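(* Let $n=4$, $p>0$ and $\beta\in\mathbb{R}$. There exists a radially symmetric continuous function $u$ on $\mathbb{R}^4$ with $(1+|x|^{4p})e^{4u}\in L^1(\mathbb{R}^4)$ satisfying, for some constant $C\in\mathbb{R}$ and all $x\in\mathbb{R}^4$, $$u(x)=\frac{2}{3!\,|\mathbb{S}^4|}\int_{\mathbb{R}^4}\log\frac{|y|}{|x-y|}\,(1+|y|^{4p})e^{4u(y)}\,dy+C$$ and $$\frac{2}{3!\,|\mathbb{S}^4|}\int_{\mathbb{R}^4}(1+|x|^{4p})e^{4u}\,dx=\beta$$ if and only if $$\max\{2,2p\}<\beta<2+2p.$$
   Context: $|\mathbb{S}^4|=\frac{8\pi^2}{3}$ is the volume of the standard unit 4-sphere. Radially symmetric means depending only on $|x|$. *)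

theory Defs
  imports "HOL-Analysis.Analysis"
begin

definition vol_S4 :: real where
  "vol_S4 = 8 * pi\<^sup>2 / 3"

text \<open>The surface measure of the unit sphere in dimension 5 is the derivative at radius 1 of
  the volume of the ball of radius r, namely of r ^ 5 times the volume of the unit ball.\<close>

lemma vol_S4_surface:
  "((\<lambda>r. measure lborel (ball (0 :: real ^ 5) r)) has_real_derivative vol_S4) (at 1)"
proof -
  have ubv: "unit_ball_vol 5 = 8 * pi\<^sup>2 / 15"
    using unit_ball_vol_numeral(2)[of "num.Bit0 num.One"] by (simp add: fact_numeral)
  have "((\<lambda>r. unit_ball_vol 5 * r ^ 5) has_real_derivative vol_S4) (at 1)"
    by (auto intro!: derivative_eq_intros simp: ubv vol_S4_def)
  moreover have "\<forall>\<^sub>F r in nhds (1::real).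
      measure lborel (ball (0 :: real ^ 5) r) = unit_ball_vol 5 * r ^ 5"
    by (rule eventually_mono[OF eventually_nhds_in_open[of "{0<..}"]]) (auto simp: content_ball)
  ultimately show ?thesis
    by (subst DERIV_cong_ev[OF refl _ refl]) auto
qed

definition radially_symmetric :: "('a::real_normed_vector \<Rightarrow> 'b) \<Rightarrow> bool" where
  "radially_symmetric u \<longleftrightarrow> (\<forall>x y. norm x = norm y \<longrightarrow> u x = u y)"

text \<open>The density of the weighted conformal volume. For \<open>p > 0\<close> the convention
  \<open>0 powr a = 0\<close> gives the correct value at the origin.\<close>

definition conf_density :: "real \<Rightarrow> (real ^ 4 \<Rightarrow> real) \<Rightarrow> real ^ 4 \<Rightarrow> real" where
  "conf_density p u x = (1 + norm x powr (4 * p)) * exp (4 * u x)"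

text \<open>The integral is a genuine Lebesgue integral: integrability is required explicitly, since the
  Bochner integral of a non-integrable function is 0. At the null set \<open>y \<in> {0, x}\<close> the logarithm
  takes an irrelevant value.\<close>

definition solves_integral_eq :: "real \<Rightarrow> (real ^ 4 \<Rightarrow> real) \<Rightarrow> real \<Rightarrow> bool" where
  "solves_integral_eq p u C \<longleftrightarrow> (\<forall>x.
     integrable lborel (\<lambda>y. ln (norm y / norm (x - y)) * conf_density p u y) \<and>
     u x = 2 / (fact 3 * vol_S4) *
       (LINT y|lborel. ln (norm y / norm (x - y)) * conf_density p u y) + C)"

end

theory Submission
  imports Defs "HOL-Real_Asymp.Real_Asymp"
begin

text \<open>
  The mean of \<open>ln (|y| / |x - y|)\<close> over the sphere \<open>|y| = s\<close> is explicit, so a radial solution solves a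
  one-dimensional integral equation. With \<open>t = ln |x|\<close> and \<open>w = u + t\<close> it becomes
  \<open>w'''' - 4 w'' = F\<close> with \<open>F = F0 + F1\<close>, \<open>F0 = e^(4w)\<close>, \<open>F1 = d e^(4w + 4pt)\<close>, where \<open>w\<close> is concave with
  slopes \<open>1\<close> at \<open>-\<infinity>\<close> and \<open>1 - \<beta>\<close> at \<open>+\<infinity>\<close>; here \<open>d\<close> is the coefficient of \<open>|x|^(4p)\<close> in the weight.
  The energy \<open>w''' w' - w''^2 / 2 - 2 w'^2 - F / 4\<close> has derivative \<open>- p F1\<close>, which gives
  \<open>\<beta>^2 - 2\<beta> = 2p (\<beta> - \<beta>0)\<close> with \<open>\<beta>0 = 1/4 \<integral> F0\<close>. Together with \<open>\<beta> > 1 + p\<close>, which follows from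
  integrability, the claim is thus equivalent to \<open>0 < \<beta>0 < 2\<close>. For the upper bound, let \<open>w'(t) = -1\<close>. Up to \<open>t\<close>
  the energy built from \<open>F0\<close> alone has derivative \<open>F1 w' \<ge> - F1\<close>, and the part of
  \<open>\<integral> F0\<close> beyond \<open>t\<close> is at most \<open>F0(t) / 4\<close>; adding up leaves \<open>\<integral> F0 \<le> 8 - w''(t)^2 / 2\<close>.

  For existence, \<open>u(0) = 0\<close> is prescribed and \<open>- \<Delta>u(0)\<close> is found by shooting, after truncating the nonlinearity to
  \<open>e^(4 min(u, 0))\<close>, which does not affect solutions of the integral equation. The solution obtained depends
  continuously on \<open>d \<ge> 0\<close>. By Fatou, \<open>\<beta>\<close> and \<open>\<beta>0\<close> are lower semicontinuous in \<open>d\<close>; since \<open>\<beta>\<close> is a decreasing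
  function of \<open>\<beta>0\<close>, both are continuous for \<open>d > 0\<close>. As \<open>\<beta>0 = 2\<close> at \<open>d = 0\<close> and \<open>\<beta>0\<close> tends to \<open>0\<close> for
  large \<open>d\<close>, every value in \<open>(0, 2)\<close> is attained, and a dilation brings \<open>d\<close> back to \<open>1\<close>.
\<close>

section \<open>Moments and the radial potential\<close>

definition weight :: "real \<Rightarrow> real \<Rightarrow> real \<Rightarrow> real" where
  "weight p d s = 1 + d * s powr (4 * p)"

definition mom :: "nat \<Rightarrow> (real \<Rightarrow> real) \<Rightarrow> real \<Rightarrow> real" where
  "mom k h r = integral {0..r} (\<lambda>s. s ^ k * h s)"

definition lmom :: "(real \<Rightarrow> real) \<Rightarrow> real \<Rightarrow> real" where
  "lmom h r = integral {0..r} (\<lambda>s. s ^ 3 * ln s * h s)"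

text \<open>
  In dimension 4, \<open>pot c h\<close> is the radial solution of \<open>\<Delta>\<^sup>2 u = h\<close> with \<open>u(0) = 0\<close> and \<open>\<Delta>u(0) = - c / 2\<close>; it is the
  logarithmic potential of \<open>h\<close> exactly when \<open>c\<close> is the full first moment of \<open>h\<close>. The kernel \<open>ker\<close>, for \<open>s \<le> r\<close>,
  is that of the Volterra operator obtained for \<open>c = 0\<close>. At \<open>r = 0\<close> all terms vanish, because \<open>ln 0 = 0\<close> and
  \<open>x / 0 = 0\<close>.
\<close>

definition pot :: "real \<Rightarrow> (real \<Rightarrow> real) \<Rightarrow> real \<Rightarrow> real" where
  "pot c h r = (lmom h r - ln r * mom 3 h r) / 4 - mom 5 h r / (16 * r\<^sup>2)
     - r\<^sup>2 / 16 * (c - mom 1 h r)"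

definition ker :: "real \<Rightarrow> real \<Rightarrow> real" where
  "ker r s = s ^ 3 * (ln s - ln r) / 4 - s ^ 5 / (16 * r\<^sup>2) + r\<^sup>2 * s / 16"

lemma continuous_on_cube_ln: "continuous_on {0..} (\<lambda>s::real. s ^ 3 * ln s)"
proof -
  have "((\<lambda>s::real. s ^ 3 * ln s) \<longlongrightarrow> 0) (at 0 within {0..})"
  proof -
    have "((\<lambda>s::real. s ^ 3 * ln s) \<longlongrightarrow> 0) (at_right 0)" by real_asymp
    moreover have "at (0::real) within {0..} = at_right 0"
      by (rule at_within_nhd[of _ "{-1<..<1}"]) auto
    ultimately show ?thesis by simp
  qed
  then have "continuous (at x within {0..}) (\<lambda>s::real. s ^ 3 * ln s)" if "x \<ge> 0" for x
    using that by (cases "x = 0") (auto simp: continuous_within intro!: tendsto_eq_intros)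
  then show ?thesis by (auto simp: continuous_on_eq_continuous_within)
qed

lemma continuous_on_weight: "p > 0 \<Longrightarrow> continuous_on {0..} (weight p d)"
  unfolding weight_def by (intro continuous_intros continuous_on_powr') auto

lemma weight_ge_1: "d \<ge> 0 \<Longrightarrow> weight p d s \<ge> 1"
  by (simp add: weight_def)

lemma has_real_derivative_indef_integral:
  fixes f :: "real \<Rightarrow> real"
  assumes "continuous_on {0..} f" "r > 0"
  shows "((\<lambda>r. integral {0..r} f) has_real_derivative f r) (at r)"
proof -
  have "((\<lambda>r. integral {0..r} f) has_real_derivative f r) (at r within {0..r+1})"
    using assms by (intro integral_has_real_derivative) (auto intro: continuous_on_subset)
  moreover have "at r within {0..r+1} = at r"
    using assms by (intro at_within_interior) auto
  ultimately show ?thesis by simp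
qed

lemma continuous_on_indef_integral:
  fixes f :: "real \<Rightarrow> real"
  assumes "\<And>r. f integrable_on {0..r}"
  shows "continuous_on {0..} (\<lambda>r. integral {0..r} f)"
proof -
  have "continuous (at x within {0..}) (\<lambda>r. integral {0..r} f)" if "x \<ge> 0" for x
  proof -
    have "continuous_on {0..x+1} (\<lambda>r. integral {0..r} f)"
      by (rule indefinite_integral_continuous_1[OF assms])
    then have "continuous (at x within {0..x+1}) (\<lambda>r. integral {0..r} f)"
      using that by (auto simp: continuous_on_eq_continuous_within)
    moreover have "at x within {0..x+1} = at x within {0..}"
      by (rule at_within_nhd[of _ "{x-1<..<x+1}"]) (use that in auto)
    ultimately show ?thesis by (simp add: continuous_within)
  qed
  then show ?thesis by (auto simp: continuous_on_eq_continuous_within)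
qed

lemma integrable_on_cont_half_line:
  fixes f :: "real \<Rightarrow> real"
  assumes "continuous_on {0..} f"
  shows "f integrable_on {0..r}"
  by (rule integrable_continuous_real) (use assms in \<open>auto intro: continuous_on_subset\<close>)

lemma continuous_on_mom_integrand:
  "continuous_on {0..} h \<Longrightarrow> continuous_on {0..} (\<lambda>s::real. s ^ k * h s)"
  by (intro continuous_intros)

lemma continuous_on_lmom_integrand:
  "continuous_on {0..} h \<Longrightarrow> continuous_on {0..} (\<lambda>s::real. s ^ 3 * ln s * h s)"
  by (intro continuous_on_mult continuous_on_cube_ln)

lemma DERIV_mom:
  assumes "continuous_on {0..} h" "r > 0"
  shows "(mom k h has_real_derivative r ^ k * h r) (at r)"
  unfolding mom_def[abs_def]
  by (rule has_real_derivative_indef_integral[OF continuous_on_mom_integrand]) (use assms in auto)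

lemma DERIV_lmom:
  assumes "continuous_on {0..} h" "r > 0"
  shows "(lmom h has_real_derivative r ^ 3 * ln r * h r) (at r)"
  unfolding lmom_def[abs_def]
  by (rule has_real_derivative_indef_integral[OF continuous_on_lmom_integrand]) (use assms in auto)

text \<open>Collecting the moments under one integral isolates the linear dependence on
  \<open>c\<close>, and the sign of \<open>ker\<close> then makes \<open>pot\<close> monotone in the
  density. The hypotheses ask for integrability only, because a limit of iterates is not known to be
  continuous in advance.\<close>

lemma pot_eq_ker:
  assumes "(\<lambda>s. s ^ 1 * h s) integrable_on {0..r}" "(\<lambda>s. s ^ 3 * h s) integrable_on {0..r}"
    "(\<lambda>s. s ^ 5 * h s) integrable_on {0..r}" "(\<lambda>s. s ^ 3 * ln s * h s) integrable_on {0..r}"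
  shows "((\<lambda>s. ker r s * h s) has_integral pot c h r + c * r\<^sup>2 / 16) {0..r}"
proof -
  have "((\<lambda>s. (s ^ 3 * ln s * h s) * (1/4) - (s ^ 3 * h s) * (ln r / 4) - (s ^ 5 * h s) * (1 / (16 * r\<^sup>2))
      + (s ^ 1 * h s) * (r\<^sup>2 / 16)) has_integral
      lmom h r * (1/4) - mom 3 h r * (ln r / 4) - mom 5 h r * (1 / (16 * r\<^sup>2)) + mom 1 h r * (r\<^sup>2 / 16)) {0..r}"
    unfolding lmom_def mom_def
    by (intro has_integral_add has_integral_diff has_integral_mult_left integrable_integral assms)
  moreover have "(\<lambda>s. (s ^ 3 * ln s * h s) * (1/4) - (s ^ 3 * h s) * (ln r / 4) - (s ^ 5 * h s) * (1 / (16 * r\<^sup>2))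
      + (s ^ 1 * h s) * (r\<^sup>2 / 16)) = (\<lambda>s. ker r s * h s)"
    by (auto simp: ker_def algebra_simps add_divide_distrib diff_divide_distrib)
  moreover have "lmom h r * (1/4) - mom 3 h r * (ln r / 4) - mom 5 h r * (1 / (16 * r\<^sup>2)) + mom 1 h r * (r\<^sup>2 / 16)
     = pot c h r + c * r\<^sup>2 / 16"
    by (simp add: pot_def algebra_simps add_divide_distrib diff_divide_distrib)
  ultimately show ?thesis by simp
qed

text \<open>For \<open>x = r / s\<close> this is the positivity of \<open>ker\<close>. Both sides
  vanish at 1, and the difference has derivative
  \<open>(x\<^sup>2 - 1)\<^sup>2 / (2 * x ^ 3)\<close>.\<close>

lemma ln_le_quarter_sq: 
  fixes x :: real assumes "x \<ge> 1" shows "ln x \<le> (x\<^sup>2 - 1 / x\<^sup>2) / 4"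
proof -
  have "x\<^sup>2 > 0" using assms by simp
  let ?f = "\<lambda>x::real. (x\<^sup>2 - 1 / x\<^sup>2) / 4 - ln x"
  have "?f 1 \<le> ?f x"
  proof (rule DERIV_nonneg_imp_nondecreasing[OF assms])
    fix y :: real assume y: "1 \<le> y" "y \<le> x"
    have "(?f has_real_derivative (2 * y + 2 / y ^ 3) / 4 - 1 / y) (at y)"
      using y by (auto intro!: derivative_eq_intros simp: field_simps power2_eq_square power3_eq_cube)
    moreover have "(2 * y + 2 / y ^ 3) / 4 - 1 / y = (y\<^sup>2 - 1)\<^sup>2 / (2 * y ^ 3)"
      using y by (simp add: field_simps power2_eq_square power3_eq_cube)
    moreover have "\<dots> \<ge> 0" using y by simp
    ultimately show "\<exists>D. (?f has_real_derivative D) (at y) \<and> 0 \<le> D" by metis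
  qed
  then show ?thesis by simp
qed

lemma ker_bounds:
  assumes "0 \<le> s" "s \<le> r"
  shows "0 \<le> ker r s" "ker r s \<le> r\<^sup>2 * s / 16"
proof -
  show "ker r s \<le> r\<^sup>2 * s / 16"
  proof (cases "s = 0")
    case False
    then have "s ^ 3 * (ln s - ln r) \<le> 0" "s ^ 5 / (16 * r\<^sup>2) \<ge> 0"
      using assms by (auto intro!: mult_nonneg_nonpos)
    then show ?thesis unfolding ker_def by linarith
  qed (simp add: ker_def)
  show "0 \<le> ker r s"
  proof (cases "s = 0")
    case False
    then have s: "s > 0" "r > 0" using assms by auto
    have "ker r s = s ^ 3 / 4 * (((r/s)\<^sup>2 - 1 / (r/s)\<^sup>2) / 4 - ln (r/s))"
      using s by (simp add: ker_def ln_div field_simps power2_eq_square power3_eq_cube numeral_eq_Suc)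
    also have "\<dots> \<ge> 0"
      using ln_le_quarter_sq[of "r/s"] s assms by (intro mult_nonneg_nonneg) auto
    finally show ?thesis .
  qed (simp add: ker_def)
qed

section \<open>Radial solutions in logarithmic coordinates\<close>

lemma mom_nonneg:
  assumes "\<And>s. s \<ge> 0 \<Longrightarrow> h s \<ge> 0"
  shows "mom k h r \<ge> 0"
\<comment> \<open>For an integrand that is not integrable, \<open>integral\<close> returns
  0.\<close>
proof (cases "(\<lambda>s. s ^ k * h s) integrable_on {0..r}")
  case True
  then show ?thesis unfolding mom_def by (rule integral_nonneg) (use assms in auto)
qed (simp add: mom_def not_integrable_integral)

lemma mom_0 [simp]: "mom k h 0 = 0"
  by (simp add: mom_def)

lemma mom_diff:
  assumes "continuous_on {0..} h" "0 \<le> a" "a \<le> b"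
  shows "mom k h b - mom k h a = integral {a..b} (\<lambda>s. s ^ k * h s)"
  using Henstock_Kurzweil_Integration.integral_combine[OF assms(2,3) integrable_on_cont_half_line[OF continuous_on_mom_integrand[OF assms(1)]], of k]
  by (simp add: mom_def)

lemma mom_integrand_integrable:
  assumes "continuous_on {0..} h" "0 \<le> a"
  shows "(\<lambda>s::real. s ^ k * h s) integrable_on {a..b}"
  by (rule integrable_continuous_real[OF continuous_on_subset[OF continuous_on_mom_integrand[OF assms(1)]]])
     (use assms(2) in auto)

lemma mom_mono:
  assumes "continuous_on {0..} h" "\<And>s. s \<ge> 0 \<Longrightarrow> h s \<ge> 0" "0 \<le> a" "a \<le> b"
  shows "mom k h a \<le> mom k h b"
proof -
  have "integral {a..b} (\<lambda>s. s ^ k * h s) \<ge> 0"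
    by (rule Henstock_Kurzweil_Integration.integral_nonneg[OF mom_integrand_integrable])
       (use assms in auto)
  with mom_diff[OF assms(1,3,4), of k] show ?thesis by simp
qed

text \<open>On \<open>{a..b}\<close> the extra factor \<open>s\<^sup>2\<close> lies between
  \<open>a\<^sup>2\<close> and \<open>b\<^sup>2\<close>. These bounds control \<open>P\<close> and
  \<open>N\<close> by the mass \<open>J\<close>.\<close>

lemma mom_shift_bounds:
  assumes "continuous_on {0..} h" "\<And>s. s \<ge> 0 \<Longrightarrow> h s \<ge> 0" "0 \<le> a" "a \<le> b"
  shows "a\<^sup>2 * (mom k h b - mom k h a) \<le> mom (k + 2) h b - mom (k + 2) h a"
    and "mom (k + 2) h b - mom (k + 2) h a \<le> b\<^sup>2 * (mom k h b - mom k h a)"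
proof -
  have int: "(\<lambda>s. s ^ k * h s) integrable_on {a..b}" for k
    by (rule mom_integrand_integrable) (use assms in auto)
  have "integral {a..b} (\<lambda>s. a\<^sup>2 * (s ^ k * h s)) \<le> integral {a..b} (\<lambda>s. s ^ (k + 2) * h s)"
  proof (rule Henstock_Kurzweil_Integration.integral_le)
    fix s assume s: "s \<in> {a..b}"
    then have "a\<^sup>2 * (s ^ k * h s) \<le> s\<^sup>2 * (s ^ k * h s)"
      using assms by (intro mult_right_mono power_mono mult_nonneg_nonneg) auto
    then show "a\<^sup>2 * (s ^ k * h s) \<le> s ^ (k + 2) * h s" by (simp add: power_add mult_ac power2_eq_square)
  qed (use int[of "k+2"] integrable_on_mult_right[OF int[of k]] in auto)
  then show "a\<^sup>2 * (mom k h b - mom k h a) \<le> mom (k + 2) h b - mom (k + 2) h a"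
    using assms by (simp only: mom_diff[OF assms(1,3,4)] Henstock_Kurzweil_Integration.integral_mult_right)
  have "integral {a..b} (\<lambda>s. s ^ (k + 2) * h s) \<le> integral {a..b} (\<lambda>s. b\<^sup>2 * (s ^ k * h s))"
  proof (rule Henstock_Kurzweil_Integration.integral_le)
    fix s assume s: "s \<in> {a..b}"
    then have "s\<^sup>2 * (s ^ k * h s) \<le> b\<^sup>2 * (s ^ k * h s)"
      using assms by (intro mult_right_mono power_mono mult_nonneg_nonneg) auto
    then show "s ^ (k + 2) * h s \<le> b\<^sup>2 * (s ^ k * h s)" by (simp add: power_add mult_ac power2_eq_square)
  qed (use int[of "k+2"] integrable_on_mult_right[OF int[of k]] in auto)
  then show "mom (k + 2) h b - mom (k + 2) h a \<le> b\<^sup>2 * (mom k h b - mom k h a)"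
    using assms by (simp only: mom_diff[OF assms(1,3,4)] Henstock_Kurzweil_Integration.integral_mult_right)
qed

lemma DERIV_comp_exp:
  assumes "(f has_real_derivative f' ) (at (exp t))"
  shows "((\<lambda>t. f (exp t)) has_real_derivative f' * exp t) (at t)"
  using DERIV_chain2[OF assms DERIV_exp] .

definition radial_density :: "real \<Rightarrow> real \<Rightarrow> (real \<Rightarrow> real) \<Rightarrow> real \<Rightarrow> real" where
  "radial_density p d u s = weight p d s * exp (4 * u s)"

text \<open>The coefficient \<open>d\<close> is kept general because existence is obtained by
  varying it, with the unweighted case \<open>d = 0\<close> at one end; the theorem itself concerns
  \<open>d = 1\<close>.\<close>

locale radial_solution =
  fixes p d C c :: real and u :: "real \<Rightarrow> real"
  assumes p_pos: "p > 0" and d_nonneg: "d \<ge> 0"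
    and cont_u: "continuous_on {0..} u"
    and mom1_lim: "(mom 1 (radial_density p d u) \<longlongrightarrow> c) at_top"
    and u_eq: "\<And>r. r > 0 \<Longrightarrow> u r = C + pot c (radial_density p d u) r"
begin

abbreviation "h \<equiv> radial_density p d u"

lemma cont_h: "continuous_on {0..} h"
  unfolding radial_density_def[abs_def]
  by (intro continuous_intros continuous_on_weight p_pos cont_u)

lemma h_pos: "h s > 0"
  using weight_ge_1[OF d_nonneg, of p s] by (simp add: radial_density_def)

lemma h_nonneg: "h s \<ge> 0"
  using h_pos[of s] by simp

text \<open>Below, \<open>q = w'\<close>, \<open>v = - w''\<close> and \<open>v1 = v'\<close>; \<open>P\<close> and \<open>N\<close> are the contributions to \<open>4 v\<close> of the source on the left
  and on the right of \<open>t\<close>.\<close>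

definition w where "w t = t + u (exp t)"
definition F0 where "F0 t = exp (4 * w t)"
definition F1 where "F1 t = d * exp (4 * w t + 4 * p * t)"
definition F where "F t = F0 t + F1 t"
text \<open>In the variable \<open>t\<close>, \<open>J\<close> and \<open>J0\<close> are the
  integrals of \<open>F\<close> and \<open>F0\<close> over the half-line to the left of
  \<open>t\<close>.\<close>

definition J where "J t = mom 3 h (exp t)"
definition J0 where "J0 t = mom 3 (\<lambda>s. exp (4 * u s)) (exp t)"
definition P where "P t = mom 5 h (exp t) / (exp t)\<^sup>2"
definition N where "N t = (exp t)\<^sup>2 * (c - mom 1 h (exp t))"
definition q where "q t = 1 - (J t / 4 - P t / 8 + N t / 8)"
definition v where "v t = (P t + N t) / 4"
definition v1 where "v1 t = (N t - P t) / 2"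

lemma F0_eq: "F0 t = exp t * (exp t ^ 3 * exp (4 * u (exp t)))"
proof -
  have "exp t * exp t ^ 3 = exp (4 * t)"
    using exp_of_nat_mult[of 4 t] by (simp add: numeral_eq_Suc)
  then show ?thesis by (simp add: F0_def w_def distrib_left exp_add flip: mult.assoc)
qed

lemma F_eq: "F t = exp t * (exp t ^ 3 * h (exp t))"
proof -
  have "F1 t = d * exp (4 * p * t) * F0 t"
    by (simp add: F1_def F0_def exp_add)
  moreover have "exp t powr (4 * p) = exp (4 * p * t)" by (simp add: powr_def)
  ultimately have "F t = weight p d (exp t) * F0 t"
    by (simp add: F_def weight_def distrib_right)
  then show ?thesis by (simp add: F0_eq radial_density_def)
qed

lemma DERIV_J: "(J has_real_derivative F t) (at t)"
  unfolding J_def[abs_def]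
  by (rule DERIV_cong[OF DERIV_comp_exp[OF DERIV_mom[OF cont_h]]]) (auto simp: F_eq)

lemma DERIV_J0: "(J0 has_real_derivative F0 t) (at t)"
  unfolding J0_def[abs_def]
  by (rule DERIV_cong[OF DERIV_comp_exp[OF DERIV_mom]]) 
     (auto simp: F0_eq intro!: continuous_intros cont_u)

lemma exp_sq: "(exp t)\<^sup>2 = exp (2 * t)" for t :: real
  by (simp add: exp_double)

text \<open>Variation of constants: \<open>P t\<close> is the integral of
  \<open>exp (- 2 * (t - s)) * F s\<close> over \<open>s \<le> t\<close>, and \<open>N t\<close>
  that of \<open>exp (2 * (t - s)) * F s\<close> over \<open>s \<ge> t\<close>. The two first-order
  equations together give \<open>4 * v - v'' = F\<close>.\<close>

lemma DERIV_P: "(P has_real_derivative F t - 2 * P t) (at t)"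
proof -
  have D: "((\<lambda>t. mom 5 h (exp t)) has_real_derivative (exp t ^ 5 * h (exp t) * exp t)) (at t)"
    by (rule DERIV_comp_exp[OF DERIV_mom[OF cont_h]]) auto
  have E: "((\<lambda>t. exp (- 2 * t)) has_real_derivative (- 2 * exp (- 2 * t))) (at t)"
    by (auto intro!: derivative_eq_intros)
  have P: "P = (\<lambda>t. mom 5 h (exp t) * exp (- 2 * t))"
    by (simp add: P_def[abs_def] exp_sq exp_minus divide_inverse)
  have "exp t ^ 5 * exp (- 2 * t) = exp t ^ 3"
    by (simp add: mult_exp_exp flip: exp_of_nat_mult)
  then have "(exp t ^ 5 * h (exp t) * exp t) * exp (- 2 * t) = F t"
    unfolding F_eq by (metis mult.assoc mult.commute)
  with DERIV_mult[OF D E] show ?thesis 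
    unfolding P by (simp add: mult_ac)
qed

lemma DERIV_N: "(N has_real_derivative 2 * N t - F t) (at t)"
proof -
  have D: "((\<lambda>t. c - mom 1 h (exp t)) has_real_derivative - (exp t ^ 1 * h (exp t) * exp t)) (at t)"
    using DERIV_diff[OF DERIV_const[of c] DERIV_comp_exp[OF DERIV_mom[OF cont_h, of "exp t" 1]]] by simp
  have E: "((\<lambda>t. exp (2 * t)) has_real_derivative (2 * exp (2 * t))) (at t)"
    by (auto intro!: derivative_eq_intros)
  have N: "N = (\<lambda>t. exp (2 * t) * (c - mom 1 h (exp t)))"
    by (simp add: N_def[abs_def] exp_sq)
  have "exp t * exp (2 * t) = exp t ^ 3"
    by (simp add: mult_exp_exp flip: exp_of_nat_mult)
  then have "(exp t ^ 1 * h (exp t) * exp t) * exp (2 * t) = F t"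
    unfolding F_eq by (metis mult.assoc mult.commute power_one_right)
  with DERIV_mult[OF E D] show ?thesis 
    unfolding N by (simp add: mult_ac)
qed

lemma DERIV_w: "(w has_real_derivative q t) (at t)"
proof -
  have "w = (\<lambda>t. t + C + (lmom h (exp t) - t * J t) / 4 - P t / 16 - N t / 16)"
    by (auto simp: w_def u_eq pot_def J_def P_def N_def)
  moreover have D: "((\<lambda>t. lmom h (exp t)) has_real_derivative (exp t ^ 3 * ln (exp t) * h (exp t) * exp t)) (at t)"
    by (rule DERIV_comp_exp[OF DERIV_lmom[OF cont_h]]) auto
  \<comment> \<open>The derivative \<open>t * F t\<close> of the logarithmic moment cancels against
    the product rule for \<open>t * J t\<close>, leaving only \<open>- J t / 4\<close>.\<close>
  have "((\<lambda>t. t + C + (lmom h (exp t) - t * J t) / 4 - P t / 16 - N t / 16) has_real_derivative q t) (at t)"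
    by (auto intro!: derivative_eq_intros D DERIV_J DERIV_P DERIV_N simp: F_eq q_def field_simps)
  ultimately show ?thesis by simp
qed

lemma DERIV_q: "(q has_real_derivative - v t) (at t)"
  unfolding q_def[abs_def]
  by (auto intro!: derivative_eq_intros DERIV_J DERIV_P DERIV_N simp: v_def field_simps)

lemma DERIV_v: "(v has_real_derivative v1 t) (at t)"
  unfolding v_def[abs_def]
  by (auto intro!: derivative_eq_intros DERIV_J DERIV_P DERIV_N simp: v1_def field_simps)

lemma DERIV_v1: "(v1 has_real_derivative 4 * v t - F t) (at t)"
  unfolding v1_def[abs_def]
  by (auto intro!: derivative_eq_intros DERIV_J DERIV_P DERIV_N simp: v_def field_simps)

lemma DERIV_F0: "(F0 has_real_derivative 4 * q t * F0 t) (at t)"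
  unfolding F0_def[abs_def]
  by (auto intro!: derivative_eq_intros DERIV_w simp: algebra_simps)

lemma DERIV_F1: "(F1 has_real_derivative 4 * (q t + p) * F1 t) (at t)"
  unfolding F1_def[abs_def]
  by (auto intro!: derivative_eq_intros DERIV_w simp: algebra_simps)

lemma DERIV_F: "(F has_real_derivative 4 * q t * F t + 4 * p * F1 t) (at t)"
  unfolding F_def[abs_def]
  by (auto intro!: derivative_eq_intros DERIV_F0 DERIV_F1 simp: algebra_simps)

text \<open>This is \<open>w'''' - 4 w'' = F\<close> integrated from minus infinity, where
  \<open>w'\<close> tends to 1 and \<open>w'''\<close> to 0.\<close>

lemma J_eq: "J t = 4 - 4 * q t - v1 t"
  by (simp add: q_def v1_def field_simps)

lemma F0_pos: "F0 t > 0" and F1_nonneg: "F1 t \<ge> 0" and F_pos: "F t > 0"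
  using d_nonneg by (auto simp: F0_def F1_def F_def add_pos_nonneg)

lemma J_nonneg: "J t \<ge> 0"
  unfolding J_def by (rule mom_nonneg[OF h_nonneg])

lemma J_mono: "s \<le> t \<Longrightarrow> J s \<le> J t"
  unfolding J_def by (rule mom_mono[OF cont_h h_nonneg]) auto

lemma mom1_le: "r \<ge> 0 \<Longrightarrow> mom 1 h r \<le> c"
  by (rule tendsto_lowerbound[OF mom1_lim eventually_mono[OF eventually_ge_at_top[of r]]])
     (auto intro: mom_mono[OF cont_h h_nonneg])

lemma N_nonneg: "N t \<ge> 0"
  unfolding N_def using mom1_le[of "exp t"] by simp

lemma P_nonneg: "P t \<ge> 0"
  unfolding P_def by (auto intro!: divide_nonneg_nonneg mom_nonneg h_nonneg)

lemma P_le_J: "P t \<le> J t"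
  using mom_shift_bounds(2)[OF cont_h h_nonneg, of 0 "exp t" 3]
  by (simp add: P_def J_def field_simps)

text \<open>At a zero of \<open>P\<close> the equation \<open>P' = F - 2 * P\<close> gives a
  positive derivative, so \<open>P\<close> would be negative just to the left.\<close>

lemma P_pos: "P t > 0"
proof (rule ccontr)
  assume "\<not> P t > 0"
  then have P0: "P t = 0" using P_nonneg[of t] by simp
  have "\<exists>s<t. P s < 0"
  proof -
    have "F t - 2 * P t > 0" using P0 F_pos by simp
    from DERIV_pos_inc_left[OF DERIV_P this] obtain e where e: "e > 0" "\<And>k. k > 0 \<Longrightarrow> k < e \<Longrightarrow> P (t - k) < P t"
      by auto
    show ?thesis using e(2)[of "e/2"] e(1) P0 by (intro exI[of _ "t - e/2"]) auto
  qed
  with P_nonneg show False by (metis not_less)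
qed

lemma v_pos: "v t > 0"
  using P_pos[of t] N_nonneg[of t] by (simp add: v_def)

lemma q_antimono: "s < t \<Longrightarrow> q t < q s"
  by (rule DERIV_neg_imp_decreasing) (use DERIV_q v_pos in force)+

text \<open>A large mass accumulated up to \<open>t\<close> forces a steep negative slope. This a
  priori bound is what makes the total mass finite.\<close>

lemma q_le: "q t \<le> 1 - J t / 8"
  using P_le_J[of t] N_nonneg[of t] by (simp add: q_def)

end

section \<open>Asymptotics and the energy identity\<close>

lemma tendsto_SUP_mono_at_top:
  fixes f :: "real \<Rightarrow> real"
  assumes "\<And>s t. s \<le> t \<Longrightarrow> f s \<le> f t" "bdd_above (range f)"
  shows "(f \<longlongrightarrow> (SUP t. f t)) at_top"
proof (rule order_tendstoI)
  fix a assume "a < (SUP t. f t)"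
  then obtain t where "a < f t" using less_cSUP_iff[OF _ assms(2)] by auto
  then show "\<forall>\<^sub>F x in at_top. a < f x"
    using assms(1) by (intro eventually_mono[OF eventually_ge_at_top[of t]]) (auto intro: less_le_trans)
next
  fix a assume "a > (SUP t. f t)"
  then show "\<forall>\<^sub>F x in at_top. a > f x"
    using cSUP_upper[OF _ assms(2)] by (intro always_eventually allI) (meson UNIV_I le_less_trans)
qed

lemma continuous_on_mom: "continuous_on {0..} h \<Longrightarrow> continuous_on {0..} (mom k h)"
  unfolding mom_def[abs_def]
  by (intro continuous_on_indef_integral mom_integrand_integrable) auto

section \<open>Limits at minus infinity\<close>

lemma tendsto_exp_at_bot_within: 
  fixes f :: "real \<Rightarrow> real"
  assumes "continuous_on {0..} f"
  shows "((\<lambda>t. f (exp t)) \<longlongrightarrow> f 0) at_bot"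
proof -
  have "(f \<longlongrightarrow> f 0) (at 0 within {0..})"
    using assms by (auto simp: continuous_on_def)
  moreover have "filterlim exp (at (0::real) within {0..}) at_bot"
    by (auto simp: filterlim_at intro!: exp_at_bot)
  ultimately show ?thesis by (rule filterlim_compose)
qed

context radial_solution
begin

lemma J_at_bot: "(J \<longlongrightarrow> 0) at_bot"
  using tendsto_exp_at_bot_within[OF continuous_on_mom[OF cont_h, of 3]] by (simp add: J_def[abs_def])

lemma J0_at_bot: "(J0 \<longlongrightarrow> 0) at_bot"
proof -
  have "continuous_on {0..} (\<lambda>s. exp (4 * u s))"
    by (intro continuous_intros cont_u)
  from tendsto_exp_at_bot_within[OF continuous_on_mom[OF this, of 3]] show ?thesis by (simp add: J0_def[abs_def])
qed

lemma P_at_bot: "(P \<longlongrightarrow> 0) at_bot"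
  by (rule tendsto_sandwich[OF _ _ tendsto_const J_at_bot]) (auto intro!: always_eventually P_nonneg P_le_J)

lemma N_at_bot: "(N \<longlongrightarrow> 0) at_bot"
proof -
  have "((\<lambda>t. (exp t)\<^sup>2 * (c - mom 1 h (exp t))) \<longlongrightarrow> 0\<^sup>2 * (c - mom 1 h 0)) at_bot"
    by (intro tendsto_intros exp_at_bot tendsto_exp_at_bot_within continuous_on_mom cont_h)
  then show ?thesis by (simp add: N_def[abs_def])
qed

lemma F_at_bot: "(F \<longlongrightarrow> 0) at_bot"
proof -
  have "((\<lambda>t. exp t * (exp t ^ 3 * h (exp t))) \<longlongrightarrow> 0 * (0 ^ 3 * h 0)) at_bot"
    by (intro tendsto_intros exp_at_bot tendsto_exp_at_bot_within cont_h)
  then show ?thesis by (simp flip: F_eq)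
qed

lemma F0_at_bot: "(F0 \<longlongrightarrow> 0) at_bot"
  by (rule tendsto_sandwich[OF _ _ tendsto_const F_at_bot]) 
     (auto intro!: always_eventually F0_pos[THEN less_imp_le] simp: F_def F1_nonneg)

lemma q_at_bot: "(q \<longlongrightarrow> 1) at_bot"
proof -
  have "((\<lambda>t. 1 - (J t / 4 - P t / 8 + N t / 8)) \<longlongrightarrow> 1 - (0 / 4 - 0 / 8 + 0 / 8)) at_bot"
    by (intro tendsto_intros J_at_bot P_at_bot N_at_bot) auto
  then show ?thesis by (simp add: q_def[abs_def])
qed

lemma v_at_bot: "(v \<longlongrightarrow> 0) at_bot"
  using tendsto_divide[OF tendsto_add[OF P_at_bot N_at_bot] tendsto_const[of 4]] by (simp add: v_def[abs_def])

lemma v1_at_bot: "(v1 \<longlongrightarrow> 0) at_bot"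
  using tendsto_divide[OF tendsto_diff[OF N_at_bot P_at_bot] tendsto_const[of 2]] by (simp add: v1_def[abs_def])

text \<open>Finiteness of the mass is derived from the equation. Once \<open>J\<close> exceeds
  \<open>8 * (2 + p)\<close>, \<open>q_le\<close> gives slope at most \<open>- 1 - p\<close> from
  then on, and \<open>J + F / 4\<close>, with derivative
  \<open>F0 * (1 + q) + F1 * (1 + q + p)\<close>, can no longer increase.\<close>

lemma bdd_J: "bdd_above (range J)"
proof (cases "\<exists>t0. J t0 > 8 * (2 + p)")
  case True
  then obtain t0 where "J t0 > 8 * (2 + p)" by auto
  then have q0: "q t0 \<le> - 1 - p" using q_le[of t0] by simp
  have le: "J t \<le> J t0 + F t0 / 4" if "t \<ge> t0" for t
  proof -
    have "J t + F t / 4 \<le> J t0 + F t0 / 4"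
    proof (rule DERIV_nonpos_imp_nonincreasing[OF that])
      fix x assume x: "t0 \<le> x" "x \<le> t"
      have qx: "q x \<le> - 1 - p" using q_antimono[of t0 x] q0 x by (cases "x = t0") auto
      have "((\<lambda>t. J t + F t / 4) has_real_derivative F x + (4 * q x * F x + 4 * p * F1 x) / 4) (at x)"
        by (auto intro!: derivative_eq_intros DERIV_J DERIV_F)
      then have "((\<lambda>t. J t + F t / 4) has_real_derivative F0 x * (1 + q x) + F1 x * (1 + q x + p)) (at x)"
        by (rule DERIV_cong) (simp add: F_def algebra_simps)
      moreover have "F0 x * (1 + q x) + F1 x * (1 + q x + p) \<le> 0"
      proof -
        have "F0 x * (1 + q x) \<le> 0" "F1 x * (1 + q x + p) \<le> 0"
          using qx F0_pos[of x] F1_nonneg[of x] p_pos by (auto intro!: mult_nonneg_nonpos)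
        then show ?thesis by linarith
      qed
      ultimately show "\<exists>y. ((\<lambda>t. J t + F t / 4) has_real_derivative y) (at x) \<and> y \<le> 0" by blast
    qed
    then show ?thesis using F_pos[of t] by linarith
  qed
  have "J t \<le> J t0 + F t0 / 4" for t
    using le[of t] J_mono[of t t0] F_pos[of t0] by (cases "t \<ge> t0") auto
  then show ?thesis by (auto simp: bdd_above_def)
next
  case False
  then show ?thesis by (auto simp: bdd_above_def not_less)
qed

definition Jinf where "Jinf = (SUP t. J t)"

lemma J_at_top: "(J \<longlongrightarrow> Jinf) at_top"
  unfolding Jinf_def by (rule tendsto_SUP_mono_at_top[OF J_mono bdd_J])

lemma J_le_Jinf: "J t \<le> Jinf"
  unfolding Jinf_def by (rule cSUP_upper[OF _ bdd_J]) simp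

lemma Jinf_pos: "Jinf > 0"
proof -
  have "J 0 < J 1"
    by (rule DERIV_pos_imp_increasing) (use DERIV_J F_pos in force)+
  then show ?thesis using J_nonneg[of 0] J_le_Jinf[of 1] by linarith
qed

lemma J0_le_J: "J0 t \<le> J t"
  unfolding J0_def J_def mom_def
proof (rule Henstock_Kurzweil_Integration.integral_le)
  show "(\<lambda>s. s ^ 3 * exp (4 * u s)) integrable_on {0..exp t}"
    by (intro mom_integrand_integrable continuous_intros cont_u) auto
  show "(\<lambda>s. s ^ 3 * h s) integrable_on {0..exp t}"
    by (intro mom_integrand_integrable cont_h) auto
  fix s assume "s \<in> {0..exp t}"
  then show "s ^ 3 * exp (4 * u s) \<le> s ^ 3 * h s"
    using weight_ge_1[OF d_nonneg, of p s] by (auto simp: radial_density_def intro!: mult_left_mono)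
qed

lemma J0_mono: "s \<le> t \<Longrightarrow> J0 s \<le> J0 t"
  unfolding J0_def by (rule mom_mono) (auto intro!: continuous_intros cont_u)

lemma bdd_J0: "bdd_above (range J0)"
  using J0_le_J J_le_Jinf by (meson bdd_aboveI2 order_trans)

definition J0inf where "J0inf = (SUP t. J0 t)"

lemma J0_at_top: "(J0 \<longlongrightarrow> J0inf) at_top"
  unfolding J0inf_def by (rule tendsto_SUP_mono_at_top[OF J0_mono bdd_J0])

lemma J0_le_J0inf: "J0 t \<le> J0inf"
  unfolding J0inf_def by (rule cSUP_upper[OF _ bdd_J0]) simp

lemma J0inf_pos: "J0inf > 0"
proof -
  have "J0 0 < J0 1"
    by (rule DERIV_pos_imp_increasing) (use DERIV_J0 F0_pos in force)+
  moreover have "J0 0 \<ge> 0" unfolding J0_def by (rule mom_nonneg) simp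
  ultimately show ?thesis using J0_le_J0inf[of 1] by linarith
qed

text \<open>Beyond the radius \<open>exp t\<close> one has
  \<open>(exp t)\<^sup>2 \<le> s\<^sup>2\<close>, so \<open>N t\<close> is at most the mass still to
  come.\<close>

lemma N_at_top: "(N \<longlongrightarrow> 0) at_top"
proof (rule tendsto_sandwich[OF _ _ tendsto_const])
  show "((\<lambda>t. Jinf - J t) \<longlongrightarrow> 0) at_top"
    using tendsto_diff[OF tendsto_const[of Jinf] J_at_top] by simp
  have "N t \<le> Jinf - J t" for t
  proof -
    have "((\<lambda>r. (exp t)\<^sup>2 * (mom 1 h r - mom 1 h (exp t))) \<longlongrightarrow> N t) at_top"
      unfolding N_def by (intro tendsto_intros mom1_lim)
    then show ?thesis
    proof (rule tendsto_upperbound[OF _ eventually_mono[OF eventually_ge_at_top[of "exp t"]]])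
      fix r assume r: "exp t \<le> r"
      then have "r > 0" by (meson exp_gt_zero less_le_trans)
      have "(exp t)\<^sup>2 * (mom 1 h r - mom 1 h (exp t)) \<le> mom 3 h r - mom 3 h (exp t)"
        using mom_shift_bounds(1)[OF cont_h h_nonneg _ r, of 1] by (simp add: numeral_3_eq_3)
      also have "\<dots> \<le> Jinf - J t"
        using J_le_Jinf[of "ln r"] \<open>r > 0\<close> by (simp add: J_def)
      finally show "(exp t)\<^sup>2 * (mom 1 h r - mom 1 h (exp t)) \<le> Jinf - J t" .
    qed auto
  qed
  then show "\<forall>\<^sub>F t in at_top. N t \<le> Jinf - J t" by simp
qed (simp add: N_nonneg)

text \<open>The source is split at a late \<open>t0\<close>: what lies before \<open>t0\<close> is
  damped by \<open>exp (- 2 * t)\<close>, and what lies after contributes at most the remaining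
  mass.\<close>

lemma P_at_top: "(P \<longlongrightarrow> 0) at_top"
proof (rule tendstoI)
  fix e :: real assume e: "e > 0"
  have "\<forall>\<^sub>F t in at_top. J t > Jinf - e / 2"
    using J_at_top by (rule order_tendstoD) (use e in auto)
  then obtain t0 where t0: "J t0 > Jinf - e / 2" by (auto simp: eventually_at_top_linorder)
  have "((\<lambda>t. mom 5 h (exp t0) / (exp t)\<^sup>2) \<longlongrightarrow> 0) at_top"
  proof -
    have "((\<lambda>t. k / (exp t)\<^sup>2) \<longlongrightarrow> 0) at_top" for k :: real by real_asymp
    then show ?thesis .
  qed
  then have "\<forall>\<^sub>F t in at_top. mom 5 h (exp t0) / (exp t)\<^sup>2 < e / 2"
    by (rule order_tendstoD) (use e in auto)
  with eventually_ge_at_top[of t0] show "\<forall>\<^sub>F t in at_top. dist (P t) 0 < e"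
  proof eventually_elim
    case (elim t)
    have "mom 5 h (exp t) - mom 5 h (exp t0) \<le> (exp t)\<^sup>2 * (J t - J t0)"
      using mom_shift_bounds(2)[OF cont_h h_nonneg, of "exp t0" "exp t" 3] elim by (simp add: J_def)
    also have "\<dots> \<le> (exp t)\<^sup>2 * (e / 2)"
      using t0 J_le_Jinf[of t] by (intro mult_left_mono) auto
    finally have "mom 5 h (exp t) / (exp t)\<^sup>2 \<le> mom 5 h (exp t0) / (exp t)\<^sup>2 + e / 2"
      by (simp add: field_simps)
    then have "P t < e" using elim unfolding P_def by linarith
    then show ?case using P_nonneg[of t] by simp
  qed
qed

lemma q_at_top: "(q \<longlongrightarrow> 1 - Jinf / 4) at_top"
proof -
  have "((\<lambda>t. 1 - (J t / 4 - P t / 8 + N t / 8)) \<longlongrightarrow> 1 - (Jinf / 4 - 0 / 8 + 0 / 8)) at_top"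
    by (intro tendsto_intros J_at_top P_at_top N_at_top) auto
  then show ?thesis by (simp add: q_def[abs_def])
qed

lemma v_at_top: "(v \<longlongrightarrow> 0) at_top"
  using tendsto_divide[OF tendsto_add[OF P_at_top N_at_top] tendsto_const[of 4]] by (simp add: v_def[abs_def])

lemma v1_at_top: "(v1 \<longlongrightarrow> 0) at_top"
  using tendsto_divide[OF tendsto_diff[OF N_at_top P_at_top] tendsto_const[of 2]] by (simp add: v1_def[abs_def])

lemma q_gt_lim: "q t > 1 - Jinf / 4"
proof -
  have "1 - Jinf / 4 \<le> q (t + 1)"
    by (rule tendsto_upperbound[OF q_at_top eventually_mono[OF eventually_ge_at_top[of "t + 1"]]])
       (use q_antimono in \<open>auto simp: le_less\<close>)
  then show ?thesis using q_antimono[of t "t + 1"] by simp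
qed

text \<open>A positive lower bound for \<open>F\<close> would make its integral \<open>J\<close>
  grow linearly, against \<open>J \<le> Jinf\<close>.\<close>

lemma unbounded_contra:
  assumes "\<And>t. t \<ge> 0 \<Longrightarrow> F t \<ge> a" "a > 0"
  shows False
proof -
  have "J t \<ge> J 0 + a * t" if "t \<ge> 0" for t
  proof -
    have "J 0 - a * 0 \<le> J t - a * t"
    proof (rule DERIV_nonneg_imp_nondecreasing[OF that])
      fix x assume x: "0 \<le> x" "x \<le> t"
      have "((\<lambda>t. J t - a * t) has_real_derivative F x - a) (at x)"
        by (auto intro!: derivative_eq_intros DERIV_J)
      then show "\<exists>y. ((\<lambda>t. J t - a * t) has_real_derivative y) (at x) \<and> y \<ge> 0" 
        using assms(1)[OF x(1)] by force
    qed
    then show ?thesis by simp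
  qed
  from this[of "(Jinf + 1) / a"] J_nonneg[of 0] J_le_Jinf[of "(Jinf + 1) / a"] Jinf_pos assms(2)
  show False by simp
qed

lemma q_eventually_neg: "\<exists>t0. q t0 < 0"
proof (rule ccontr)
  assume "\<not> ?thesis"
  then have q: "q t \<ge> 0" for t by (auto simp: not_less)
  have q': "4 * q x * F0 x \<ge> 0" for x
    using q[of x] F0_pos[of x] by simp
  have "F t \<ge> F0 0" if "t \<ge> 0" for t
  proof -
    have "F0 0 \<le> F0 t"
      by (rule DERIV_nonneg_imp_nondecreasing[OF that]) (use DERIV_F0 q' in blast)
    then show ?thesis using F1_nonneg[of t] by (simp add: F_def)
  qed
  then show False using unbounded_contra F0_pos by blast
qed

text \<open>The logarithmic derivative of \<open>F1\<close> is \<open>4 * (q + p)\<close>; if it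
  stayed nonnegative, \<open>F1\<close> would be bounded below on a half-line and not integrable.
  This is the source of the bound \<open>\<beta> > 1 + p\<close>.\<close>

lemma q_eventually_lt_p: 
  assumes "d > 0" shows "\<exists>t0. q t0 < - p"
proof (rule ccontr)
  assume "\<not> ?thesis"
  then have q: "q t + p \<ge> 0" for t by (smt (verit))
  have q': "4 * (q x + p) * F1 x \<ge> 0" for x
    using q[of x] F1_nonneg[of x] by simp
  have "F t \<ge> F1 0" if "t \<ge> 0" for t
  proof -
    have "F1 0 \<le> F1 t"
      by (rule DERIV_nonneg_imp_nondecreasing[OF that]) (use DERIV_F1 q' in blast)
    then show ?thesis using F0_pos[of t] by (simp add: F_def)
  qed
  moreover have "F1 0 > 0" using assms by (simp add: F1_def)
  ultimately show False using unbounded_contra by blast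
qed

text \<open>Integrability alone does not give decay, but once the slope is negative enough
  \<open>F\<close> is nonincreasing, and then \<open>F t * (t - t0)\<close> is at most the total
  mass.\<close>

lemma F_at_top: "(F \<longlongrightarrow> 0) at_top"
proof -
  have "\<exists>t0. \<forall>t\<ge>t0. 4 * q t * F t + 4 * p * F1 t \<le> 0"
  proof (cases "d = 0")
    case True
    obtain t0 where "q t0 < 0" using q_eventually_neg by blast
    then have "q t < 0" if "t \<ge> t0" for t using q_antimono[of t0 t] that by (cases "t = t0") auto
    moreover have "F1 t = 0" for t unfolding F1_def by (simp only: True mult_zero_left)
    ultimately show ?thesis
      by (intro exI[of _ t0]) (auto simp: mult_nonpos_nonneg less_imp_le F_pos)
  next
    case False
    then obtain t0 where q0: "q t0 < - p" using q_eventually_lt_p d_nonneg by auto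
    have "4 * q t * F t + 4 * p * F1 t \<le> 0" if "t \<ge> t0" for t
    proof -
      have "q t < - p" using q_antimono[of t0 t] that q0 by (cases "t = t0") auto
      then have "q t * F0 t \<le> 0" "(q t + p) * F1 t \<le> 0"
        using p_pos F0_pos[of t] F1_nonneg[of t] by (auto intro!: mult_nonpos_nonneg)
      then show ?thesis by (simp add: F_def algebra_simps)
    qed
    then show ?thesis by blast
  qed
  then obtain t0 where t0: "\<And>t. t \<ge> t0 \<Longrightarrow> 4 * q t * F t + 4 * p * F1 t \<le> 0" by blast
  have F_anti: "F t \<le> F s" if "t0 \<le> s" "s \<le> t" for s t
    by (rule DERIV_nonpos_imp_nonincreasing[OF that(2)]) (use DERIV_F t0 that in force)
  have bound: "F t \<le> Jinf / (t - t0)" if "t > t0" for t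
  proof -
    have "J t0 - F t * t0 \<le> J t - F t * t"
    proof (rule DERIV_nonneg_imp_nondecreasing[where f = "\<lambda>s. J s - F t * s"])
      fix x assume x: "t0 \<le> x" "x \<le> t"
      have "((\<lambda>s. J s - F t * s) has_real_derivative F x - F t) (at x)"
        by (auto intro!: derivative_eq_intros DERIV_J)
      then show "\<exists>y. ((\<lambda>s. J s - F t * s) has_real_derivative y) (at x) \<and> y \<ge> 0" 
        using F_anti[OF x] by force
    qed (use that in auto)
    then have "F t * (t - t0) \<le> Jinf" using J_nonneg[of t0] J_le_Jinf[of t] by (simp add: algebra_simps)
    then show ?thesis using that by (simp add: field_simps)
  qed
  have lim: "((\<lambda>t. Jinf / (t - t0)) \<longlongrightarrow> 0) at_top"
    by (intro tendsto_divide_0[OF tendsto_const] filterlim_at_top_imp_at_infinity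
        filterlim_tendsto_add_at_top[OF tendsto_const[of "- t0"] filterlim_ident, simplified])
  have "\<forall>\<^sub>F t in at_top. F t \<le> Jinf / (t - t0)"
    using bound by (intro eventually_mono[OF eventually_gt_at_top[of t0]]) auto
  then show ?thesis
    by (intro tendsto_sandwich[OF _ _ tendsto_const lim]) (auto simp: F_pos less_imp_le)
qed

lemma DERIV_J1: "((\<lambda>t. J t - J0 t) has_real_derivative F1 t) (at t)"
  using DERIV_diff[OF DERIV_J DERIV_J0] by (simp add: F_def)

text \<open>Adding \<open>p\<close> times the integral of \<open>F1\<close> to the energy makes it
  constant. At both ends \<open>v\<close>, \<open>v1\<close> and \<open>F\<close> vanish, so the
  comparison of the two limits involves only the end slopes 1 and \<open>1 - Jinf / 4\<close> and
  the integral of \<open>F1\<close>.\<close>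

lemma energy_identity: "2 * (1 - Jinf / 4)\<^sup>2 - 2 = p * (Jinf - J0inf)"
proof -
  define J1 where "J1 t = J t - J0 t" for t
  have J1: "(J1 has_real_derivative F1 t) (at t)" for t
    unfolding J1_def[abs_def] by (rule DERIV_J1)
  let ?H = "\<lambda>t. - v1 t * q t - (v t)\<^sup>2 / 2 - 2 * (q t)\<^sup>2 - F t / 4 + p * J1 t"
  have D: "(?H has_real_derivative 0) (at t)" for t
  proof -
    note D = DERIV_add[OF DERIV_diff[OF DERIV_diff[OF DERIV_diff[OF
      DERIV_mult[OF DERIV_minus[OF DERIV_v1] DERIV_q]
      DERIV_cdivide[OF DERIV_power[OF DERIV_v, where n = 2], where c = 2]]
      DERIV_cmult[OF DERIV_power[OF DERIV_q, where n = 2], where c = 2]]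
      DERIV_cdivide[OF DERIV_F, where c = 4]] DERIV_cmult[OF J1, where c = p]]
    show ?thesis by (rule DERIV_cong[OF D]) (simp add: algebra_simps)
  qed
  define k where "k = ?H 0"
  have k: "?H t = k" for t
    unfolding k_def by (rule DERIV_isconst_all[where f = ?H]) (use D in blast)
  have "(?H \<longlongrightarrow> - 0 * 1 - 0\<^sup>2 / 2 - 2 * 1\<^sup>2 - 0 / 4 + p * (0 - 0)) at_bot"
    unfolding J1_def by (intro tendsto_intros v1_at_bot q_at_bot v_at_bot F_at_bot J_at_bot J0_at_bot) auto
  then have "((\<lambda>t. k) \<longlongrightarrow> - 2) (at_bot :: real filter)" unfolding k by simp
  then have "k = - 2" by (simp add: tendsto_const_iff)
  have "(?H \<longlongrightarrow> - 0 * (1 - Jinf / 4) - 0\<^sup>2 / 2 - 2 * (1 - Jinf / 4)\<^sup>2 - 0 / 4 + p * (Jinf - J0inf)) at_top"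
    unfolding J1_def by (intro tendsto_intros v1_at_top q_at_top v_at_top F_at_top J_at_top J0_at_top) auto
  then have "((\<lambda>t. k) \<longlongrightarrow> - 2 * (1 - Jinf / 4)\<^sup>2 + p * (Jinf - J0inf)) (at_top :: real filter)" unfolding k by simp
  then have "k = - 2 * (1 - Jinf / 4)\<^sup>2 + p * (Jinf - J0inf)" by (simp add: tendsto_const_iff)
  with \<open>k = - 2\<close> show ?thesis by simp
qed

end

section \<open>Bounds for the total mass\<close>

context radial_solution
begin

lemma isCont_q: "isCont q t"
  by (rule DERIV_isCont[OF DERIV_q])

lemma J0inf_lt_8:
  assumes "Jinf > 8"
  shows "J0inf < 8"
proof -
  \<comment> \<open>As \<open>Jinf > 8\<close>, the slope decreases from 1 to a limit below -1, so
    it takes the value -1 somewhere.\<close>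
  have "\<forall>\<^sub>F t in at_bot. q t > - 1"
    using q_at_bot by (rule order_tendstoD) simp
  then obtain a where a: "q a > - 1" by (auto simp: eventually_at_bot_linorder)
  have "\<forall>\<^sub>F t in at_top. q t < - 1"
    using q_at_top by (rule order_tendstoD) (use assms in simp)
  then obtain b where b: "q b < - 1" by (auto simp: eventually_at_top_linorder)
  have "a \<le> b" using q_antimono[of b a] a b by (cases "a \<le> b") auto
  then obtain t where t: "q t = - 1"
    using IVT2[of q b "- 1" a] a b isCont_q by auto
  \<comment> \<open>The energy built from \<open>F0\<close> alone plus the integral of
    \<open>F1\<close>: its derivative \<open>F1 * (q + 1)\<close> is nonnegative as long as the
    slope is at least -1.\<close>
  let ?\<Psi> = "\<lambda>t. - v1 t * q t - (v t)\<^sup>2 / 2 - 2 * (q t)\<^sup>2 - F0 t / 4 + (J t - J0 t)"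
  have D: "(?\<Psi> has_real_derivative F1 s * (q s + 1)) (at s)" for s
  proof -
    note D = DERIV_add[OF DERIV_diff[OF DERIV_diff[OF DERIV_diff[OF
      DERIV_mult[OF DERIV_minus[OF DERIV_v1] DERIV_q]
      DERIV_cdivide[OF DERIV_power[OF DERIV_v, where n = 2], where c = 2]]
      DERIV_cmult[OF DERIV_power[OF DERIV_q, where n = 2], where c = 2]]
      DERIV_cdivide[OF DERIV_F0, where c = 4]] DERIV_J1]
    show ?thesis by (rule DERIV_cong[OF D]) (simp add: algebra_simps F_def)
  qed
  have mono: "?\<Psi> s \<le> ?\<Psi> t" if "s \<le> t" for s
  proof (rule DERIV_nonneg_imp_nondecreasing[OF that, of ?\<Psi>])
    fix x assume "s \<le> x" "x \<le> t"
    then have "q x \<ge> - 1" using q_antimono[of x t] t by (cases "x = t") auto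
    then have "F1 x * (q x + 1) \<ge> 0" using F1_nonneg by simp
    with D show "\<exists>y. (?\<Psi> has_real_derivative y) (at x) \<and> 0 \<le> y" by blast
  qed
  have lim: "(?\<Psi> \<longlongrightarrow> - 0 * 1 - 0\<^sup>2 / 2 - 2 * 1\<^sup>2 - 0 / 4 + (0 - 0)) at_bot"
    by (intro tendsto_intros v1_at_bot q_at_bot v_at_bot F0_at_bot J_at_bot J0_at_bot) auto
  have "- 0 * 1 - 0\<^sup>2 / 2 - 2 * 1\<^sup>2 - 0 / 4 + (0 - 0) \<le> ?\<Psi> t"
    by (rule tendsto_upperbound[OF lim eventually_mono[OF eventually_le_at_bot[of t]]]) (use mono in auto)
  \<comment> \<open>At slope -1 the term \<open>- v1 * q\<close> equals \<open>v1\<close>, which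
    cancels against the \<open>v1\<close> in \<open>J\<close>.\<close>
  moreover have "J t = 8 - v1 t" using J_eq[of t] t by simp
  ultimately have *: "J0 t + F0 t / 4 \<le> 8 - (v t)\<^sup>2 / 2" by (simp add: t)
  \<comment> \<open>Beyond \<open>t\<close> the slope is below -1, so \<open>F0\<close> decays at
    rate at least 4 and its remaining integral is at most \<open>F0 t / 4\<close>.\<close>
  have "J0 s \<le> J0 t + F0 t / 4" for s
  proof (cases "t \<le> s")
    case True
    have "J0 s + F0 s / 4 \<le> J0 t + F0 t / 4"
    proof (rule DERIV_nonpos_imp_nonincreasing[OF True, where f = "\<lambda>t. J0 t + F0 t / 4"])
      fix x assume "t \<le> x" "x \<le> s"
      then have "q x \<le> - 1" using q_antimono[of t x] t by (cases "x = t") auto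
      have "((\<lambda>t. J0 t + F0 t / 4) has_real_derivative F0 x + (4 * q x * F0 x) / 4) (at x)"
        by (intro DERIV_add DERIV_cdivide DERIV_J0 DERIV_F0)
      moreover have "F0 x + (4 * q x * F0 x) / 4 \<le> 0"
      proof -
        have "F0 x * (1 + q x) \<le> 0" using \<open>q x \<le> - 1\<close> F0_pos[of x] by (simp add: mult_nonneg_nonpos)
        then show ?thesis by (simp add: algebra_simps)
      qed
      ultimately show "\<exists>y. ((\<lambda>t. J0 t + F0 t / 4) has_real_derivative y) (at x) \<and> y \<le> 0" by blast
    qed
    then show ?thesis using F0_pos[of s] by linarith
  next
    case False
    then show ?thesis using J0_mono[of s t] F0_pos[of t] by simp
  qed
  then have "J0inf \<le> J0 t + F0 t / 4"
    unfolding J0inf_def by (intro cSUP_least) auto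
  moreover have "(v t)\<^sup>2 > 0" using v_pos[of t] by simp
  ultimately show ?thesis using * by linarith
qed

definition "\<beta> = Jinf / 4"
definition "\<beta>0 = J0inf / 4"

lemma pohozaev: "\<beta>\<^sup>2 - 2 * \<beta> = 2 * p * (\<beta> - \<beta>0)"
  using energy_identity by (simp add: \<beta>_def \<beta>0_def power2_eq_square algebra_simps)

lemma \<beta>0_pos: "\<beta>0 > 0" and \<beta>_pos: "\<beta> > 0"
  using J0inf_pos Jinf_pos by (simp_all add: \<beta>_def \<beta>0_def)

text \<open>Without the weight \<open>J\<close> and \<open>J0\<close> coincide, and
  \<open>pohozaev\<close> degenerates to \<open>\<beta> * (\<beta> - 2) = 0\<close>.\<close>

lemma \<beta>_d0: 
  assumes "d = 0" shows "\<beta> = 2" "\<beta>0 = 2"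
proof -
  have "J = J0"
    unfolding J_def[abs_def] J0_def[abs_def] radial_density_def[abs_def] weight_def using assms by simp
  then have "\<beta>0 = \<beta>" by (simp add: \<beta>_def \<beta>0_def Jinf_def J0inf_def)
  with pohozaev have "\<beta> * (\<beta> - 2) = 0" by (simp add: power2_eq_square algebra_simps)
  with \<beta>_pos \<open>\<beta>0 = \<beta>\<close> show "\<beta> = 2" "\<beta>0 = 2" by auto
qed

context
  assumes d_pos: "d > 0"
begin

lemma \<beta>0_less_\<beta>: "\<beta>0 < \<beta>"
proof -
  have F1: "F1 x > 0" for x using d_pos by (simp add: F1_def)
  have "J 0 - J0 0 < J 1 - J0 1"
    by (rule DERIV_pos_imp_increasing[where f = "\<lambda>t. J t - J0 t"]) (use DERIV_J1 F1 zero_less_one in blast)+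
  also have "J 1 - J0 1 \<le> Jinf - J0inf"
  proof (rule tendsto_lowerbound[OF tendsto_diff[OF J_at_top J0_at_top] eventually_mono[OF eventually_ge_at_top[of 1]]])
    fix x :: real assume "1 \<le> x"
    then show "J 1 - J0 1 \<le> J x - J0 x"
      by (rule DERIV_nonneg_imp_nondecreasing[where f = "\<lambda>t. J t - J0 t"]) (use DERIV_J1 F1_nonneg in blast)
  qed simp
  finally show ?thesis using J0_le_J[of 0] by (simp add: \<beta>_def \<beta>0_def)
qed

lemma \<beta>_gt: "\<beta> > 2" "\<beta> > 1 + p"
proof -
  have "\<beta> * (\<beta> - 2) > 0"
  proof -
    have "\<beta> * (\<beta> - 2) = 2 * p * (\<beta> - \<beta>0)"
      using pohozaev by (simp add: power2_eq_square algebra_simps)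
    also have "\<dots> > 0" using \<beta>0_less_\<beta> p_pos by simp
    finally show ?thesis .
  qed
  then show "\<beta> > 2" using \<beta>_pos by (simp add: zero_less_mult_iff)
  \<comment> \<open>The decreasing slope stays above its limit \<open>1 - \<beta>\<close>, yet it
    falls below \<open>- p\<close>.\<close>
  show "\<beta> > 1 + p"
    using q_eventually_lt_p[OF d_pos] q_gt_lim unfolding \<beta>_def by (smt (verit))
qed

lemma \<beta>0_less_2: "\<beta>0 < 2"
  using J0inf_lt_8 \<beta>_gt(1) by (simp add: \<beta>_def \<beta>0_def)

text \<open>Two factorisations of \<open>pohozaev\<close>, with right-hand sides
  \<open>2 * p * (2 - \<beta>0)\<close> and \<open>2 * p * \<beta>0\<close>, turn the bounds for
  \<open>\<beta>0\<close> into bounds for \<open>\<beta>\<close>.\<close>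

lemma \<beta>_bounds: "max 2 (2 * p) < \<beta>" "\<beta> < 2 + 2 * p"
proof -
  have "(\<beta> - 2) * (\<beta> - 2 * p) = 2 * p * (2 - \<beta>0)"
    using pohozaev by (simp add: power2_eq_square algebra_simps)
  also have "\<dots> > 0" using \<beta>0_less_2 p_pos by simp
  finally have "\<beta> - 2 * p > 0" using \<beta>_gt(1) by (simp add: zero_less_mult_iff)
  then show "max 2 (2 * p) < \<beta>" using \<beta>_gt(1) by simp
  have "\<beta> * (2 + 2 * p - \<beta>) = 2 * p * \<beta>0"
    using pohozaev by (simp add: power2_eq_square algebra_simps)
  also have "\<dots> > 0" using \<beta>0_pos p_pos by simp
  finally show "\<beta> < 2 + 2 * p" using \<beta>_pos by (simp add: zero_less_mult_iff)
qed

end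

end

section \<open>The truncated Volterra equation\<close>

lemma gronwall:
  fixes f :: "real \<Rightarrow> real"
  assumes "continuous_on {0..} f" "k \<ge> 0" "r \<ge> 0"
    and le: "\<And>s. 0 \<le> s \<Longrightarrow> s \<le> r \<Longrightarrow> f s \<le> a + k * integral {0..s} f"
  shows "f r \<le> a * exp (k * r)"
proof -
  let ?I = "\<lambda>s. integral {0..s} f"
  let ?G = "\<lambda>s. (a + k * ?I s) * exp (- k * s)"
  have "?G r \<le> ?G 0"
  proof (rule DERIV_nonpos_imp_decreasing_open[OF \<open>r \<ge> 0\<close>])
    fix x assume x: "0 < x" "x < r"
    have "(?G has_real_derivative k * f x * exp (- k * x) + (a + k * ?I x) * (- k * exp (- k * x))) (at x)"
      by (auto intro!: derivative_eq_intros has_real_derivative_indef_integral assms x)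
    moreover have "k * f x * exp (- k * x) + (a + k * ?I x) * (- k * exp (- k * x))
        = - (k * exp (- k * x) * (a + k * ?I x - f x))"
      by (simp add: algebra_simps)
    moreover have "\<dots> \<le> 0"
      using le[of x] x assms(2) by simp
    ultimately show "\<exists>y. (?G has_real_derivative y) (at x) \<and> y \<le> 0" by metis
  next
    have "continuous_on {0..r} ?I"
      by (rule indefinite_integral_continuous_1) (rule integrable_on_cont_half_line[OF assms(1)])
    then show "continuous_on {0..r} ?G"
      by (intro continuous_intros)
  qed
  then have "a + k * ?I r \<le> a * exp (k * r)"
    by (simp add: exp_minus field_simps)
  with le[OF \<open>r \<ge> 0\<close> order_refl] show ?thesis by (rule order_trans)
qed

text \<open>Weaker than continuity and stable under dominated pointwise limits. The density of a
  limit of iterates satisfies this before the limit is known to be continuous.\<close>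

definition moments_exist :: "(real \<Rightarrow> real) \<Rightarrow> bool" where
  "moments_exist h \<longleftrightarrow> (\<forall>r. (\<forall>k. (\<lambda>s. s ^ k * h s) integrable_on {0..r}) \<and>
     (\<lambda>s. s ^ 3 * ln s * h s) integrable_on {0..r})"

lemma moments_existD:
  assumes "moments_exist h"
  shows "(\<lambda>s. s ^ k * h s) integrable_on {0..r}" "(\<lambda>s. s ^ 3 * ln s * h s) integrable_on {0..r}"
  using assms by (auto simp: moments_exist_def)

lemma moments_exist_continuous: "continuous_on {0..} h \<Longrightarrow> moments_exist h"
  unfolding moments_exist_def
  by (auto intro!: integrable_on_cont_half_line continuous_on_mom_integrand continuous_on_lmom_integrand)

lemma ker_has_integral:
  assumes "moments_exist h"
  shows "((\<lambda>s. ker r s * h s) has_integral pot c h r + c * r\<^sup>2 / 16) {0..r}"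
  by (intro pot_eq_ker moments_existD assms)

lemma pot_bounds:
  assumes "moments_exist h" "\<And>s. s \<ge> 0 \<Longrightarrow> h s \<ge> 0"
  shows "- (c * r\<^sup>2 / 16) \<le> pot c h r" "pot c h r \<le> - (r\<^sup>2 / 16 * (c - mom 1 h r))"
proof -
  have "0 \<le> pot c h r + c * r\<^sup>2 / 16"
    by (rule has_integral_nonneg[OF ker_has_integral[OF assms(1)]]) (use ker_bounds assms in auto)
  then show "- (c * r\<^sup>2 / 16) \<le> pot c h r" by simp
  have "((\<lambda>s. r\<^sup>2 / 16 * (s ^ 1 * h s)) has_integral r\<^sup>2 / 16 * mom 1 h r) {0..r}"
    unfolding mom_def by (intro has_integral_mult_right integrable_integral moments_existD assms)
  then have le: "pot c h r + c * r\<^sup>2 / 16 \<le> r\<^sup>2 / 16 * mom 1 h r"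
  proof (rule has_integral_le[OF ker_has_integral[OF assms(1)]])
    fix s assume s: "s \<in> {0..r}"
    have "ker r s * h s \<le> (r\<^sup>2 * s / 16) * h s"
      by (intro mult_right_mono ker_bounds assms) (use s in auto)
    then show "ker r s * h s \<le> r\<^sup>2 / 16 * (s ^ 1 * h s)" by simp
  qed
  show "pot c h r \<le> - (r\<^sup>2 / 16 * (c - mom 1 h r))" 
  proof -
    have "r\<^sup>2 / 16 * (c - mom 1 h r) = c * r\<^sup>2 / 16 - r\<^sup>2 / 16 * mom 1 h r"
      by (simp add: algebra_simps diff_divide_distrib)
    then show ?thesis using le by linarith
  qed
qed

lemma pot_mono:
  assumes "moments_exist h" "moments_exist h'" "\<And>s. s \<ge> 0 \<Longrightarrow> h s \<le> h' s"
  shows "pot c h r \<le> pot c h' r"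
proof -
  have "pot c h r + c * r\<^sup>2 / 16 \<le> pot c h' r + c * r\<^sup>2 / 16"
    by (rule has_integral_le[OF ker_has_integral ker_has_integral])
       (use assms ker_bounds in \<open>auto intro!: mult_left_mono\<close>)
  then show ?thesis by simp
qed

lemma continuous_on_mom':
  assumes "moments_exist h" shows "continuous_on {0..} (mom k h)"
  unfolding mom_def[abs_def] by (intro continuous_on_indef_integral moments_existD assms)

lemma pot_0 [simp]: "pot c h 0 = 0"
  by (simp add: pot_def lmom_def)

text \<open>Away from 0 every term is continuous. At 0 the single terms contain \<open>ln r\<close>
  and \<open>1 / r\<^sup>2\<close>, so the sum is squeezed between the bounds of
  \<open>pot_bounds\<close> instead.\<close>

lemma continuous_on_pot:
  assumes "moments_exist h" "\<And>s. s \<ge> 0 \<Longrightarrow> h s \<ge> 0"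
  shows "continuous_on {0..} (pot c h)"
proof -
  note cm = continuous_on_mom'[OF assms(1)]
  have cl: "continuous_on {0..} (lmom h)"
    unfolding lmom_def[abs_def] by (intro continuous_on_indef_integral moments_existD assms)
  have "continuous_on {0<..} (pot c h)"
    unfolding pot_def[abs_def]
    by (intro continuous_intros continuous_on_subset[OF cm] continuous_on_subset[OF cl]) auto
  then have pos: "continuous (at x) (pot c h)" if "x > 0" for x
    using that by (simp add: continuous_on_eq_continuous_at)
  have zero: "(pot c h \<longlongrightarrow> 0) (at 0 within {0..})"
  proof (rule tendsto_sandwich)
    show "\<forall>\<^sub>F r in at 0 within {0..}. - (c * r\<^sup>2 / 16) \<le> pot c h r"
      using pot_bounds[OF assms] by (intro always_eventually) auto
    show "\<forall>\<^sub>F r in at 0 within {0..}. pot c h r \<le> - (r\<^sup>2 / 16 * (c - mom 1 h r))"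
      using pot_bounds[OF assms] by (intro always_eventually) auto
    have "((\<lambda>r. - (c * r\<^sup>2 / 16)) \<longlongrightarrow> - (c * 0\<^sup>2 / 16)) (at 0 within {0..})"
      by (intro tendsto_intros) auto
    then show "((\<lambda>r. - (c * r\<^sup>2 / 16)) \<longlongrightarrow> 0) (at 0 within {0..})" by simp
    have m: "(mom 1 h \<longlongrightarrow> mom 1 h 0) (at 0 within {0..})"
      using bspec[OF cm[of 1, unfolded continuous_on_def], of 0] by simp
    have "((\<lambda>r. - (r\<^sup>2 / 16 * (c - mom 1 h r))) \<longlongrightarrow> - (0\<^sup>2 / 16 * (c - mom 1 h 0))) (at 0 within {0..})"
      by (intro tendsto_intros m) auto
    then show "((\<lambda>r. - (r\<^sup>2 / 16 * (c - mom 1 h r))) \<longlongrightarrow> 0) (at 0 within {0..})" by simp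
  qed
  show ?thesis
    unfolding continuous_on_def
  proof
    fix x :: real assume "x \<in> {0..}"
    then show "(pot c h \<longlongrightarrow> pot c h x) (at x within {0..})"
      using zero pos[of x] by (cases "x = 0") (auto simp: isCont_def intro: tendsto_within_subset)
  qed
qed

text \<open>For fixed \<open>r\<close> the potential is a finite combination of moments over
  \<open>{0..r}\<close>, and dominated convergence applies to each of them separately.\<close>

lemma moments_dominated_convergence:
  assumes h: "\<And>n. moments_exist (h n)" and g: "continuous_on {0..} g"
    and le: "\<And>n s. s \<ge> 0 \<Longrightarrow> \<bar>h n s\<bar> \<le> g s"
    and lim: "\<And>s. s \<ge> 0 \<Longrightarrow> (\<lambda>n. h n s) \<longlonglongrightarrow> h' s"
  shows "moments_exist h'"
    and "(\<lambda>n. mom k (h n) r) \<longlonglongrightarrow> mom k h' r"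
    and "c' \<longlonglongrightarrow> c \<Longrightarrow> (\<lambda>n. pot (c' n) (h n) r) \<longlonglongrightarrow> pot c h' r"
proof -
  have gi: "(\<lambda>s. s ^ k * g s) integrable_on {0..r}" for k r
    by (intro integrable_on_cont_half_line continuous_on_mom_integrand g)
  have gl: "(\<lambda>s. \<bar>s ^ 3 * ln s\<bar> * g s) integrable_on {0..r}" for r
    by (intro integrable_on_cont_half_line continuous_on_mult continuous_on_rabs continuous_on_cube_ln g)
  have m: "(\<lambda>s. s ^ k * h' s) integrable_on {0..r}"
      "(\<lambda>n. integral {0..r} (\<lambda>s. s ^ k * h n s)) \<longlonglongrightarrow> integral {0..r} (\<lambda>s. s ^ k * h' s)" for k r
  proof -
    have le': "norm (s ^ k * h n s) \<le> s ^ k * g s" if "s \<in> {0..r}" for n s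
      using that le[of s n] by (auto simp: abs_mult intro!: mult_left_mono)
    have lim': "(\<lambda>n. s ^ k * h n s) \<longlonglongrightarrow> s ^ k * h' s" if "s \<in> {0..r}" for s
      using that by (intro tendsto_intros lim) auto
    show "(\<lambda>s. s ^ k * h' s) integrable_on {0..r}"
      "(\<lambda>n. integral {0..r} (\<lambda>s. s ^ k * h n s)) \<longlonglongrightarrow> integral {0..r} (\<lambda>s. s ^ k * h' s)"
      by (rule dominated_convergence[where f = "\<lambda>n s. s ^ k * h n s", OF moments_existD(1)[OF h] gi le' lim']; assumption)+
  qed
  have l: "(\<lambda>s. s ^ 3 * ln s * h' s) integrable_on {0..r}"
      "(\<lambda>n. integral {0..r} (\<lambda>s. s ^ 3 * ln s * h n s)) \<longlonglongrightarrow> integral {0..r} (\<lambda>s. s ^ 3 * ln s * h' s)" for r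
  proof -
    have le': "norm (s ^ 3 * ln s * h n s) \<le> \<bar>s ^ 3 * ln s\<bar> * g s" if "s \<in> {0..r}" for n s
      using that le[of s n] unfolding real_norm_def abs_mult[of "s ^ 3 * ln s"] by (intro mult_left_mono) auto
    have lim': "(\<lambda>n. s ^ 3 * ln s * h n s) \<longlonglongrightarrow> s ^ 3 * ln s * h' s" if "s \<in> {0..r}" for s
      using that by (intro tendsto_intros lim) auto
    show "(\<lambda>s. s ^ 3 * ln s * h' s) integrable_on {0..r}"
      "(\<lambda>n. integral {0..r} (\<lambda>s. s ^ 3 * ln s * h n s)) \<longlonglongrightarrow> integral {0..r} (\<lambda>s. s ^ 3 * ln s * h' s)"
      by (rule dominated_convergence[where f = "\<lambda>n s. s ^ 3 * ln s * h n s", OF moments_existD(2)[OF h] gl le' lim']; assumption)+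
  qed
  show "moments_exist h'" using m(1) l(1) by (auto simp: moments_exist_def)
  show M: "(\<lambda>n. mom k (h n) r) \<longlonglongrightarrow> mom k h' r" for k
    unfolding mom_def by (rule m(2))
  assume "c' \<longlonglongrightarrow> c"
  then show "(\<lambda>n. pot (c' n) (h n) r) \<longlonglongrightarrow> pot c h' r"
    unfolding pot_def lmom_def divide_inverse by (intro tendsto_intros M l(2))
qed

text \<open>The truncation bounds the density by the weight and makes it Lipschitz in
  \<open>u\<close>, so that solutions exist for all radii and every \<open>c\<close>.\<close>

definition trunc_density :: "real \<Rightarrow> real \<Rightarrow> (real \<Rightarrow> real) \<Rightarrow> real \<Rightarrow> real" where
  "trunc_density p d u s = weight p d s * exp (4 * min (u s) 0)"

text \<open>By convexity \<open>exp a - exp b \<le> exp a * (a - b)\<close>, and the truncation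
  gives \<open>exp a \<le> 1\<close>. The one-sided form yields both monotonicity in
  \<open>c\<close> and continuity in the parameters.\<close>

lemma exp_min_diff_le: "exp (4 * min x 0) - exp (4 * min y 0) \<le> 4 * max 0 (x - y)" for x y :: real
proof -
  let ?a = "4 * min x 0" and ?b = "4 * min y 0"
  show ?thesis
  proof (cases "?b \<le> ?a")
    case True
    have "exp ?a * (1 + (?b - ?a)) \<le> exp ?a * exp (?b - ?a)"
      by (intro mult_left_mono) auto
    then have "exp ?a - exp ?b \<le> exp ?a * (?a - ?b)"
      by (simp add: exp_diff algebra_simps)
    also have "\<dots> \<le> 1 * (?a - ?b)" using True by (intro mult_right_mono) auto
    also have "\<dots> \<le> 4 * max 0 (x - y)" by (simp add: min_def max_def)
    finally show ?thesis .
  next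
    case False
    then have "exp ?a \<le> exp ?b" by (meson exp_le_cancel_iff linear)
    then have "exp ?a - exp ?b \<le> 0" by simp
    also have "0 \<le> 4 * max 0 (x - y)" by simp
    finally show ?thesis .
  qed
qed

locale pos_exponent = 
  fixes p :: real assumes p_pos: "p > 0"
begin

abbreviation "td \<equiv> trunc_density p"

lemma cont_weight: "continuous_on {0..} (weight p d)"
  by (rule continuous_on_weight[OF p_pos])

lemma weight_mono: "d \<ge> 0 \<Longrightarrow> 0 \<le> s \<Longrightarrow> s \<le> r \<Longrightarrow> weight p d s \<le> weight p d r"
  using p_pos by (simp add: weight_def mult_left_mono powr_mono2)

lemma td_bounds: "d \<ge> 0 \<Longrightarrow> 0 \<le> td d u s" "d \<ge> 0 \<Longrightarrow> td d u s \<le> weight p d s"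
  using weight_ge_1[of d p s] by (auto simp: trunc_density_def mult_left_le)

lemma cont_td: "continuous_on {0..} u \<Longrightarrow> continuous_on {0..} (td d u)"
  unfolding trunc_density_def[abs_def]
  by (intro continuous_intros cont_weight)

lemma td_mono: "d \<ge> 0 \<Longrightarrow> u s \<le> u' s \<Longrightarrow> td d u s \<le> td d u' s"
  using weight_ge_1[of d p s] by (auto simp: trunc_density_def intro!: mult_left_mono)

lemma td_tendsto: 
  assumes "(\<lambda>n. u n s) \<longlonglongrightarrow> u' s" "d \<longlonglongrightarrow> d'"
  shows "(\<lambda>n. td (d n) (u n) s) \<longlonglongrightarrow> td d' u' s"
  unfolding trunc_density_def weight_def by (intro tendsto_intros assms)

text \<open>Monotone iteration. The start is the solution for density 0, which lies below the first
  iterate; since \<open>ker\<close> is nonnegative and the density increases with \<open>u\<close>,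
  the iterates increase. They are bounded by the potential of the full weight.\<close>

lemma volterra_solution_exists:
  assumes d: "d \<ge> 0"
  shows "\<exists>u. continuous_on {0..} u \<and> (\<forall>r\<ge>0. u r = pot c (td d u) r)"
proof -
  define V where "V = rec_nat (\<lambda>r. - (c * r\<^sup>2 / 16)) (\<lambda>_ u. pot c (td d u))"
  have V0: "V 0 = (\<lambda>r. - (c * r\<^sup>2 / 16))" and VS: "V (Suc n) = pot c (td d (V n))" for n
    by (simp_all add: V_def)
  have cV: "continuous_on {0..} (V n)" for n
    by (induction n) (auto simp: V0 VS intro!: continuous_intros continuous_on_pot moments_exist_continuous cont_td td_bounds d)
  have mV: "moments_exist (td d (V n))" for n
    by (intro moments_exist_continuous cont_td cV)
  have inc: "V n r \<le> V (Suc n) r" if "r \<ge> 0" for n r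
    using that
  proof (induction n arbitrary: r)
    case 0
    then show ?case unfolding VS V0 by (intro pot_bounds(1) mV[of 0, unfolded V0] td_bounds d)
  next
    case (Suc n)
    show ?case unfolding VS[of "Suc n"] unfolding VS[of n]
      by (rule pot_mono) (use mV[of n] mV[of "Suc n"] Suc.IH d in \<open>auto simp: VS intro!: td_mono\<close>)
  qed
  have bd: "V (Suc n) r \<le> pot c (weight p d) r" for n r
    unfolding VS by (intro pot_mono mV moments_exist_continuous cont_weight td_bounds d)
  define u where "u r = lim (\<lambda>n. V n r)" for r
  have lim: "(\<lambda>n. V n r) \<longlonglongrightarrow> u r" if "r \<ge> 0" for r
  proof -
    have "incseq (\<lambda>n. V n r)" using inc[OF that] by (rule incseq_SucI)
    moreover have "V n r \<le> pot c (weight p d) r" for n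
      using inc[OF that, of n] bd[of n r] by linarith
    ultimately obtain L where "(\<lambda>n. V n r) \<longlonglongrightarrow> L" using incseq_convergent by blast
    then show ?thesis unfolding u_def by (metis limI)
  qed
  have hlim: "(\<lambda>n. td d (V n) s) \<longlonglongrightarrow> td d u s" if "s \<ge> 0" for s
    by (intro td_tendsto lim that tendsto_const)
  have le: "\<bar>td d (V n) s\<bar> \<le> weight p d s" for n s
    using td_bounds[OF d, of "V n" s] by simp
  note dom = moments_dominated_convergence[where h = "\<lambda>n. td d (V n)", OF mV cont_weight le hlim]
  have eq: "u r = pot c (td d u) r" if "r \<ge> 0" for r
  proof (rule LIMSEQ_unique)
    show "(\<lambda>n. V (Suc n) r) \<longlonglongrightarrow> u r" using lim[OF that] by (rule LIMSEQ_Suc)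
    show "(\<lambda>n. V (Suc n) r) \<longlonglongrightarrow> pot c (td d u) r"
      unfolding VS by (rule dom(3)) auto
  qed
  \<comment> \<open>A pointwise limit need not be continuous, but the potential of its density
    is.\<close>
  have "continuous_on {0..} (pot c (td d u))"
    by (intro continuous_on_pot dom(1) td_bounds d) auto
  then have "continuous_on {0..} u"
    by (rule continuous_on_eq) (use eq in auto)
  with eq show ?thesis by blast
qed

definition U where "U d c = (SOME u. continuous_on {0..} u \<and> (\<forall>r\<ge>0. u r = pot c (td d u) r))"

lemma U_solves:
  assumes "d \<ge> 0"
  shows "continuous_on {0..} (U d c) \<and> (\<forall>r\<ge>0. U d c r = pot c (td d (U d c)) r)"
  unfolding U_def by (rule someI_ex[OF volterra_solution_exists[OF assms]])

lemma cont_U: "d \<ge> 0 \<Longrightarrow> continuous_on {0..} (U d c)"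
  by (rule conjunct1[OF U_solves])

lemma U_eq: "d \<ge> 0 \<Longrightarrow> r \<ge> 0 \<Longrightarrow> U d c r = pot c (td d (U d c)) r"
  by (rule conjunct2[OF U_solves, rule_format])

lemma moments_U: "d \<ge> 0 \<Longrightarrow> moments_exist (td d (U d c))"
  by (intro moments_exist_continuous cont_td cont_U)

text \<open>Gronwall's inequality for the positive part of the difference on \<open>{0..R}\<close>.
  The rate is the kernel bound \<open>R ^ 3 / 16\<close> times the Lipschitz constant 4 and the
  largest weight; the initial constant collects the effect of changing \<open>c\<close> and
  \<open>d\<close>.\<close>

lemma U_comparison:
  assumes d: "d1 \<ge> 0" "d2 \<ge> 0" and r: "0 \<le> r" "r \<le> R"
  shows "U d1 c1 r - U d2 c2 r \<le> (max 0 (c2 - c1) * R\<^sup>2 / 16 + max 0 (d1 - d2) * (R ^ 4 * R powr (4 * p) / 16))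
    * exp (R ^ 3 * weight p d2 R / 4 * r)"
proof -
  define D where "D s = max 0 (U d1 c1 s - U d2 c2 s)" for s
  let ?A = "max 0 (c2 - c1) * R\<^sup>2 / 16 + max 0 (d1 - d2) * (R ^ 4 * R powr (4 * p) / 16)"
  let ?k = "R ^ 3 * weight p d2 R / 4"
  let ?m = "max 0 (d1 - d2) * (R ^ 3 * R powr (4 * p) / 16)"
  have R: "R \<ge> 0" using r by simp
  have cD: "continuous_on {0..} D"
    unfolding D_def[abs_def] by (intro continuous_intros cont_U d)
  have k: "?k \<ge> 0" using R weight_ge_1[OF d(2), of p R] by simp
  have D_nonneg: "D s \<ge> 0" for s by (simp add: D_def)
  have A: "?A \<ge> 0" using R by simp
  have main: "D s \<le> ?A + ?k * integral {0..s} D" if s: "0 \<le> s" "s \<le> r" for s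
  proof -
    have i1: "((\<lambda>t. ker s t * td d1 (U d1 c1) t - ker s t * td d2 (U d2 c2) t) has_integral 
        (U d1 c1 s + c1 * s\<^sup>2 / 16) - (U d2 c2 s + c2 * s\<^sup>2 / 16)) {0..s}"
      unfolding U_eq[OF d(1) s(1)] U_eq[OF d(2) s(1)]
      by (intro has_integral_diff ker_has_integral moments_U d)
    have i2: "((\<lambda>t. ?m + ?k * D t) has_integral ?m * s + ?k * integral {0..s} D) {0..s}"
      using has_integral_add[OF has_integral_const_real[of ?m 0 s] has_integral_mult_right[OF integrable_integral[OF integrable_on_cont_half_line[OF cD, of s]], of ?k]] s
      by (simp add: mult_ac)
    have "(U d1 c1 s + c1 * s\<^sup>2 / 16) - (U d2 c2 s + c2 * s\<^sup>2 / 16) \<le> ?m * s + ?k * integral {0..s} D"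
    proof (rule has_integral_le[OF i1 i2])
      fix t assume t: "t \<in> {0..s}"
      let ?e1 = "exp (4 * min (U d1 c1 t) 0)" and ?e2 = "exp (4 * min (U d2 c2 t) 0)"
      have w2: "0 \<le> weight p d2 t" "weight p d2 t \<le> weight p d2 R"
        using weight_ge_1[OF d(2), of p t] weight_mono[OF d(2), of t R] t s r by auto
      have tR: "t powr (4 * p) \<le> R powr (4 * p)"
        using t s r p_pos by (intro powr_mono2) auto
      \<comment> \<open>The change of coefficient is separated from the change of solution, the
        latter being weighted with \<open>d2\<close> only.\<close>
      have "td d1 (U d1 c1) t - td d2 (U d2 c2) t = (d1 - d2) * t powr (4 * p) * ?e1 + weight p d2 t * (?e1 - ?e2)"
        by (simp add: trunc_density_def weight_def algebra_simps)
      also have "\<dots> \<le> max 0 (d1 - d2) * R powr (4 * p) * 1 + weight p d2 R * (4 * D t)"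
      proof (rule add_mono)
        have "(d1 - d2) * t powr (4 * p) * ?e1 \<le> max 0 (d1 - d2) * t powr (4 * p) * ?e1"
          by (intro mult_right_mono) auto
        also have "\<dots> \<le> max 0 (d1 - d2) * R powr (4 * p) * 1"
          using tR by (intro mult_mono) auto
        finally show "(d1 - d2) * t powr (4 * p) * ?e1 \<le> max 0 (d1 - d2) * R powr (4 * p) * 1" .
        have "weight p d2 t * (?e1 - ?e2) \<le> weight p d2 t * (4 * D t)"
          unfolding D_def by (intro mult_left_mono exp_min_diff_le w2)
        also have "\<dots> \<le> weight p d2 R * (4 * D t)"
          using w2 D_nonneg by (intro mult_right_mono) auto
        finally show "weight p d2 t * (?e1 - ?e2) \<le> weight p d2 R * (4 * D t)" .
      qed
      finally have *: "td d1 (U d1 c1) t - td d2 (U d2 c2) t \<le> max 0 (d1 - d2) * R powr (4 * p) + 4 * weight p d2 R * D t"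
        by simp
      have nn: "max 0 (d1 - d2) * R powr (4 * p) + 4 * weight p d2 R * D t \<ge> 0"
        using D_nonneg[of t] w2 by (intro add_nonneg_nonneg mult_nonneg_nonneg) auto
      have kb: "0 \<le> ker s t" "ker s t \<le> R ^ 3 / 16"
      proof -
        show "0 \<le> ker s t" using t by (intro ker_bounds) auto
        have "ker s t \<le> s\<^sup>2 * t / 16" using t by (intro ker_bounds) auto
        also have "\<dots> \<le> R\<^sup>2 * R / 16" using t s r by (intro divide_right_mono mult_mono power_mono) auto
        finally show "ker s t \<le> R ^ 3 / 16" by (simp add: power3_eq_cube power2_eq_square)
      qed
      have "ker s t * (td d1 (U d1 c1) t - td d2 (U d2 c2) t) \<le> ker s t * (max 0 (d1 - d2) * R powr (4 * p) + 4 * weight p d2 R * D t)"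
        by (intro mult_left_mono * kb)
      also have "\<dots> \<le> R ^ 3 / 16 * (max 0 (d1 - d2) * R powr (4 * p) + 4 * weight p d2 R * D t)"
        by (intro mult_right_mono nn kb)
      also have "\<dots> = ?m + ?k * D t"
        by (simp add: distrib_left mult_ac)
      finally show "ker s t * td d1 (U d1 c1) t - ker s t * td d2 (U d2 c2) t \<le> ?m + ?k * D t"
        by (simp only: right_diff_distrib)
    qed
    moreover have "?m * s \<le> max 0 (d1 - d2) * (R ^ 4 * R powr (4 * p) / 16)"
    proof -
      have "?m * s \<le> ?m * R" using s r R by (intro mult_left_mono) auto
      also have "\<dots> = max 0 (d1 - d2) * ((R ^ 3 * R) * R powr (4 * p) / 16)"
        by simp
      also have "R ^ 3 * R = R ^ 4" by (simp add: eval_nat_numeral)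
      finally show ?thesis .
    qed
    moreover have "(c2 - c1) * s\<^sup>2 / 16 \<le> max 0 (c2 - c1) * R\<^sup>2 / 16"
      using s r by (intro divide_right_mono mult_mono power_mono) auto
    moreover have "(c2 - c1) * s\<^sup>2 / 16 = c2 * s\<^sup>2 / 16 - c1 * s\<^sup>2 / 16"
      by (simp add: left_diff_distrib diff_divide_distrib)
    ultimately have "U d1 c1 s - U d2 c2 s \<le> ?A + ?k * integral {0..s} D"
      by linarith
    moreover have "?A + ?k * integral {0..s} D \<ge> 0"
      by (intro add_nonneg_nonneg[OF A] mult_nonneg_nonneg[OF k] Henstock_Kurzweil_Integration.integral_nonneg integrable_on_cont_half_line cD D_nonneg)
    ultimately show ?thesis unfolding D_def[of s] by linarith
  qed
  have "D r \<le> ?A * exp (?k * r)"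
    by (rule gronwall[OF cD k r(1) main])
  then show ?thesis by (simp add: D_def)
qed

lemma U_antimono: "d \<ge> 0 \<Longrightarrow> c \<le> c' \<Longrightarrow> r \<ge> 0 \<Longrightarrow> U d c' r \<le> U d c r"
  using U_comparison[of d d r r c' c] by simp

text \<open>The comparison is applied in both directions; each bound vanishes in the limit because
  only positive parts of parameter differences enter.\<close>

lemma U_tendsto:
  assumes d: "\<And>n. dn n \<ge> 0" "dn \<longlonglongrightarrow> d" and c: "cn \<longlonglongrightarrow> c" and r: "r \<ge> 0"
  shows "(\<lambda>n. U (dn n) (cn n) r) \<longlonglongrightarrow> U d c r"
proof -
  have d0: "d \<ge> 0" by (rule tendsto_lowerbound[OF d(2)]) (auto simp: d)
  let ?B = "\<lambda>d1 c1 d2 c2. (max 0 (c2 - c1) * r\<^sup>2 / 16 + max 0 (d1 - d2) * (r ^ 4 * r powr (4 * p) / 16))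
    * exp (r ^ 3 * weight p d2 r / 4 * r)"
  have w: "(\<lambda>n. weight p (dn n) r) \<longlonglongrightarrow> weight p d r"
    unfolding weight_def by (intro tendsto_intros d)
  have 1: "(\<lambda>n. ?B (dn n) (cn n) d c) \<longlonglongrightarrow> ?B d c d c"
    by (intro tendsto_intros d c) auto
  have 2: "(\<lambda>n. ?B d c (dn n) (cn n)) \<longlonglongrightarrow> ?B d c d c"
    by (intro tendsto_intros d c w) auto
  have "(\<lambda>n. U (dn n) (cn n) r - U d c r) \<longlonglongrightarrow> 0"
  proof (rule tendsto_sandwich)
    show "\<forall>\<^sub>F n in sequentially. U (dn n) (cn n) r - U d c r \<le> ?B (dn n) (cn n) d c"
      by (intro always_eventually allI U_comparison d d0 r order_refl)
    have "- ?B d c (dn n) (cn n) \<le> U (dn n) (cn n) r - U d c r" for n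
      using U_comparison[OF d0 d(1) r order_refl, of c n "cn n"] by linarith
    then show "\<forall>\<^sub>F n in sequentially. - ?B d c (dn n) (cn n) \<le> U (dn n) (cn n) r - U d c r"
      by (intro always_eventually allI)
    show "(\<lambda>n. ?B (dn n) (cn n) d c) \<longlonglongrightarrow> 0" using 1 by simp
    show "(\<lambda>n. - ?B d c (dn n) (cn n)) \<longlonglongrightarrow> 0" using tendsto_minus[OF 2] by simp
  qed
  then show ?thesis by (rule LIM_zero_cancel)
qed

lemma mom_U_tendsto:
  assumes d: "\<And>n. dn n \<ge> 0" "dn \<longlonglongrightarrow> d" and c: "cn \<longlonglongrightarrow> c"
  shows "(\<lambda>n. mom k (td (dn n) (U (dn n) (cn n))) r) \<longlonglongrightarrow> mom k (td d (U d c)) r"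
proof -
  have "Bseq dn" using d(2) by (intro convergent_imp_Bseq) (auto simp: convergent_def)
  then obtain L where L: "\<And>n. \<bar>dn n\<bar> \<le> L" by (auto simp: Bseq_def)
  have le: "\<bar>td (dn n) (U (dn n) (cn n)) s\<bar> \<le> weight p L s" if "s \<ge> 0" for n s
  proof -
    have "weight p (dn n) s \<le> weight p L s"
      using L[of n] by (auto simp: weight_def intro!: mult_right_mono)
    then show ?thesis using td_bounds[OF d(1)[of n], of "U (dn n) (cn n)" s] by simp
  qed
  show ?thesis
  proof (rule moments_dominated_convergence(2)[OF moments_U[OF d(1)] cont_weight le])
    show "(\<lambda>n. td (dn n) (U (dn n) (cn n)) s) \<longlonglongrightarrow> td d (U d c) s" if "s \<ge> 0" for s
      by (rule td_tendsto[where u = "\<lambda>n. U (dn n) (cn n)"]) (intro U_tendsto d c that)+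
  qed
qed

end

section \<open>The critical parameter\<close>

text \<open>The Gaussian is \<open>exp (4 * u)\<close> for \<open>u = - e * s\<^sup>2 / 16\<close>,
  the upper bound available while the first moment stays \<open>e\<close> below
  \<open>c\<close>.\<close>

lemma gaussian_tail_small:
  fixes p e L :: real
  assumes "p > 0" "e > 0" "L > 0"
  shows "\<forall>\<^sub>F s in at_top. s * (1 + L * s powr (4 * p)) * exp (- e * s\<^sup>2 / 4) \<le> 1 / s\<^sup>2"
proof -
  have "((\<lambda>s. s ^ 3 * (1 + L * s powr (4 * p)) * exp (- e * s\<^sup>2 / 4)) \<longlongrightarrow> 0) at_top"
    using assms by real_asymp
  then have "\<forall>\<^sub>F s in at_top. s ^ 3 * (1 + L * s powr (4 * p)) * exp (- e * s\<^sup>2 / 4) < 1"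
    by (rule order_tendstoD) simp
  then show ?thesis using eventually_gt_at_top[of 0]
    by eventually_elim (simp add: field_simps power2_eq_square power3_eq_cube)
qed

lemma integral_inverse_square_le:
  fixes a b :: real
  assumes "0 < a" "a \<le> b"
  shows "(\<lambda>s. 1 / s\<^sup>2) integrable_on {a..b}" "integral {a..b} (\<lambda>s. 1 / s\<^sup>2) \<le> 1 / a"
proof -
  have "((\<lambda>s. 1 / s\<^sup>2) has_integral (- 1 / b - (- 1 / a))) {a..b}"
    by (rule fundamental_theorem_of_calculus)
       (use assms in \<open>auto intro!: derivative_eq_intros simp: power2_eq_square simp flip: has_real_derivative_iff_has_vector_derivative\<close>)
  then show "(\<lambda>s. 1 / s\<^sup>2) integrable_on {a..b}" "integral {a..b} (\<lambda>s. 1 / s\<^sup>2) \<le> 1 / a"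
    using assms by (auto simp: integral_unique has_integral_integrable)
qed

context pos_exponent
begin

abbreviation "D d c r \<equiv> mom 1 (td d (U d c)) r"

lemma D_mono: "d \<ge> 0 \<Longrightarrow> 0 \<le> r \<Longrightarrow> r \<le> r' \<Longrightarrow> D d c r \<le> D d c r'"
  by (intro mom_mono cont_td cont_U td_bounds)

lemma D_nonneg: "d \<ge> 0 \<Longrightarrow> D d c r \<ge> 0"
  by (intro mom_nonneg td_bounds)

lemma D_antimono:
  assumes "d \<ge> 0" "c \<le> c'"
  shows "D d c' r \<le> D d c r"
  unfolding mom_def
proof (rule Henstock_Kurzweil_Integration.integral_le)
  fix s assume "s \<in> {0..r}"
  then show "s ^ 1 * td d (U d c') s \<le> s ^ 1 * td d (U d c) s"
    using assms by (intro mult_left_mono td_mono U_antimono) auto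
qed (intro moments_existD moments_U assms)+

lemma U_le: "d \<ge> 0 \<Longrightarrow> r \<ge> 0 \<Longrightarrow> U d c r \<le> - (r\<^sup>2 / 16 * (c - D d c r))"
  by (subst U_eq) (assumption | intro pot_bounds moments_U td_bounds)+

text \<open>As long as \<open>D d c r \<le> c - e\<close>, the solution lies below \<open>- e r\<^sup>2 / 16\<close>, and then \<open>D\<close> gains less than \<open>1 / R\<close> beyond
  the radius \<open>R\<close>, too little to reach \<open>c - e\<close>.\<close>

lemma bootstrap:
  assumes d: "d \<ge> 0" and e: "e > 0" and R: "R > 0"
    and tail: "\<And>s. s \<ge> R \<Longrightarrow> s * weight p d s * exp (- e * s\<^sup>2 / 4) \<le> 1 / s\<^sup>2"
    and start: "D d c R + 1 / R < c - e" and r: "r \<ge> R"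
  shows "D d c r \<le> c - e"
proof (rule ccontr)
  assume "\<not> ?thesis"
  then have r1: "D d c r \<ge> c - e" by simp
  have cont: "continuous_on {R..r} (D d c)"
    by (rule continuous_on_subset[OF continuous_on_mom'[OF moments_U[OF d]]]) (use R in auto)
  have "D d c R \<le> c - e"
    using start R by (smt (verit) divide_pos_pos)
  from IVT'[OF this r1 r cont] obtain r2 where r2: "R \<le> r2" "D d c r2 = c - e" by auto
  have "D d c r2 - D d c R = integral {R..r2} (\<lambda>s. s ^ 1 * td d (U d c) s)"
    by (rule mom_diff) (use R r2 d in \<open>auto intro!: cont_td cont_U\<close>)
  also have "\<dots> \<le> integral {R..r2} (\<lambda>s. 1 / s\<^sup>2)"
  proof (rule Henstock_Kurzweil_Integration.integral_le)
    show "(\<lambda>s. s ^ 1 * td d (U d c) s) integrable_on {R..r2}"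
      by (rule mom_integrand_integrable) (use R d in \<open>auto intro!: cont_td cont_U\<close>)
    show "(\<lambda>s. 1 / s\<^sup>2) integrable_on {R..r2}"
      by (rule integral_inverse_square_le[OF R r2(1)])
    fix s assume s: "s \<in> {R..r2}"
    have "D d c s \<le> c - e" using D_mono[OF d, of s r2 c] s r2 R by auto
    then have "s\<^sup>2 / 16 * e \<le> s\<^sup>2 / 16 * (c - D d c s)" by (intro mult_left_mono) auto
    moreover have "U d c s \<le> - (s\<^sup>2 / 16 * (c - D d c s))" using s R by (intro U_le d) auto
    ultimately have "U d c s \<le> - (s\<^sup>2 / 16 * e)" by linarith
    then have "4 * min (U d c s) 0 \<le> - e * s\<^sup>2 / 4" by (simp add: min_def mult_ac)
    then have "td d (U d c) s \<le> weight p d s * exp (- e * s\<^sup>2 / 4)"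
      unfolding trunc_density_def using weight_ge_1[OF d, of p s] by (intro mult_left_mono) auto
    then have "s * td d (U d c) s \<le> s * (weight p d s * exp (- e * s\<^sup>2 / 4))"
      using s R by (intro mult_left_mono) auto
    also have "\<dots> \<le> 1 / s\<^sup>2" using tail[of s] s by (simp add: mult_ac)
    finally show "s ^ 1 * td d (U d c) s \<le> 1 / s\<^sup>2" by simp
  qed
  also have "\<dots> \<le> 1 / R" by (rule integral_inverse_square_le[OF R r2(1)])
  finally show False using r2 start by linarith
qed

lemma tail_radius:
  assumes "e > 0" "L \<ge> 0"
  obtains R where "R > 0" "1 / R < e" 
    "\<And>d s. 0 \<le> d \<Longrightarrow> d \<le> L \<Longrightarrow> s \<ge> R \<Longrightarrow> s * weight p d s * exp (- e * s\<^sup>2 / 4) \<le> 1 / s\<^sup>2"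
proof -
  \<comment> \<open>\<open>gaussian_tail_small\<close> asks for a positive coefficient while
    \<open>L\<close> may be 0, hence \<open>L + 1\<close>.\<close>
  have "\<forall>\<^sub>F s in at_top. s * weight p (L + 1) s * exp (- e * s\<^sup>2 / 4) \<le> 1 / s\<^sup>2"
    unfolding weight_def by (rule gaussian_tail_small) (use assms p_pos in auto)
  then obtain R0 where R0: "\<And>s. s \<ge> R0 \<Longrightarrow> s * weight p (L + 1) s * exp (- e * s\<^sup>2 / 4) \<le> 1 / s\<^sup>2"
    by (auto simp: eventually_at_top_linorder)
  define R where "R = max R0 (1 + 1 / e)"
  have R: "R > 0" "R \<ge> R0" "R > 1 / e" using assms by (auto simp: R_def add_pos_pos intro: less_max_iff_disj[THEN iffD2])
  have "1 / R < e" using R assms by (simp add: field_simps)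
  moreover have "s * weight p d s * exp (- e * s\<^sup>2 / 4) \<le> 1 / s\<^sup>2" if "0 \<le> d" "d \<le> L" "s \<ge> R" for d s
  proof -
    have "weight p d s \<le> weight p (L + 1) s"
      using that by (auto simp: weight_def intro!: mult_right_mono)
    then have "s * weight p d s * exp (- e * s\<^sup>2 / 4) \<le> s * weight p (L + 1) s * exp (- e * s\<^sup>2 / 4)"
      using that R by (intro mult_right_mono mult_left_mono) auto
    also have "\<dots> \<le> 1 / s\<^sup>2" using R0[of s] that R by linarith
    finally show ?thesis .
  qed
  ultimately show ?thesis using that R by blast
qed

text \<open>A gap below \<open>c\<close> survives perturbation: up to a fixed radius by convergence
  of the moments, beyond it by \<open>bootstrap\<close> with a radius uniform in the bounded
  coefficients.\<close>

lemma subcritical_open: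
  assumes d: "\<And>n. dn n \<ge> 0" "dn \<longlonglongrightarrow> d" and c: "cn \<longlonglongrightarrow> c" and e: "e > 0"
    and le: "\<And>r. r \<ge> 0 \<Longrightarrow> D d c r \<le> c - e"
  shows "\<forall>\<^sub>F n in sequentially. \<forall>r\<ge>0. D (dn n) (cn n) r \<le> cn n"
proof -
  have "Bseq dn" using d(2) by (intro convergent_imp_Bseq) (auto simp: convergent_def)
  then obtain L where "L > 0" and L: "\<And>n. \<bar>dn n\<bar> \<le> L" by (auto simp: Bseq_def)
  \<comment> \<open>Half of the gap is kept at the radius \<open>R\<close>, and \<open>1 / R\<close>
    costs at most another quarter, which leaves \<open>e / 4\<close> for
    \<open>bootstrap\<close>.\<close>
  obtain R where R: "R > 0" "1 / R < e / 4"
    "\<And>d s. 0 \<le> d \<Longrightarrow> d \<le> L \<Longrightarrow> s \<ge> R \<Longrightarrow> s * weight p d s * exp (- (e / 4) * s\<^sup>2 / 4) \<le> 1 / s\<^sup>2"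
    using tail_radius[of "e / 4" L] e \<open>L > 0\<close> by auto
  have "(\<lambda>n. D (dn n) (cn n) R - cn n) \<longlonglongrightarrow> D d c R - c"
    by (intro tendsto_intros mom_U_tendsto d c)
  then have "\<forall>\<^sub>F n in sequentially. D (dn n) (cn n) R - cn n < - (e / 2)"
    by (rule order_tendstoD) (use le[of R] R e in auto)
  then show ?thesis
  proof eventually_elim
    case (elim n)
    have dn: "0 \<le> dn n" "dn n \<le> L" using d(1)[of n] L[of n] by auto
    have "D (dn n) (cn n) R + 1 / R < cn n - e / 4" using elim R by linarith
    then have *: "D (dn n) (cn n) r \<le> cn n - e / 4" if "r \<ge> R" for r
      using that e R by (intro bootstrap[where R = R] dn) (auto intro!: R(3) dn)
    show ?case
    proof (intro allI impI)
      fix r :: real assume "r \<ge> 0"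
      show "D (dn n) (cn n) r \<le> cn n"
        using *[of r] *[of R] D_mono[OF dn(1) \<open>r \<ge> 0\<close>, of R "cn n"] e by (cases "r \<le> R") auto
    qed
  qed
qed

text \<open>\<open>U d c\<close> solves the integral equation if \<open>D d c r\<close> tends to \<open>c\<close>. Since \<open>D d c r\<close> decreases in \<open>c\<close>, this happens at the
  least \<open>c\<close> that bounds it.\<close>

definition good :: "real \<Rightarrow> real set" where
  "good d = {c. c \<ge> 0 \<and> (\<forall>r\<ge>0. D d c r \<le> c)}"

definition crit :: "real \<Rightarrow> real" where "crit d = Inf (good d)"

text \<open>Up to a fixed radius the moment is at most \<open>Q\<close>, whatever \<open>c\<close>
  is, because the truncated density is bounded by the weight. For \<open>c = Q + 3\<close> the gap
  at that radius is large enough for \<open>bootstrap\<close>.\<close>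

lemma good_nonempty:
  assumes d: "d \<ge> 0" shows "good d \<noteq> {}"
proof -
  obtain R where R: "R > 0" "1 / R < 1"
    "\<And>d' s. 0 \<le> d' \<Longrightarrow> d' \<le> d \<Longrightarrow> s \<ge> R \<Longrightarrow> s * weight p d' s * exp (- 1 * s\<^sup>2 / 4) \<le> 1 / s\<^sup>2"
    using tail_radius[of 1 d] d by auto
  define Q where "Q = mom 1 (weight p d) R"
  have Q: "Q \<ge> 0" unfolding Q_def using weight_ge_1[OF d, of p] by (intro mom_nonneg) (meson order_trans zero_le_one)
  have DQ: "D d c R \<le> Q" for c
    unfolding Q_def mom_def
  proof (rule Henstock_Kurzweil_Integration.integral_le)
    show "(\<lambda>s. s ^ 1 * weight p d s) integrable_on {0..R}"
      by (intro moments_existD moments_exist_continuous cont_weight)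
    show "(\<lambda>s. s ^ 1 * td d (U d c) s) integrable_on {0..R}"
      by (intro moments_existD moments_U d)
  qed (auto intro!: mult_left_mono td_bounds d)
  have *: "D d (Q + 3) r \<le> Q + 3 - 1" if "r \<ge> R" for r
  proof (rule bootstrap[OF d _ R(1) _ _ that])
    show "D d (Q + 3) R + 1 / R < Q + 3 - 1" using DQ[of "Q + 3"] R(2) by linarith
  qed (use R(3)[OF d order_refl] in auto)
  have "D d (Q + 3) r \<le> Q + 3" if "r \<ge> 0" for r
    using *[of r] *[of R] D_mono[OF d that, of R "Q + 3"] by (cases "r \<le> R") auto
  then have "Q + 3 \<in> good d" using Q by (auto simp: good_def)
  then show ?thesis by blast
qed

lemma good_upward: "d \<ge> 0 \<Longrightarrow> c \<in> good d \<Longrightarrow> c \<le> c' \<Longrightarrow> c' \<in> good d"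
  unfolding good_def mem_Collect_eq by (meson D_antimono order_trans)

lemma bdd_below_good: "bdd_below (good d)"
  by (auto simp: good_def bdd_below_def)

lemma crit_nonneg: "d \<ge> 0 \<Longrightarrow> crit d \<ge> 0"
  unfolding crit_def by (intro cInf_greatest good_nonempty) (auto simp: good_def)

lemma good_above_crit: 
  assumes "d \<ge> 0" "c > crit d" shows "c \<in> good d"
proof -
  obtain c' where "c' \<in> good d" "c' < c"
    using assms cInf_less_iff[OF good_nonempty[OF assms(1)] bdd_below_good, of c] by (auto simp: crit_def)
  then show ?thesis using good_upward[OF assms(1), of c' c] by simp
qed

lemma crit_le: "c \<in> good d \<Longrightarrow> crit d \<le> c"
  unfolding crit_def by (rule cInf_lower[OF _ bdd_below_good])

lemma LIMSEQ_shift_inverse: "(\<lambda>n. x + a * inverse (real (Suc n))) \<longlonglongrightarrow> x" for x a :: real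
  using tendsto_add[OF tendsto_const[of x] tendsto_mult[OF tendsto_const[of a] LIMSEQ_inverse_real_of_nat]] by simp

lemma D_crit_le:
  assumes d: "d \<ge> 0" and r: "r \<ge> 0"
  shows "D d (crit d) r \<le> crit d"
proof (rule LIMSEQ_le)
  show "(\<lambda>n. D d (crit d + 1 * inverse (real (Suc n))) r) \<longlonglongrightarrow> D d (crit d) r"
    by (intro mom_U_tendsto tendsto_const LIMSEQ_shift_inverse d)
  show "(\<lambda>n. crit d + 1 * inverse (real (Suc n))) \<longlonglongrightarrow> crit d"
    by (rule LIMSEQ_shift_inverse)
  have "crit d + 1 * inverse (real (Suc n)) \<in> good d" for n
    by (rule good_above_crit[OF d]) simp
  then show "\<exists>N. \<forall>n\<ge>N. D d (crit d + 1 * inverse (real (Suc n))) r \<le> crit d + 1 * inverse (real (Suc n))"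
    using r by (auto simp: good_def)
qed

text \<open>If a gap remained at the least admissible value, \<open>subcritical_open\<close> would
  make slightly smaller values admissible as well.\<close>

lemma D_crit_sharp:
  assumes d: "d \<ge> 0" and e: "e > 0"
  shows "\<exists>r\<ge>0. D d (crit d) r > crit d - e"
proof (rule ccontr)
  assume "\<not> ?thesis"
  then have le: "D d (crit d) r \<le> crit d - e" if "r \<ge> 0" for r using that by (auto simp: not_less)
  have lim: "(\<lambda>n. crit d + (-1) * inverse (real (Suc n))) \<longlonglongrightarrow> crit d" by (rule LIMSEQ_shift_inverse)
  \<comment> \<open>The moment at radius 0 vanishes, so a gap forces \<open>crit d \<ge> e\<close>.
    The smaller values are then eventually positive, as membership in \<open>good\<close>
    requires.\<close>
  have pos: "crit d > 0" using le[of 0] e by simp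
  have "\<forall>\<^sub>F n in sequentially. \<forall>r\<ge>0. D d (crit d + (-1) * inverse (real (Suc n))) r \<le> crit d + (-1) * inverse (real (Suc n))"
    using subcritical_open[OF d tendsto_const lim e le] .
  moreover have "\<forall>\<^sub>F n in sequentially. crit d + (-1) * inverse (real (Suc n)) > 0"
    using lim pos by (rule order_tendstoD)
  ultimately have "\<forall>\<^sub>F n in sequentially. crit d + (-1) * inverse (real (Suc n)) \<in> good d"
    by eventually_elim (auto simp: good_def)
  then obtain n where "crit d + (-1) * inverse (real (Suc n)) \<in> good d"
    by (auto simp: eventually_sequentially)
  from crit_le[OF this] have "inverse (real (Suc n)) \<le> 0" by linarith
  moreover have "inverse (real (Suc n)) > 0" by simp
  ultimately show False by linarith
qed

lemma D_crit_tendsto: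
  assumes d: "d \<ge> 0" shows "(D d (crit d) \<longlongrightarrow> crit d) at_top"
proof (rule order_tendstoI)
  fix a assume "a < crit d"
  then obtain r where r: "r \<ge> 0" "D d (crit d) r > a" using D_crit_sharp[OF d, of "crit d - a"] by auto
  then show "\<forall>\<^sub>F x in at_top. a < D d (crit d) x"
    using D_mono[OF d] by (intro eventually_mono[OF eventually_ge_at_top[of r]]) (auto intro: less_le_trans)
next
  fix a assume "a > crit d"
  then show "\<forall>\<^sub>F x in at_top. a > D d (crit d) x"
    using D_crit_le[OF d] by (intro eventually_mono[OF eventually_ge_at_top[of 0]]) (auto intro: le_less_trans)
qed

text \<open>Below \<open>crit d\<close> the bound fails at one radius, and this failure is stable
  under convergence; above it there is a gap, and \<open>subcritical_open\<close> applies.\<close>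

lemma crit_tendsto:
  assumes d: "\<And>n. dn n \<ge> 0" "dn \<longlonglongrightarrow> d"
  shows "(\<lambda>n. crit (dn n)) \<longlonglongrightarrow> crit d"
proof (rule order_tendstoI)
  have d0: "d \<ge> 0" by (rule tendsto_lowerbound[OF d(2)]) (auto simp: d)
  {
    fix a assume a: "a < crit d"
    show "\<forall>\<^sub>F n in sequentially. a < crit (dn n)"
    proof (cases "a < 0")
      case True
      then show ?thesis using crit_nonneg[OF d(1)] by (intro always_eventually allI) (rule less_le_trans)
    next
      case False
      obtain c where c: "a < c" "c < crit d" using dense[OF a] by blast
      then have "c \<notin> good d" using crit_le[of c d] by auto
      then obtain r where r: "r \<ge> 0" "D d c r > c" using c False by (auto simp: good_def)
      have "(\<lambda>n. D (dn n) c r) \<longlonglongrightarrow> D d c r"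
        by (intro mom_U_tendsto d tendsto_const)
      then have "\<forall>\<^sub>F n in sequentially. D (dn n) c r > c"
        using r(2) by (rule order_tendstoD)
      then show ?thesis
      proof eventually_elim
        case (elim n)
        then have "c \<notin> good (dn n)" using r(1) by (auto simp: good_def not_le)
        then have "crit (dn n) \<ge> c" using good_above_crit[OF d(1)[of n], of c] by linarith
        then show ?case using c by simp
      qed
    qed
  next
    fix a assume a: "a > crit d"
    obtain c where c: "crit d < c" "c < a" using dense[OF a] by blast
    have "D d c r \<le> c - (c - crit d)" if "r \<ge> 0" for r
      using D_antimono[OF d0, of "crit d" c r] D_crit_le[OF d0 that] c by simp
    from subcritical_open[OF d tendsto_const _ this] c
    have "\<forall>\<^sub>F n in sequentially. \<forall>r\<ge>0. D (dn n) c r \<le> c" by simp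
    then show "\<forall>\<^sub>F n in sequentially. crit (dn n) < a"
    proof eventually_elim
      case (elim n)
      then have "c \<in> good (dn n)" using crit_nonneg[OF d0] c by (auto simp: good_def)
      then show ?case using crit_le[of c "dn n"] c by simp
    qed
  }
qed

definition sol :: "real \<Rightarrow> real \<Rightarrow> real" where "sol d = U d (crit d)"

text \<open>At the critical value the moment never exceeds \<open>c\<close>, so \<open>U_le\<close>
  gives a nonpositive bound and the truncation is inactive.\<close>

lemma sol_nonpos: 
  assumes "d \<ge> 0" "r \<ge> 0" shows "sol d r \<le> 0"
proof -
  have "0 \<le> r\<^sup>2 / 16 * (crit d - D d (crit d) r)"
    using D_crit_le[OF assms] by simp
  with U_le[OF assms, of "crit d"] show ?thesis unfolding sol_def by linarith
qed

lemma td_sol: "d \<ge> 0 \<Longrightarrow> s \<ge> 0 \<Longrightarrow> td d (sol d) s = radial_density p d (sol d) s"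
  using sol_nonpos[of d s] by (simp add: trunc_density_def radial_density_def min_def)

lemma mom_td_sol: "d \<ge> 0 \<Longrightarrow> mom k (td d (sol d)) r = mom k (radial_density p d (sol d)) r"
  unfolding mom_def by (intro Henstock_Kurzweil_Integration.integral_cong) (simp add: td_sol)

lemma lmom_td_sol: "d \<ge> 0 \<Longrightarrow> lmom (td d (sol d)) r = lmom (radial_density p d (sol d)) r"
  unfolding lmom_def by (intro Henstock_Kurzweil_Integration.integral_cong) (simp add: td_sol)

lemma radial_solution_sol:
  assumes d: "d \<ge> 0"
  shows "radial_solution p d 0 (crit d) (sol d)"
proof
  show "p > 0" "d \<ge> 0" by (fact p_pos d)+
  show "continuous_on {0..} (sol d)" unfolding sol_def by (rule cont_U[OF d])
  show "(mom 1 (radial_density p d (sol d)) \<longlongrightarrow> crit d) at_top"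
    using D_crit_tendsto[OF d] by (simp add: mom_td_sol[OF d] flip: sol_def)
  show "sol d r = 0 + pot (crit d) (radial_density p d (sol d)) r" if "r > 0" for r
    using U_eq[OF d, of r "crit d"] that
    by (simp add: pot_def mom_td_sol[OF d] lmom_td_sol[OF d] flip: sol_def)
qed

end

section \<open>Continuity and range of the mass\<close>

context pos_exponent
begin

definition mass :: "real \<Rightarrow> real" where "mass d = radial_solution.\<beta> p d (sol d)"
definition mass0 :: "real \<Rightarrow> real" where "mass0 d = radial_solution.\<beta>0 (sol d)"

lemma sol_tendsto:
  assumes d: "\<And>n. dn n \<ge> 0" "dn \<longlonglongrightarrow> d" and r: "r \<ge> 0"
  shows "(\<lambda>n. sol (dn n) r) \<longlonglongrightarrow> sol d r"
  unfolding sol_def by (intro U_tendsto d crit_tendsto r)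

lemma mom_sol_tendsto:
  assumes d: "\<And>n. dn n \<ge> 0" "dn \<longlonglongrightarrow> d"
  shows "(\<lambda>n. mom k (radial_density p (dn n) (sol (dn n))) r) \<longlonglongrightarrow> mom k (radial_density p d (sol d)) r"
proof -
  have d0: "d \<ge> 0" by (rule tendsto_lowerbound[OF d(2)]) (auto simp: d)
  show ?thesis
    using mom_U_tendsto[OF d crit_tendsto[OF d], of k r]
    by (simp add: mom_td_sol[OF d(1)] mom_td_sol[OF d0] flip: sol_def)
qed

lemma mom0_sol_tendsto:
  assumes d: "\<And>n. dn n \<ge> 0" "dn \<longlonglongrightarrow> d"
  shows "(\<lambda>n. mom k (\<lambda>s. exp (4 * sol (dn n) s)) r) \<longlonglongrightarrow> mom k (\<lambda>s. exp (4 * sol d s)) r"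
proof (rule moments_dominated_convergence(2))
  show "moments_exist (\<lambda>s. exp (4 * sol (dn n) s))" for n
    unfolding sol_def by (intro moments_exist_continuous continuous_intros cont_U d)
  show "continuous_on {0..} (\<lambda>s. 1 :: real)" by simp
  show "\<bar>exp (4 * sol (dn n) s)\<bar> \<le> 1" if "s \<ge> 0" for n s
    using sol_nonpos[OF d(1) that] by simp
  show "(\<lambda>n. exp (4 * sol (dn n) s)) \<longlonglongrightarrow> exp (4 * sol d s)" if "s \<ge> 0" for s
    by (intro tendsto_intros sol_tendsto d that)
qed

text \<open>The mass is a supremum of the masses of balls, and each of these is continuous in
  \<open>d\<close>.\<close>

lemma mass_lsc:
  assumes d: "\<And>n. dn n \<ge> 0" "dn \<longlonglongrightarrow> d" and x: "x < mass d"
  shows "\<forall>\<^sub>F n in sequentially. x < mass (dn n)"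
proof -
  have d0: "d \<ge> 0" by (rule tendsto_lowerbound[OF d(2)]) (auto simp: d)
  interpret S: radial_solution p d 0 "crit d" "sol d" by (rule radial_solution_sol[OF d0])
  obtain t where t: "4 * x < S.J t"
    using x less_cSUP_iff[OF _ S.bdd_J, of "4 * x"] by (auto simp: mass_def S.\<beta>_def S.Jinf_def)
  have "(\<lambda>n. mom 3 (radial_density p (dn n) (sol (dn n))) (exp t)) \<longlonglongrightarrow> S.J t"
    unfolding S.J_def by (rule mom_sol_tendsto[OF d])
  then have "\<forall>\<^sub>F n in sequentially. 4 * x < mom 3 (radial_density p (dn n) (sol (dn n))) (exp t)"
    using t by (rule order_tendstoD)
  then show ?thesis
  proof eventually_elim
    case (elim n)
    interpret Sn: radial_solution p "dn n" 0 "crit (dn n)" "sol (dn n)" by (rule radial_solution_sol[OF d(1)])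
    show ?case using elim Sn.J_le_Jinf[of t] by (simp add: mass_def Sn.\<beta>_def Sn.J_def)
  qed
qed

lemma mass0_lsc:
  assumes d: "\<And>n. dn n \<ge> 0" "dn \<longlonglongrightarrow> d" and x: "x < mass0 d"
  shows "\<forall>\<^sub>F n in sequentially. x < mass0 (dn n)"
proof -
  have d0: "d \<ge> 0" by (rule tendsto_lowerbound[OF d(2)]) (auto simp: d)
  interpret S: radial_solution p d 0 "crit d" "sol d" by (rule radial_solution_sol[OF d0])
  obtain t where t: "4 * x < S.J0 t"
    using x less_cSUP_iff[OF _ S.bdd_J0, of "4 * x"] by (auto simp: mass0_def S.\<beta>0_def S.J0inf_def)
  have "(\<lambda>n. mom 3 (\<lambda>s. exp (4 * sol (dn n) s)) (exp t)) \<longlonglongrightarrow> S.J0 t"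
    unfolding S.J0_def by (rule mom0_sol_tendsto[OF d])
  then have "\<forall>\<^sub>F n in sequentially. 4 * x < mom 3 (\<lambda>s. exp (4 * sol (dn n) s)) (exp t)"
    using t by (rule order_tendstoD)
  then show ?thesis
  proof eventually_elim
    case (elim n)
    interpret Sn: radial_solution p "dn n" 0 "crit (dn n)" "sol (dn n)" by (rule radial_solution_sol[OF d(1)])
    show ?case using elim Sn.J0_le_J0inf[of t] by (simp add: mass0_def Sn.\<beta>0_def Sn.J0_def)
  qed
qed

lemma mass_relation: 
  assumes "d \<ge> 0" shows "mass0 d = mass d * (2 + 2 * p - mass d) / (2 * p)"
proof -
  interpret S: radial_solution p d 0 "crit d" "sol d" by (rule radial_solution_sol[OF assms])
  show ?thesis using S.pohozaev p_pos
    by (simp add: mass_def mass0_def field_simps power2_eq_square)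
qed

lemma mass_gt: "d > 0 \<Longrightarrow> mass d > 1 + p"
  using radial_solution.\<beta>_gt(2)[OF radial_solution_sol, of d] by (simp add: mass_def)

lemma mass0_0: "mass0 0 = 2"
  using radial_solution.\<beta>_d0(2)[OF radial_solution_sol, of 0] by (simp add: mass0_def)

text \<open>Lower semicontinuity is \<open>mass0_lsc\<close>. For the upper half,
  \<open>mass0\<close> is a function of \<open>mass\<close> that decreases on
  \<open>{1 + p..}\<close>, where \<open>mass\<close> takes its values, so lower semicontinuity of
  \<open>mass\<close> bounds \<open>mass0\<close> from above.\<close>

lemma mass0_tendsto:
  assumes d: "\<And>n. dn n > 0" "dn \<longlonglongrightarrow> d" and "d > 0"
  shows "(\<lambda>n. mass0 (dn n)) \<longlonglongrightarrow> mass0 d"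
proof (rule order_tendstoI)
  have dn: "dn n \<ge> 0" for n using d(1)[of n] by simp
  show "\<forall>\<^sub>F n in sequentially. a < mass0 (dn n)" if "a < mass0 d" for a
    by (rule mass0_lsc[OF dn d(2) that])
  fix a assume a: "mass0 d < a"
  let ?\<psi> = "\<lambda>y. y * (2 + 2 * p - y) / (2 * p)"
  have "(?\<psi> \<longlongrightarrow> ?\<psi> (mass d)) (at_left (mass d))"
    using p_pos by (intro tendsto_intros) auto
  then have "\<forall>\<^sub>F y in at_left (mass d). ?\<psi> y < a"
    by (rule order_tendstoD) (use a mass_relation[of d] \<open>d > 0\<close> in simp)
  moreover have "\<forall>\<^sub>F y in at_left (mass d). y \<in> {1 + p<..<mass d}"
    by (rule eventually_at_leftI[OF _ mass_gt[OF \<open>d > 0\<close>]])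
  ultimately have "\<forall>\<^sub>F y in at_left (mass d). ?\<psi> y < a \<and> y \<in> {1 + p<..<mass d}"
    by (rule eventually_conj)
  then obtain y where y: "?\<psi> y < a" "1 + p < y" "y < mass d"
    using eventually_happens'[OF trivial_limit_at_left_real] by fastforce
  have "\<forall>\<^sub>F n in sequentially. y < mass (dn n)"
    by (rule mass_lsc[OF dn d(2) y(3)])
  then show "\<forall>\<^sub>F n in sequentially. mass0 (dn n) < a"
  proof eventually_elim
    case (elim n)
    have "0 \<le> (mass (dn n) - y) * (mass (dn n) + y - (2 + 2 * p))"
      using elim y(2) by (intro mult_nonneg_nonneg) auto
    then have "mass (dn n) * (2 + 2 * p - mass (dn n)) \<le> y * (2 + 2 * p - y)"
      by (simp add: algebra_simps)
    then have "mass0 (dn n) \<le> ?\<psi> y"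
      unfolding mass_relation[OF dn] using p_pos by (intro divide_right_mono) auto
    then show ?case using y(1) by simp
  qed
qed

lemma continuous_mass0: "continuous_on {0<..} mass0"
  unfolding continuous_on_sequentially comp_def
  by (auto intro!: mass0_tendsto)

text \<open>Lower semicontinuity at \<open>d = 0\<close>, where the value is exactly 2, reaches
  small positive coefficients.\<close>

lemma mass0_near_2:
  assumes "x < 2" shows "\<exists>d>0. x < mass0 d"
proof -
  have "(\<lambda>n. inverse (real (Suc n))) \<longlonglongrightarrow> 0" by (rule LIMSEQ_inverse_real_of_nat)
  from mass0_lsc[OF _ this, of x] assms have "\<forall>\<^sub>F n in sequentially. x < mass0 (inverse (real (Suc n)))"
    by (simp add: mass0_0)
  then obtain n where "x < mass0 (inverse (real (Suc n)))" by (auto simp: eventually_sequentially)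
  then show ?thesis by (intro exI[of _ "inverse (real (Suc n))"]) auto
qed

text \<open>The integral of \<open>F0\<close> is split at \<open>T\<close>: before \<open>T\<close>
  it is small because \<open>sol\<close> is nonpositive, after \<open>T\<close> because a large
  \<open>d\<close> makes \<open>F0\<close> a small fraction of \<open>F1\<close>, whose integral is
  bounded independently of \<open>d\<close>.\<close>

lemma mass0_near_0:
  assumes x: "x > 0" shows "\<exists>d>0. mass0 d < x"
proof -
  \<comment> \<open>With this \<open>T\<close> the bound \<open>exp T ^ 4 / 4\<close> for the part
    before \<open>T\<close> equals \<open>x\<close>.\<close>
  define T where "T = ln (4 * x) / 4"
  have T: "exp (4 * T) = 4 * x" using x by (simp add: T_def)
  \<comment> \<open>Chosen so that \<open>k\<close>, the ratio of \<open>F0\<close> to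
    \<open>F1\<close> at \<open>T\<close>, times the mass bound \<open>4 * (2 + 2 * p)\<close>
    equals \<open>x\<close>. In total \<open>J0inf\<close> is below \<open>2 * x\<close>, hence
    \<open>mass0 d\<close> below \<open>x / 2\<close>.\<close>
  define d where "d = exp (- 4 * p * T) * (4 * (2 + 2 * p)) / x"
  have d: "d > 0" using x p_pos by (auto simp: d_def intro!: divide_pos_pos mult_pos_pos)
  interpret S: radial_solution p d 0 "crit d" "sol d" by (rule radial_solution_sol) (use d in simp)
  have JT: "S.J0 T \<le> x"
  proof -
    have "S.J0 T \<le> integral {0..exp T} (\<lambda>s. s ^ 3)"
      unfolding S.J0_def mom_def
    proof (rule Henstock_Kurzweil_Integration.integral_le)
      show "(\<lambda>s. s ^ 3 * exp (4 * sol d s)) integrable_on {0..exp T}"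
        by (intro mom_integrand_integrable continuous_intros S.cont_u) auto
      show "(\<lambda>s::real. s ^ 3) integrable_on {0..exp T}"
        by (intro integrable_continuous_real continuous_intros)
      fix s assume "s \<in> {0..exp T}"
      then show "s ^ 3 * exp (4 * sol d s) \<le> s ^ 3"
        using sol_nonpos[of d s] d by (intro mult_left_le) auto
    qed
    also have "((\<lambda>s::real. s ^ 3) has_integral (exp T ^ 4 / 4 - 0 ^ 4 / 4)) {0..exp T}"
      by (rule fundamental_theorem_of_calculus)
         (auto intro!: derivative_eq_intros simp flip: has_real_derivative_iff_has_vector_derivative)
    then have "integral {0..exp T} (\<lambda>s::real. s ^ 3) = exp T ^ 4 / 4" by (simp add: integral_unique)
    also have "exp T ^ 4 = 4 * x" using T exp_of_nat_mult[of 4 T] by simp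
    finally show ?thesis by simp
  qed
  define k where "k = exp (- 4 * p * T) / d"
  have k: "k > 0" using d by (simp add: k_def)
  have J: "S.J0 t \<le> x + k * S.Jinf" for t
  proof (cases "T \<le> t")
    case True
    have "S.J0 t - k * S.J t \<le> S.J0 T - k * S.J T"
    proof (rule DERIV_nonpos_imp_nonincreasing[OF True, where f = "\<lambda>t. S.J0 t - k * S.J t"])
      fix s assume s: "T \<le> s" "s \<le> t"
      have "S.F1 s = d * exp (4 * p * s) * S.F0 s"
        by (simp add: S.F1_def S.F0_def exp_add)
      then have "k * S.F1 s = exp (4 * p * s - 4 * p * T) * S.F0 s"
        using d by (simp add: k_def exp_diff exp_minus field_simps)
      moreover have "exp (4 * p * s - 4 * p * T) \<ge> 1" using s p_pos by simp
      ultimately have "S.F0 s \<le> k * S.F1 s" using S.F0_pos[of s] by simp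
      also have "\<dots> \<le> k * S.F s" using k S.F0_pos[of s] by (simp add: S.F_def)
      finally have "S.F0 s - k * S.F s \<le> 0" by simp
      moreover have "((\<lambda>t. S.J0 t - k * S.J t) has_real_derivative S.F0 s - k * S.F s) (at s)"
        by (intro DERIV_diff DERIV_cmult S.DERIV_J0 S.DERIV_J)
      ultimately show "\<exists>y. ((\<lambda>t. S.J0 t - k * S.J t) has_real_derivative y) (at s) \<and> y \<le> 0" by blast
    qed
    moreover have "k * S.J t \<le> k * S.Jinf" "k * S.J T \<ge> 0"
      using k S.J_le_Jinf[of t] S.J_nonneg[of T] by auto
    ultimately show ?thesis using JT by linarith
  next
    case False
    then have "S.J0 t \<le> S.J0 T" by (intro S.J0_mono) simp
    moreover have "k * S.Jinf \<ge> 0" using k S.Jinf_pos by simp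
    ultimately show ?thesis using JT by linarith
  qed
  have "k * S.Jinf < k * (4 * (2 + 2 * p))"
    using S.\<beta>_bounds(2)[OF d] k by (intro mult_strict_left_mono) (auto simp: S.\<beta>_def)
  also have "\<dots> = x" using d x p_pos by (simp add: k_def d_def field_simps)
  finally have "k * S.Jinf < x" .
  moreover have "S.J0inf \<le> x + k * S.Jinf"
    unfolding S.J0inf_def by (intro cSUP_least J) auto
  ultimately have "mass0 d < x" using x by (simp add: mass0_def S.\<beta>0_def)
  with d show ?thesis by blast
qed

lemma mass_attained:
  assumes b: "max 2 (2 * p) < b" "b < 2 + 2 * p"
  shows "\<exists>d>0. mass d = b"
proof -
  define x where "x = b * (2 + 2 * p - b) / (2 * p)"
  have "x > 0" using b p_pos by (simp add: x_def)
  have "x < 2"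
  proof -
    have "(b - 2) * (b - 2 * p) > 0" using b by (intro mult_pos_pos) auto
    then have "b * (2 + 2 * p - b) < 2 * (2 * p)" by (simp add: algebra_simps)
    then show ?thesis using p_pos by (simp add: x_def field_simps)
  qed
  obtain d1 where d1: "d1 > 0" "mass0 d1 < x" using mass0_near_0[OF \<open>x > 0\<close>] by blast
  obtain d2 where d2: "d2 > 0" "x < mass0 d2" using mass0_near_2[OF \<open>x < 2\<close>] by blast
  have "connected (mass0 ` {0<..})"
    by (intro connected_continuous_image continuous_mass0) auto
  then have "x \<in> mass0 ` {0<..}"
    using connectedD_interval[of "mass0 ` {0<..}" "mass0 d1" "mass0 d2" x] d1 d2 by auto
  then obtain d where d: "d > 0" "mass0 d = x" by auto
  have "mass d * (2 + 2 * p - mass d) = b * (2 + 2 * p - b)"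
    using mass_relation[of d] d p_pos by (simp add: x_def)
  then have "(mass d - b) * (mass d + b - (2 + 2 * p)) = 0"
    by (simp add: algebra_simps)
  \<comment> \<open>The second root \<open>2 + 2 * p - b\<close> is excluded: \<open>mass d\<close>
    exceeds \<open>1 + p\<close>, and so does \<open>b\<close>, because the maximum of 2 and
    \<open>2 * p\<close> is at least their mean.\<close>
  moreover have "mass d + b - (2 + 2 * p) > 0" using mass_gt[OF d(1)] b by (auto simp: max_def split: if_splits)
  ultimately have "mass d = b" by simp
  with d show ?thesis by blast
qed

end

section \<open>Laws of the norm and of a coordinate\<close>

text \<open>The half-lines \<open>{..s}\<close> generate the Borel sets and are stable under
  intersection, so a measure with finite values on them is determined by its distribution
  function.\<close>

lemma measure_eq_density_of_cdf:
  fixes M :: "real measure" and G g :: "real \<Rightarrow> real"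
  assumes sets: "sets M = sets borel"
    and below: "\<And>s. s < a \<Longrightarrow> emeasure M {..s} = 0"
    and above: "\<And>s. s \<ge> a \<Longrightarrow> emeasure M {..s} = ennreal (G s)"
    and G: "G a = 0" "continuous_on {a..} G"
    and deriv: "\<And>s. s > a \<Longrightarrow> (G has_real_derivative g s) (at s)"
    and g: "\<And>s. s > a \<Longrightarrow> g s \<ge> 0" "g \<in> borel_measurable borel"
  shows "M = density lborel (\<lambda>s. ennreal (indicator {a<..} s * g s))"
proof (rule measure_eqI_generator_eq)
  let ?E = "range (\<lambda>s::real. {..s})"
  let ?N = "density lborel (\<lambda>s. ennreal (indicator {a<..} s * g s))"
  show "Int_stable ?E" by (auto simp: Int_stable_def)
  show "?E \<subseteq> Pow UNIV" by simp
  show "sets M = sigma_sets UNIV ?E" "sets ?N = sigma_sets UNIV ?E"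
    by (simp_all add: sets borel_eq_atMost)
  show "range (\<lambda>n. {..real n}) \<subseteq> ?E" by auto
  show "(\<Union>n. {..real n}) = UNIV" using real_arch_simple by auto
  show "emeasure M {..real n} \<noteq> \<infinity>" for n
    using below[of n] above[of n] by (cases "real n < a") auto
  fix X assume "X \<in> ?E"
  then obtain s where X: "X = {..s}" by auto
  note [measurable] = g(2)
  let ?f = "\<lambda>x. indicator {a<..} x * g x * indicator {..s} x"
  have "emeasure ?N X = (\<integral>\<^sup>+x. ennreal (?f x) \<partial>lborel)"
    unfolding X by (subst emeasure_density) (auto intro!: nn_integral_cong simp: indicator_def)
  also have "\<dots> = emeasure M X"
  proof (cases "s < a")
    case True
    then have z: "?f x = 0" for x by (auto simp: indicator_def)
    show ?thesis unfolding z X below[OF True] by simp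
  next
    case False
    then have s: "a \<le> s" by simp
    have "(g has_integral (G s - G a)) {a..s}"
    proof (rule fundamental_theorem_of_calculus_interior[OF s])
      show "continuous_on {a..s} G" by (rule continuous_on_subset[OF G(2)]) auto
      show "(G has_vector_derivative g x) (at x)" if "x \<in> {a<..<s}" for x
        using deriv[of x] that by (simp add: has_real_derivative_iff_has_vector_derivative)
    qed
    then have "((\<lambda>x. if x \<in> {a..s} then g x else 0) has_integral G s) UNIV"
      unfolding has_integral_restrict_UNIV by (simp add: G)
    then have "(?f has_integral G s) UNIV"
      by (rule has_integral_spike[of "{a}", rotated 2]) (auto simp: indicator_def)
    moreover have "?f x \<ge> 0" for x using g(1) by (auto simp: indicator_def)
    ultimately have "(\<integral>\<^sup>+x. ennreal (?f x) \<partial>lborel) = ennreal (G s)"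
      by (intro nn_integral_has_integral_lborel) auto
    then show ?thesis using above[OF s] by (simp add: X)
  qed
  finally show "emeasure M X = emeasure ?N X" by simp
qed

text \<open>Polar coordinates for radial functions: the distribution function of the norm is the
  volume of a ball.\<close>

lemma distr_norm_lborel:
  "distr (lborel :: 'a::euclidean_space measure) borel norm =
     density lborel (\<lambda>s. ennreal (indicator {0<..} s * (unit_ball_vol DIM('a) * (DIM('a) * s ^ (DIM('a) - 1)))))"
proof (rule measure_eq_density_of_cdf[where G = "\<lambda>s. unit_ball_vol DIM('a) * s ^ DIM('a)"])
  have *: "emeasure (distr lborel borel (norm :: 'a \<Rightarrow> real)) {..s} = emeasure lborel (cball (0::'a) s)" for s
    by (subst emeasure_distr) (auto intro!: arg_cong2[where f = emeasure] simp: cball_def)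
  show "emeasure (distr lborel borel (norm :: 'a \<Rightarrow> real)) {..s} = 0" if "s < 0" for s
    unfolding * using that by simp
  show "emeasure (distr lborel borel (norm :: 'a \<Rightarrow> real)) {..s} = ennreal (unit_ball_vol DIM('a) * s ^ DIM('a))" if "0 \<le> s" for s
    unfolding * using that by (simp add: emeasure_cball)
  show "((\<lambda>s. unit_ball_vol DIM('a) * s ^ DIM('a)) has_real_derivative unit_ball_vol DIM('a) * (DIM('a) * s ^ (DIM('a) - 1))) (at s)" if "0 < s" for s :: real
    by (auto intro!: derivative_eq_intros)
qed (auto intro!: continuous_intros)

text \<open>The law of the norm on the slice of 4-space at first coordinate \<open>c\<close>. Its
  sublevel sets are balls of radius \<open>sqrt (s\<^sup>2 - c\<^sup>2)\<close> in dimension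
  3.\<close>

lemma distr_sqrt_norm_lborel:
  "distr (lborel :: (real ^ 3) measure) borel (\<lambda>v. sqrt (c\<^sup>2 + (norm v)\<^sup>2)) =
     density lborel (\<lambda>s. ennreal (indicator {\<bar>c\<bar><..} s * (4 * pi * (s * sqrt (s\<^sup>2 - c\<^sup>2)))))"
proof (rule measure_eq_density_of_cdf[where G = "\<lambda>s. 4 / 3 * pi * sqrt (s\<^sup>2 - c\<^sup>2) ^ 3"])
  let ?M = "distr (lborel :: (real ^ 3) measure) borel (\<lambda>v. sqrt (c\<^sup>2 + (norm v)\<^sup>2))"
  have *: "emeasure ?M {..s} = emeasure lborel {v :: real ^ 3. sqrt (c\<^sup>2 + (norm v)\<^sup>2) \<le> s}" for s
    by (subst emeasure_distr) (auto intro!: arg_cong2[where f = emeasure])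
  show "emeasure ?M {..s} = 0" if "s < \<bar>c\<bar>" for s
  proof -
    have "\<bar>c\<bar> \<le> sqrt (c\<^sup>2 + x\<^sup>2)" for x by (rule real_le_rsqrt) simp
    then have "{v :: real ^ 3. sqrt (c\<^sup>2 + (norm v)\<^sup>2) \<le> s} = {}"
      using that by (auto simp: not_le intro: less_le_trans)
    then show ?thesis by (simp add: *)
  qed
  show "emeasure ?M {..s} = ennreal (4 / 3 * pi * sqrt (s\<^sup>2 - c\<^sup>2) ^ 3)" if s: "\<bar>c\<bar> \<le> s" for s
  proof -
    have cs: "c\<^sup>2 \<le> s\<^sup>2" using s by (metis abs_le_square_iff abs_ge_zero abs_of_nonneg order_trans)
    have "(sqrt (c\<^sup>2 + x\<^sup>2) \<le> s) = (x \<le> sqrt (s\<^sup>2 - c\<^sup>2))" if "x \<ge> 0" for x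
    proof -
      have "(sqrt (c\<^sup>2 + x\<^sup>2) \<le> s) = (c\<^sup>2 + x\<^sup>2 \<le> s\<^sup>2)"
        using s by (metis abs_ge_zero order_trans real_sqrt_le_iff real_sqrt_abs abs_of_nonneg)
      also have "\<dots> = (x\<^sup>2 \<le> s\<^sup>2 - c\<^sup>2)" by auto
      also have "\<dots> = (x \<le> sqrt (s\<^sup>2 - c\<^sup>2))"
        using that by (metis abs_of_nonneg real_sqrt_abs real_sqrt_le_iff)
      finally show ?thesis .
    qed
    then have "{v :: real ^ 3. sqrt (c\<^sup>2 + (norm v)\<^sup>2) \<le> s} = cball 0 (sqrt (s\<^sup>2 - c\<^sup>2))" by auto
    then show ?thesis using cs by (simp add: * emeasure_cball unit_ball_vol_3)
  qed
  show "continuous_on {\<bar>c\<bar>..} (\<lambda>s. 4 / 3 * pi * sqrt (s\<^sup>2 - c\<^sup>2) ^ 3)"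
    by (intro continuous_intros)
  fix s assume s: "\<bar>c\<bar> < s"
  have cs: "s\<^sup>2 - c\<^sup>2 > 0" using s by (simp add: abs_le_square_iff power2_strict_mono)
  show "((\<lambda>s. 4 / 3 * pi * sqrt (s\<^sup>2 - c\<^sup>2) ^ 3) has_real_derivative 4 * pi * (s * sqrt (s\<^sup>2 - c\<^sup>2))) (at s)"
  proof -
    have sq: "sqrt (s\<^sup>2 - c\<^sup>2) ^ 2 = s\<^sup>2 - c\<^sup>2" using cs by simp
    have "((\<lambda>s. sqrt (s\<^sup>2 - c\<^sup>2)) has_real_derivative s / sqrt (s\<^sup>2 - c\<^sup>2)) (at s)"
      using cs by (auto intro!: derivative_eq_intros simp: field_simps)
    from DERIV_cmult[OF DERIV_power[OF this, of 3], of "4 / 3 * pi"]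
    show ?thesis
      by (rule DERIV_cong) (use cs in \<open>simp add: field_simps power2_eq_square\<close>)
  qed
  show "4 * pi * (s * sqrt (s\<^sup>2 - c\<^sup>2)) \<ge> 0" using s cs by simp
qed auto

text \<open>A bijection of orthonormal bases pulls boxes back to boxes with the same side lengths.
  It serves to identify \<open>real ^ 4\<close> with \<open>real \<times> real ^ 3\<close>, where
  Fubini is available.\<close>

lemma distr_basis_bij_lborel:
  fixes \<sigma> :: "'a::euclidean_space \<Rightarrow> 'b::euclidean_space"
  assumes bij: "bij_betw \<sigma> Basis Basis"
  defines "f \<equiv> \<lambda>x. \<Sum>b\<in>Basis. (x \<bullet> b) *\<^sub>R \<sigma> b"
  shows "distr lborel borel f = lborel" "\<And>x. norm (f x) = norm x" "\<And>x b. b \<in> Basis \<Longrightarrow> f x \<bullet> \<sigma> b = x \<bullet> b"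
    "f \<in> borel_measurable borel"
proof -
  have \<sigma>: "\<sigma> b \<in> Basis" if "b \<in> Basis" for b using bij that by (auto simp: bij_betw_def)
  have inj: "\<sigma> b = \<sigma> b' \<longleftrightarrow> b = b'" if "b \<in> Basis" "b' \<in> Basis" for b b'
    using bij that by (auto simp: bij_betw_def inj_on_def)
  show fi: "f x \<bullet> \<sigma> b = x \<bullet> b" if b: "b \<in> Basis" for x b
  proof -
    have "f x \<bullet> \<sigma> b = (\<Sum>b'\<in>Basis. (x \<bullet> b') * (\<sigma> b' \<bullet> \<sigma> b))"
      by (simp add: f_def inner_sum_left)
    also have "\<dots> = (\<Sum>b'\<in>Basis. if b' = b then x \<bullet> b else 0)"
      using b \<sigma> inj by (intro sum.cong) (auto simp: inner_Basis)
    finally show ?thesis using b by simp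
  qed
  have reindex: "(\<Sum>b\<in>Basis. g b) = (\<Sum>b\<in>Basis. g (\<sigma> b))" for g :: "'b \<Rightarrow> real"
    by (rule sum.reindex_bij_betw[OF bij, symmetric])
  show "norm (f x) = norm x" for x
  proof -
    have "f x \<bullet> f x = (\<Sum>b\<in>Basis. (f x \<bullet> \<sigma> b) * (f x \<bullet> \<sigma> b))"
      by (subst euclidean_inner) (rule reindex)
    also have "\<dots> = (\<Sum>b\<in>Basis. (x \<bullet> b) * (x \<bullet> b))"
      by (intro sum.cong refl) (simp only: fi)
    also have "\<dots> = x \<bullet> x" by (rule euclidean_inner[symmetric])
    finally have "f x \<bullet> f x = x \<bullet> x" .
    then show ?thesis by (simp add: norm_eq_sqrt_inner)
  qed
  show m: "f \<in> borel_measurable borel"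
    unfolding f_def by measurable
  show "distr lborel borel f = lborel"
  proof (rule lborel_eqI[symmetric])
    fix l u :: 'b assume lu: "\<And>b. b \<in> Basis \<Longrightarrow> l \<bullet> b \<le> u \<bullet> b"
    define l' where "l' = (\<Sum>b\<in>Basis. (l \<bullet> \<sigma> b) *\<^sub>R b)"
    define u' where "u' = (\<Sum>b\<in>Basis. (u \<bullet> \<sigma> b) *\<^sub>R b)"
    have l'u': "l' \<bullet> b = l \<bullet> \<sigma> b" "u' \<bullet> b = u \<bullet> \<sigma> b" if "b \<in> Basis" for b
      using that by (simp_all add: l'_def u'_def inner_sum_left_Basis)
    have ball: "(\<forall>b\<in>Basis. Q b) = (\<forall>b\<in>Basis. Q (\<sigma> b))" for Q :: "'b \<Rightarrow> bool"
      using bij_betw_imp_surj_on[OF bij] by (metis imageE image_eqI)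
    have "f -` box l u = box l' u'"
      unfolding box_def vimage_def mem_Collect_eq by (subst ball) (simp add: fi l'u')
    then have "emeasure (distr lborel borel f) (box l u) = emeasure lborel (box l' u')"
      using m by (subst emeasure_distr) auto
    also have "\<dots> = (\<Prod>b\<in>Basis. (u' - l') \<bullet> b)"
      using lu \<sigma> by (simp add: emeasure_lborel_box_eq l'u')
    also have "\<dots> = (\<Prod>b\<in>Basis. (u - l) \<bullet> \<sigma> b)"
      by (intro arg_cong[where f = ennreal] prod.cong) (auto simp: inner_diff_left l'u')
    also have "\<dots> = (\<Prod>b\<in>Basis. (u - l) \<bullet> b)"
      by (intro arg_cong[where f = ennreal] prod.reindex_bij_betw[OF bij])
    finally show "emeasure (distr lborel borel f) (box l u) = (\<Prod>b\<in>Basis. (u - l) \<bullet> b)" .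
  qed simp
qed

lemma distr_orthogonal_lborel:
  fixes g :: "(real, 'n::{finite,wellorder}) vec \<Rightarrow> (real, 'n) vec"
  assumes g: "orthogonal_transformation g"
  shows "distr lborel borel g = lborel"
proof (rule lborel_eqI[symmetric])
  fix l u :: "(real, 'n) vec" assume lu: "\<And>b. b \<in> Basis \<Longrightarrow> l \<bullet> b \<le> u \<bullet> b"
  have m: "g \<in> borel_measurable borel"
    by (intro borel_measurable_continuous_onI linear_continuous_on linear_conv_bounded_linear[THEN iffD1] orthogonal_transformation_linear g)
  have v: "g -` box l u = inv g ` box l u"
    using bij_vimage_eq_inv_image[OF orthogonal_transformation_bij[OF g]] by simp
  have meas: "g -` box l u \<in> sets borel" using measurable_sets[OF m, of "box l u"] by simp
  have oi: "orthogonal_transformation (inv g)" by (rule orthogonal_transformation_inv[OF g])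
  have fm: "inv g ` box l u \<in> lmeasurable"
    by (rule measurable_orthogonal_image[OF oi]) simp
  have "emeasure (distr lborel borel g) (box l u) = emeasure lborel (g -` box l u)"
    using m by (subst emeasure_distr) auto
  also have "\<dots> = emeasure lebesgue (inv g ` box l u)" 
    using meas by (simp add: v)
  also have "\<dots> = ennreal (measure lebesgue (inv g ` box l u))"
    using fm by (simp add: emeasure_eq_measure2)
  also have "measure lebesgue (inv g ` box l u) = measure lebesgue (box l u)"
    by (rule measure_orthogonal_image[OF oi]) simp
  also have "\<dots> = (\<Prod>b\<in>Basis. (u - l) \<bullet> b)" using lu by (simp add: measure_lborel_box_eq)
  finally show "emeasure (distr lborel borel g) (box l u) = (\<Prod>b\<in>Basis. (u - l) \<bullet> b)" .
qed simp

text \<open>A rotation moves \<open>e\<close> to a coordinate axis and a change of bases turns the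
  inner product into the first component. Slicing by that component leaves the law of the norm on
  each 3-dimensional slice.\<close>

lemma nn_integral_norm_inner:
  fixes e :: "real ^ 4" and H :: "real \<times> real \<Rightarrow> ennreal"
  assumes e: "norm e = 1" and [measurable]: "H \<in> borel_measurable borel"
  shows "(\<integral>\<^sup>+y. H (norm y, y \<bullet> e) \<partial>lborel) =
    (\<integral>\<^sup>+c. \<integral>\<^sup>+s. ennreal (indicator {\<bar>c\<bar><..} s * (4 * pi * (s * sqrt (s\<^sup>2 - c\<^sup>2)))) * H (s, c) \<partial>lborel \<partial>lborel)"
proof -
  define e0 :: "real ^ 4" where "e0 = axis 1 1"
  have e0: "e0 \<in> Basis" "norm e0 = 1" by (auto simp: e0_def axis_in_Basis_iff)
  obtain g where g: "orthogonal_transformation g" "g e0 = e"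
    using orthogonal_transformation_exists[of e0 e] e e0 by auto
  have gm [measurable]: "g \<in> borel_measurable borel"
    by (intro borel_measurable_continuous_onI linear_continuous_on linear_conv_bounded_linear[THEN iffD1] orthogonal_transformation_linear g)
  have one: "(1, 0) \<in> (Basis :: (real \<times> (real ^ 3)) set)"
    unfolding Basis_prod_def by (rule UnI1) auto
  obtain \<sigma> :: "real \<times> (real ^ 3) \<Rightarrow> real ^ 4" where \<sigma>: "bij_betw \<sigma> Basis Basis" "\<sigma> (1, 0) = e0"
  proof -
    have "card (Basis - {(1 :: real, 0 :: real ^ 3)}) = card (Basis - {e0})"
      using one e0 by (simp add: card_Diff_singleton)
    then obtain h where h: "bij_betw h (Basis - {(1 :: real, 0 :: real ^ 3)}) (Basis - {e0})"
      using bij_betw_iff_card[of "Basis - {(1 :: real, 0 :: real ^ 3)}" "Basis - {e0}"] by auto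
    then have "bij_betw (h((1, 0) := e0)) (insert (1, 0) (Basis - {(1 :: real, 0 :: real ^ 3)})) (insert e0 (Basis - {e0}))"
      by (auto simp: bij_betw_def inj_on_def)
    then show ?thesis using that[of "h((1, 0) := e0)"] one e0 by (simp add: insert_absorb)
  qed
  define f where "f x = (\<Sum>b\<in>Basis. (x \<bullet> b) *\<^sub>R \<sigma> b)" for x
  note f = distr_basis_bij_lborel[OF \<sigma>(1), folded f_def[abs_def], folded f_def]
  have fe: "f x \<bullet> e0 = fst x" for x
    using f(3)[OF one, of x] \<sigma>(2) by (simp add: inner_prod_def)
  note [measurable] = f(4)
  have "(\<lambda>x. (norm x, fst (x :: real \<times> (real ^ 3)))) \<in> borel_measurable borel"
    by (intro borel_measurable_continuous_onI continuous_intros)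
  then have [measurable]: "(\<lambda>x. H (norm x, fst (x :: real \<times> (real ^ 3)))) \<in> borel_measurable borel"
    by (rule measurable_compose) measurable
  have "(\<integral>\<^sup>+y. H (norm y, y \<bullet> e) \<partial>lborel) = (\<integral>\<^sup>+y. H (norm y, y \<bullet> e) \<partial>distr lborel borel g)"
    by (simp add: distr_orthogonal_lborel[OF g(1)])
  also have "\<dots> = (\<integral>\<^sup>+y. H (norm (g y), g y \<bullet> e) \<partial>lborel)"
    by (subst nn_integral_distr) auto
  also have "\<dots> = (\<integral>\<^sup>+y. H (norm y, y \<bullet> e0) \<partial>lborel)"
  proof -
    have "norm (g y) = norm y" "g y \<bullet> e = y \<bullet> e0" for y
      using g(1) by (auto simp: orthogonal_transformation_norm orthogonal_transformation_def g(2)[symmetric])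
    then show ?thesis by simp
  qed
  also have "\<dots> = (\<integral>\<^sup>+y. H (norm y, y \<bullet> e0) \<partial>distr lborel borel f)"
    by (simp add: f(1))
  also have "\<dots> = (\<integral>\<^sup>+x. H (norm x, fst (x :: real \<times> (real ^ 3))) \<partial>lborel)"
    by (subst nn_integral_distr) (auto simp: f(2) fe)
  also have "\<dots> = (\<integral>\<^sup>+x. H (norm x, fst (x :: real \<times> (real ^ 3))) \<partial>(lborel \<Otimes>\<^sub>M lborel))"
    by (simp add: lborel_prod)
  also have "\<dots> = (\<integral>\<^sup>+c. \<integral>\<^sup>+v. H (norm (c, v :: real ^ 3), c) \<partial>lborel \<partial>lborel)"
    by (subst lborel.nn_integral_fst[symmetric]) (auto simp: lborel_prod)
  also have "\<dots> = (\<integral>\<^sup>+c. \<integral>\<^sup>+s. H (s, c) \<partial>distr (lborel :: (real ^ 3) measure) borel (\<lambda>v. sqrt (c\<^sup>2 + (norm v)\<^sup>2)) \<partial>lborel)"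
    by (intro nn_integral_cong, subst nn_integral_distr) (auto simp: norm_Pair)
  also have "\<dots> = (\<integral>\<^sup>+c. \<integral>\<^sup>+s. ennreal (indicator {\<bar>c\<bar><..} s * (4 * pi * (s * sqrt (s\<^sup>2 - c\<^sup>2)))) * H (s, c) \<partial>lborel \<partial>lborel)"
    unfolding distr_sqrt_norm_lborel
    by (intro nn_integral_cong, subst nn_integral_density) auto
  finally show ?thesis .
qed

text \<open>Applying the slice formula to indicators gives the joint law as a measure, which
  transfers integrability and signed integrals as well.\<close>

lemma distr_norm_inner:
  fixes e :: "real ^ 4"
  assumes e: "norm e = 1"
  shows "distr lborel borel (\<lambda>y. (norm y, y \<bullet> e)) =
    density (lborel :: (real \<times> real) measure) (\<lambda>(s, c). ennreal (indicator {\<bar>c\<bar><..} s * (4 * pi * (s * sqrt (s\<^sup>2 - c\<^sup>2)))))"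
    (is "?L = density lborel ?w")
proof (rule measure_eqI)
  fix A assume "A \<in> sets ?L"
  then have A [measurable]: "A \<in> sets borel" by simp
  have w [measurable]: "?w \<in> borel_measurable borel"
  proof -
    have "?w = (\<lambda>x. ennreal (if \<bar>snd x\<bar> < fst x then 4 * pi * (fst x * sqrt ((fst x)\<^sup>2 - (snd x)\<^sup>2)) else 0))"
      by (auto simp: indicator_def fun_eq_iff)
    also have "\<dots> \<in> borel_measurable borel"
      by (intro measurable_compose[OF _ measurable_ennreal] measurable_If borel_measurable_continuous_onI continuous_intros borel_measurable_pred_less)
         (auto intro!: borel_open open_Collect_less continuous_intros)
    finally show ?thesis .
  qed
  have "emeasure ?L A = (\<integral>\<^sup>+y. indicator A (norm y, y \<bullet> e) \<partial>lborel)"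
  proof -
    have "emeasure ?L A = (\<integral>\<^sup>+z. indicator A z \<partial>?L)" by simp
    also have "\<dots> = (\<integral>\<^sup>+y. indicator A (norm y, y \<bullet> e) \<partial>lborel)"
      by (subst nn_integral_distr) auto
    finally show ?thesis .
  qed
  also have "\<dots> = (\<integral>\<^sup>+c. \<integral>\<^sup>+s. ?w (s, c) * indicator A (s, c) \<partial>lborel \<partial>lborel)"
    by (subst nn_integral_norm_inner[OF e]) auto
  also have "\<dots> = (\<integral>\<^sup>+x. ?w x * indicator A x \<partial>(lborel \<Otimes>\<^sub>M lborel))"
    by (subst lborel_pair.nn_integral_snd) (auto simp: lborel_prod intro!: nn_integral_cong)
  also have "\<dots> = emeasure (density lborel ?w) A"
    by (subst emeasure_density) (auto simp: lborel_prod)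
  finally show "emeasure ?L A = emeasure (density lborel ?w) A" .
qed simp

section \<open>The spherical mean of the logarithm\<close>

text \<open>The product expands into cosines of frequencies \<open>n\<close> and
  \<open>n \<plusminus> 2\<close>, which integrate to 0 over \<open>{0..pi}\<close> unless the
  frequency is 0; for \<open>n \<ge> 1\<close> this happens only at \<open>n = 2\<close>.\<close>

lemma has_integral_cos_mult_sin_sq:
  assumes n: "n \<ge> 1"
  shows "((\<lambda>t. cos (real n * t) * (sin t)\<^sup>2) has_integral (if n = 2 then - pi / 4 else 0)) {0..pi}"
proof -
  have trig: "cos (real n * t) / 2 - cos ((real n + 2) * t) / 4 - cos ((real n - 2) * t) / 4
      = cos (real n * t) * (sin t)\<^sup>2" for t
  proof -
    have "cos ((real n + 2) * t) + cos ((real n - 2) * t) = 2 * cos (real n * t) * cos (2 * t)"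
      by (simp add: distrib_right left_diff_distrib cos_add cos_diff)
    then have "cos ((real n + 2) * t) / 4 + cos ((real n - 2) * t) / 4 = cos (real n * t) * (1 - 2 * (sin t)\<^sup>2) / 2"
      by (simp add: cos_double_sin)
    then show ?thesis by (simp add: algebra_simps)
  qed
  show ?thesis
  proof (cases "n = 2")
    case True
    let ?A = "\<lambda>t. sin (2 * t) / 4 - sin (4 * t) / 16 - t / 4"
    have "((\<lambda>t. cos (real n * t) * (sin t)\<^sup>2) has_integral (?A pi - ?A 0)) {0..pi}"
    proof (rule fundamental_theorem_of_calculus)
      fix t :: real
      have "(?A has_real_derivative cos (2 * t) / 2 - cos (4 * t) / 4 - 1 / 4) (at t within {0..pi})"
        by (auto intro!: derivative_eq_intros)
      then show "(?A has_vector_derivative cos (real n * t) * (sin t)\<^sup>2) (at t within {0..pi})"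
        using trig[of t] by (simp add: True has_real_derivative_iff_has_vector_derivative)
    qed simp
    moreover have "sin (4 * pi) = 0" using sin_npi[of 4] by simp
    ultimately show ?thesis using True by simp
  next
    case False
    let ?A = "\<lambda>t. sin (real n * t) / (2 * real n) - sin ((real n + 2) * t) / (4 * (real n + 2))
      - sin ((real n - 2) * t) / (4 * (real n - 2))"
    have n2: "real n - 2 \<noteq> 0" "real n \<noteq> 0" "real n + 2 \<noteq> 0" using False n by auto
    have "((\<lambda>t. cos (real n * t) * (sin t)\<^sup>2) has_integral (?A pi - ?A 0)) {0..pi}"
    proof (rule fundamental_theorem_of_calculus)
      fix t :: real
      have "(?A has_real_derivative cos (real n * t) / 2 - cos ((real n + 2) * t) / 4 - cos ((real n - 2) * t) / 4) (at t within {0..pi})"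
      proof -
        have D: "((\<lambda>t. sin (m * t) / (k * m)) has_real_derivative cos (m * t) / k) (at t within {0..pi})"
          if "m \<noteq> 0" "k \<noteq> 0" for m k :: real
          using that by (auto intro!: derivative_eq_intros simp: field_simps)
        show ?thesis by (rule DERIV_diff[OF DERIV_diff[OF D D] D]) (use n2 in auto)
      qed
      then show "(?A has_vector_derivative cos (real n * t) * (sin t)\<^sup>2) (at t within {0..pi})"
        by (simp add: trig has_real_derivative_iff_has_vector_derivative)
    qed simp
    moreover have "sin (real n * pi) = 0" "sin ((real n + 2) * pi) = 0" "sin ((real n - 2) * pi) = 0"
      using sin_npi[of n] sin_npi[of "n + 2"] sin_npi_int[of "int n - 2"] by (simp_all add: mult.commute add.commute)
    ultimately show ?thesis using False by simp
  qed
qed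

lemma has_integral_sin_sq: "((\<lambda>t. (sin t)\<^sup>2) has_integral pi / 2) {0..pi}"
proof -
  let ?A = "\<lambda>t. t / 2 - sin (2 * t) / 4"
  have "((\<lambda>t. (sin t)\<^sup>2) has_integral (?A pi - ?A 0)) {0..pi}"
  proof (rule fundamental_theorem_of_calculus)
    fix t :: real
    have "(?A has_real_derivative 1 / 2 - cos (2 * t) / 2) (at t within {0..pi})"
      by (auto intro!: derivative_eq_intros)
    then show "(?A has_vector_derivative (sin t)\<^sup>2) (at t within {0..pi})"
      by (simp add: cos_double_sin has_real_derivative_iff_has_vector_derivative diff_divide_distrib)
  qed simp
  then show ?thesis by simp
qed

text \<open>With \<open>z = a * cis t\<close> the left-hand series is twice the real part of the
  power series of \<open>ln (1 + z)\<close>, and the limit is the logarithm of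
  \<open>(cmod (1 + z))\<^sup>2\<close>. The term \<open>n = 0\<close> is 0 by division by
  zero.\<close>

lemma ln_circle_sums:
  fixes a t :: real
  assumes a: "0 \<le> a" "a < 1"
  shows "(\<lambda>n. - (2 * (- a) ^ n / real n) * cos (real n * t)) sums ln (1 + a\<^sup>2 + 2 * a * cos t)"
proof -
  define z where "z = complex_of_real a * cis t"
  have z: "cmod z < 1" using a by (simp add: z_def norm_mult)
  have pos: "1 + z \<noteq> 0"
  proof
    assume "1 + z = 0"
    then have "z = - 1" by (simp add: add_eq_0_iff)
    then show False using z by simp
  qed
  have "(\<lambda>n. Re (- ((- z) ^ n) / of_nat n)) sums Re (ln (1 + z))" (is ?sums)
    by (rule sums_Re[OF Ln_series'[OF z]])
  moreover have Re: "Re (- ((- z) ^ n) / of_nat n) = - ((- a) ^ n / real n) * cos (real n * t)" for n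
  proof -
    have "- z = complex_of_real (- a) * cis t" by (simp add: z_def)
    then have "(- z) ^ n = complex_of_real ((- a) ^ n) * cis (real n * t)"
      by (simp only: power_mult_distrib Complex.DeMoivre of_real_power)
    then show ?thesis by (simp add: Re_divide_of_nat)
  qed
  moreover have Re_Ln: "Re (ln (1 + z)) = ln (cmod (1 + z))" using pos by simp
  ultimately have "(\<lambda>n. - ((- a) ^ n / real n) * cos (real n * t)) sums ln (cmod (1 + z))"
    by (simp only: Re Re_Ln)
  from sums_mult[OF this, of 2]
  have "(\<lambda>n. - (2 * (- a) ^ n / real n) * cos (real n * t)) sums (2 * ln (cmod (1 + z)))"
    by (simp add: mult.assoc)
  also have "2 * ln (cmod (1 + z)) = ln ((cmod (1 + z))\<^sup>2)"
    using pos by (simp add: ln_realpow)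
  also have "(cmod (1 + z))\<^sup>2 = (1 + a * cos t)\<^sup>2 + (a * sin t)\<^sup>2"
    by (simp add: cmod_power2 z_def)
  also have "\<dots> = 1 + 2 * a * cos t + a\<^sup>2 * ((sin t)\<^sup>2 + (cos t)\<^sup>2)"
    by (simp only: power2_sum power_mult_distrib distrib_left) simp
  also have "\<dots> = 1 + a\<^sup>2 + 2 * a * cos t"
    unfolding sin_cos_squared_add by simp
  finally show ?thesis .
qed

text \<open>The series converges uniformly, with majorant \<open>2 * a ^ n\<close>, and can be
  integrated termwise. Only \<open>n = 2\<close> contributes, with coefficient
  \<open>- a\<^sup>2\<close>.\<close>

lemma has_integral_ln_circle_sin_sq:
  fixes a :: real
  assumes a: "0 \<le> a" "a < 1"
  shows "((\<lambda>t. ln (1 + a\<^sup>2 + 2 * a * cos t) * (sin t)\<^sup>2) has_integral pi * a\<^sup>2 / 4) {0..pi}"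
proof -
  define k where "k n = - (2 * (- a) ^ n / real n)" for n
  let ?f = "\<lambda>n t. k n * (cos (real n * t) * (sin t)\<^sup>2)"
  have sums: "(\<lambda>n. ?f n t) sums (ln (1 + a\<^sup>2 + 2 * a * cos t) * (sin t)\<^sup>2)" for t
    using sums_mult2[OF ln_circle_sums[OF a], of t "(sin t)\<^sup>2"] by (simp add: k_def mult.assoc)
  have "uniform_limit {0..pi} (\<lambda>n t. \<Sum>i<n. ?f i t) (\<lambda>t. suminf (\<lambda>i. ?f i t)) sequentially"
  proof (rule Weierstrass_m_test)
    show "summable (\<lambda>n. 2 * a ^ n)" using a by (intro summable_mult summable_geometric) auto
    fix n t
    have "\<bar>k n\<bar> \<le> 2 * a ^ n"
    proof (cases "n = 0")
      case False
      then have "\<bar>k n\<bar> = 2 * a ^ n / real n" using a by (simp add: k_def abs_mult power_abs)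
      also have "\<dots> \<le> 2 * a ^ n / 1" using False a by (intro divide_left_mono) auto
      finally show ?thesis by simp
    qed (simp add: k_def)
    moreover have "\<bar>cos (real n * t) * (sin t)\<^sup>2\<bar> \<le> 1"
      by (simp add: abs_mult mult_le_one abs_square_le_1)
    ultimately have "\<bar>k n\<bar> * \<bar>cos (real n * t) * (sin t)\<^sup>2\<bar> \<le> (2 * a ^ n) * 1"
      using a by (intro mult_mono) auto
    then show "norm (?f n t) \<le> 2 * a ^ n" by (simp add: abs_mult)
  qed
  then have "uniform_limit {0..pi} (\<lambda>n t. \<Sum>i<n. ?f i t) (\<lambda>t. ln (1 + a\<^sup>2 + 2 * a * cos t) * (sin t)\<^sup>2) sequentially"
    using sums by (simp add: sums_iff)
  then obtain I L where I: "\<And>n. ((\<lambda>t. \<Sum>i<n. ?f i t) has_integral I n) {0..pi}"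
    and L: "((\<lambda>t. ln (1 + a\<^sup>2 + 2 * a * cos t) * (sin t)\<^sup>2) has_integral L) {0..pi}" and lim: "I \<longlonglongrightarrow> L"
    by (rule uniform_limit_integral) (auto intro!: continuous_intros)
  have fi: "(?f i has_integral (if i = 2 then pi * a\<^sup>2 / 4 else 0)) {0..pi}" for i
  proof (cases "i = 0")
    case False
    then show ?thesis
      using has_integral_mult_right[OF has_integral_cos_mult_sin_sq[of i], of "k i"]
      by (auto simp: k_def power2_eq_square split: if_splits)
  qed (simp add: k_def)
  have "I n = pi * a\<^sup>2 / 4" if "n \<ge> 3" for n
  proof -
    have "I n = (\<Sum>i<n. if i = 2 then pi * a\<^sup>2 / 4 else 0)"
      by (rule has_integral_unique[OF I]) (intro has_integral_sum fi finite_lessThan)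
    then show ?thesis using that by simp
  qed
  then have "I \<longlonglongrightarrow> pi * a\<^sup>2 / 4"
    by (intro tendsto_eventually) (auto simp: eventually_sequentially)
  with lim have "L = pi * a\<^sup>2 / 4" by (rule LIMSEQ_unique)
  with L show ?thesis by simp
qed

text \<open>The mean of \<open>ln (|y| / |x - y|)\<close> over the sphere \<open>|y| = s\<close> in dimension 4, where \<open>|x| = r\<close>.\<close>

definition log_kernel :: "real \<Rightarrow> real \<Rightarrow> real" where
  "log_kernel r s = (if s < r then ln s - ln r - s\<^sup>2 / (4 * r\<^sup>2) else - r\<^sup>2 / (4 * s\<^sup>2))"

text \<open>The substitution \<open>c = - s * cos t\<close> turns the weight into
  \<open>s\<^sup>2 * (sin t)\<^sup>2\<close>. Factoring out the larger of \<open>r\<close> and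
  \<open>s\<close> leaves the ratio \<open>a < 1\<close> in the logarithm. The factor
  \<open>pi * s\<^sup>2 / 2\<close> is the total weight of the slice.\<close>

lemma has_integral_log_slice:
  fixes r s :: real
  assumes r: "r > 0" and s: "s > 0" and rs: "r \<noteq> s"
  defines "f \<equiv> \<lambda>c. ln (s / sqrt (r\<^sup>2 + s\<^sup>2 - 2 * r * c)) * sqrt (s\<^sup>2 - c\<^sup>2)"
  shows "continuous_on {- s..s} f" "integral {- s..s} f = pi * s\<^sup>2 / 2 * log_kernel r s"
proof -
  have pos: "r\<^sup>2 + s\<^sup>2 - 2 * r * c > 0" if "c \<le> s" for c
  proof -
    have "0 < (r - s)\<^sup>2" using rs by simp
    also have "\<dots> = r\<^sup>2 + s\<^sup>2 - 2 * r * s" by (simp add: power2_diff)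
    also have "\<dots> \<le> r\<^sup>2 + s\<^sup>2 - 2 * r * c" using that r by simp
    finally show ?thesis .
  qed
  show cont: "continuous_on {- s..s} f"
    unfolding f_def using pos s by (intro continuous_intros) (auto simp: less_imp_neq[symmetric] dest: pos)
  have sub: "((\<lambda>t. (s * sin t) *\<^sub>R f (- s * cos t)) has_integral integral {- s * cos 0..- s * cos pi} f) {0..pi}"
  proof (rule has_integral_substitution[where c = "- s" and d = s and g = "\<lambda>t. - s * cos t"])
    show "(\<lambda>t. - s * cos t) ` {0..pi} \<subseteq> {- s..s}"
      using s by (auto simp: mult_le_cancel_left1 mult_le_cancel_left2 abs_le_iff intro: order_trans[OF _ cos_ge_minus_one])
         (metis cos_ge_minus_one minus_mult_commute mult.right_neutral mult_le_cancel_left_pos minus_le_iff mult_minus_right)+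
    show "((\<lambda>t. - s * cos t) has_real_derivative s * sin t) (at t within {0..pi})" for t
      by (auto intro!: derivative_eq_intros)
  qed (use s cont in auto)
  define m a where "m = max r s" and "a = min r s / m"
  have m: "m > 0" and a: "0 \<le> a" "a < 1" using r s rs by (auto simp: m_def a_def max_def min_def)
  have eq: "(s * sin t) *\<^sub>R f (- s * cos t) =
      s\<^sup>2 * (ln s - ln m) * (sin t)\<^sup>2 - s\<^sup>2 / 2 * (ln (1 + a\<^sup>2 + 2 * a * cos t) * (sin t)\<^sup>2)" if t: "t \<in> {0..pi}" for t
  proof -
    have sn: "sin t \<ge> 0" using t by (auto intro: sin_ge_zero)
    have "s\<^sup>2 - (- s * cos t)\<^sup>2 = s\<^sup>2 * (1 - (cos t)\<^sup>2)" by (simp add: power_mult_distrib algebra_simps)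
    also have "\<dots> = (s * sin t)\<^sup>2" by (simp add: sin_squared_eq power_mult_distrib)
    finally have 1: "sqrt (s\<^sup>2 - (- s * cos t)\<^sup>2) = s * sin t" using s sn by simp
    have "- s * cos t \<le> s" using s cos_ge_minus_one[of t] by (metis minus_mult_commute mult.right_neutral mult_le_cancel_left_pos minus_le_iff mult_minus_right)
    then have p: "r\<^sup>2 + s\<^sup>2 - 2 * r * (- s * cos t) > 0" by (rule pos)
    have 2: "r\<^sup>2 + s\<^sup>2 - 2 * r * (- s * cos t) = m\<^sup>2 * (1 + a\<^sup>2 + 2 * a * cos t)"
      using r s by (auto simp: m_def a_def max_def min_def field_simps power2_eq_square)
    then have 3: "1 + a\<^sup>2 + 2 * a * cos t > 0" using p m by (metis zero_less_mult_pos zero_less_power)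
    have "ln (s / sqrt (r\<^sup>2 + s\<^sup>2 - 2 * r * (- s * cos t))) = ln s - ln m - ln (1 + a\<^sup>2 + 2 * a * cos t) / 2"
      unfolding 2 using s m 3 by (simp add: ln_div ln_mult ln_sqrt real_sqrt_mult)
    then show ?thesis unfolding f_def 1
      by (simp only:) (simp add: algebra_simps power2_eq_square)
  qed
  have "((\<lambda>t. s\<^sup>2 * (ln s - ln m) * (sin t)\<^sup>2 - s\<^sup>2 / 2 * (ln (1 + a\<^sup>2 + 2 * a * cos t) * (sin t)\<^sup>2)) has_integral
      s\<^sup>2 * (ln s - ln m) * (pi / 2) - s\<^sup>2 / 2 * (pi * a\<^sup>2 / 4)) {0..pi}"
    by (intro has_integral_diff has_integral_mult_right has_integral_sin_sq has_integral_ln_circle_sin_sq a)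
  then have "((\<lambda>t. (s * sin t) *\<^sub>R f (- s * cos t)) has_integral
      s\<^sup>2 * (ln s - ln m) * (pi / 2) - s\<^sup>2 / 2 * (pi * a\<^sup>2 / 4)) {0..pi}"
    by (rule has_integral_eq[rotated]) (use eq in simp)
  from has_integral_unique[OF sub this]
  have "integral {- s..s} f = s\<^sup>2 * (ln s - ln m) * (pi / 2) - s\<^sup>2 / 2 * (pi * a\<^sup>2 / 4)" by simp
  also have "\<dots> = pi * s\<^sup>2 / 2 * log_kernel r s"
    using r s rs by (auto simp: log_kernel_def m_def a_def max_def min_def field_simps)
  finally show "integral {- s..s} f = pi * s\<^sup>2 / 2 * log_kernel r s" .
qed

section \<open>The logarithmic potential of a radial density\<close>

lemma log_kernel_measurable [measurable]: "log_kernel r \<in> borel_measurable borel"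
  unfolding log_kernel_def[abs_def] by measurable

lemma norm_diff_eq_sqrt:
  fixes x y :: "'a::real_inner"
  shows "norm (x - y) = sqrt ((norm x)\<^sup>2 + (norm y)\<^sup>2 - 2 * (x \<bullet> y))"
  by (simp add: norm_eq_sqrt_inner inner_diff_left inner_diff_right inner_commute)

lemma log_slice_lebesgue:
  fixes r s :: real
  assumes r: "r > 0" and rs: "r \<noteq> s"
  shows "(LINT c|lborel. indicator {\<bar>c\<bar><..} s * (4 * pi * (s * sqrt (s\<^sup>2 - c\<^sup>2))) * (ln (s / sqrt (r\<^sup>2 + s\<^sup>2 - 2 * r * c)) * b))
     = indicator {0<..} s * (2 * pi\<^sup>2 * (s ^ 3 * log_kernel r s * b))"
proof (cases "s > 0")
  case False
  then have "indicator {\<bar>c\<bar><..} s = (0 :: real)" for c by (auto simp: indicator_def)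
  then show ?thesis using False by simp
next
  case True
  let ?f = "\<lambda>c. ln (s / sqrt (r\<^sup>2 + s\<^sup>2 - 2 * r * c)) * sqrt (s\<^sup>2 - c\<^sup>2)"
  note f = has_integral_log_slice[OF r True rs]
  have "indicator {\<bar>c\<bar><..} s * (4 * pi * (s * sqrt (s\<^sup>2 - c\<^sup>2))) * (ln (s / sqrt (r\<^sup>2 + s\<^sup>2 - 2 * r * c)) * b)
      = (4 * pi * s * b) * (indicator {- s..s} c *\<^sub>R ?f c)" for c
  proof (cases "\<bar>c\<bar> = s")
    case True
    then have "s\<^sup>2 - c\<^sup>2 = 0" by (metis diff_self power2_abs)
    then show ?thesis by simp
  next
    case False
    then show ?thesis by (auto simp: indicator_def abs_less_iff abs_le_iff)
  qed
  then have "(LINT c|lborel. indicator {\<bar>c\<bar><..} s * (4 * pi * (s * sqrt (s\<^sup>2 - c\<^sup>2))) * (ln (s / sqrt (r\<^sup>2 + s\<^sup>2 - 2 * r * c)) * b))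
      = (4 * pi * s * b) * (LINT c:{- s..s}|lborel. ?f c)"
    by (simp only: set_lebesgue_integral_def Bochner_Integration.integral_mult_right_zero)
  also have "(LINT c:{- s..s}|lborel. ?f c) = pi * s\<^sup>2 / 2 * log_kernel r s"
    using set_borel_integral_eq_integral(2)[OF borel_integrable_atLeastAtMost'[OF f(1)]] f(2) by simp
  finally show ?thesis using True by (simp add: power2_eq_square power3_eq_cube)
qed

text \<open>The integrand depends on \<open>y\<close> only through its norm and its inner product
  with the direction of \<open>x\<close>, so the joint law and Fubini reduce it to slices of fixed
  norm.\<close>

lemma log_average:
  fixes x :: "real ^ 4" and g :: "real \<Rightarrow> real"
  assumes x: "x \<noteq> 0" and [measurable]: "g \<in> borel_measurable borel"
    and int: "integrable lborel (\<lambda>y. ln (norm y / norm (x - y)) * g (norm y))"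
  shows "integrable lborel (\<lambda>s. indicator {0<..} s * (2 * pi\<^sup>2 * (s ^ 3 * log_kernel (norm x) s * g s)))"
    and "(LINT y|lborel. ln (norm y / norm (x - y)) * g (norm y)) =
      (LINT s|lborel. indicator {0<..} s * (2 * pi\<^sup>2 * (s ^ 3 * log_kernel (norm x) s * g s)))"
proof -
  define r where "r = norm x"
  define e where "e = x /\<^sub>R r"
  have r: "r > 0" using x by (simp add: r_def)
  have e: "norm e = 1" using r by (simp add: e_def r_def)
  define H where "H = (\<lambda>(s, c). ln (s / sqrt (r\<^sup>2 + s\<^sup>2 - 2 * r * c)) * g s)"
  define W where "W = (\<lambda>(s, c). indicator {\<bar>c\<bar><..} s * (4 * pi * (s * sqrt (s\<^sup>2 - c\<^sup>2))))" for s c :: real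
  have [measurable]: "H \<in> borel_measurable borel"
    unfolding H_def by (subst borel_prod[symmetric]) measurable
  have [measurable]: "W \<in> borel_measurable borel"
  proof -
    have "W = (\<lambda>x. if \<bar>snd x\<bar> < fst x then 4 * pi * (fst x * sqrt ((fst x)\<^sup>2 - (snd x)\<^sup>2)) else 0)"
      by (auto simp: W_def indicator_def fun_eq_iff)
    also have "\<dots> \<in> borel_measurable borel"
      by (intro measurable_If borel_measurable_continuous_onI continuous_intros)
         (auto intro!: borel_open open_Collect_less continuous_intros)
    finally show ?thesis .
  qed
  have W0: "W z \<ge> 0" for z
    by (auto simp: W_def indicator_def abs_le_square_iff[symmetric] intro!: mult_nonneg_nonneg split: prod.splits)
  have H: "ln (norm y / norm (x - y)) * g (norm y) = H (norm y, y \<bullet> e)" for y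
  proof -
    have "r * (y \<bullet> e) = x \<bullet> y" using r by (simp add: e_def inner_commute)
    then show ?thesis by (simp add: H_def norm_diff_eq_sqrt r_def mult.assoc)
  qed
  have law: "distr lborel borel (\<lambda>y. (norm y, y \<bullet> e)) = density lborel (\<lambda>z. ennreal (W z))"
    unfolding distr_norm_inner[OF e] W_def by (auto intro!: arg_cong[where f = "density lborel"] simp: fun_eq_iff)
  have "integrable (distr lborel borel (\<lambda>y. (norm y, y \<bullet> e))) H"
    using int unfolding H by (subst integrable_distr_eq) auto
  then have I: "integrable (lborel \<Otimes>\<^sub>M lborel) (\<lambda>z. W z * H z)"
    unfolding law by (subst (asm) integrable_density) (auto simp: W0 lborel_prod)
  have slice: "AE s in lborel. (LINT c|lborel. W (s, c) * H (s, c)) = indicator {0<..} s * (2 * pi\<^sup>2 * (s ^ 3 * log_kernel r s * g s))"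
    using AE_lborel_singleton[of r]
  proof eventually_elim
    case (elim s)
    then show ?case using log_slice_lebesgue[OF r, of s "g s"] by (simp add: W_def H_def)
  qed
  have "integrable lborel (\<lambda>s. LINT c|lborel. W (s, c) * H (s, c))"
    by (rule lborel_pair.integrable_fst'[OF I])
  then show "integrable lborel (\<lambda>s. indicator {0<..} s * (2 * pi\<^sup>2 * (s ^ 3 * log_kernel (norm x) s * g s)))"
    unfolding r_def[symmetric] by (rule integrable_cong_AE_imp) (use slice in auto)
  have "(LINT y|lborel. ln (norm y / norm (x - y)) * g (norm y)) = (LINT z|distr lborel borel (\<lambda>y. (norm y, y \<bullet> e)). H z)"
    unfolding H by (subst integral_distr) auto
  also have "\<dots> = (LINT z|(lborel \<Otimes>\<^sub>M lborel). W z * H z)"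
    unfolding law by (subst integral_density) (auto simp: W0 lborel_prod)
  also have "\<dots> = (LINT s|lborel. LINT c|lborel. W (s, c) * H (s, c))"
    by (rule lborel_pair.integral_fst'[OF I, symmetric])
  also have "\<dots> = (LINT s|lborel. indicator {0<..} s * (2 * pi\<^sup>2 * (s ^ 3 * log_kernel r s * g s)))"
  proof (rule integral_cong_AE[OF _ _ slice])
    show "(\<lambda>s. LINT c|lborel. W (s, c) * H (s, c)) \<in> borel_measurable lborel"
      by (rule borel_measurable_integrable[OF lborel_pair.integrable_fst'[OF I]])
  qed measurable
  finally show "(LINT y|lborel. ln (norm y / norm (x - y)) * g (norm y)) =
      (LINT s|lborel. indicator {0<..} s * (2 * pi\<^sup>2 * (s ^ 3 * log_kernel (norm x) s * g s)))"
    by (simp add: r_def)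
qed

lemma radial_integral:
  fixes f :: "real \<Rightarrow> real"
  assumes [measurable]: "f \<in> borel_measurable borel"
  shows "integrable lborel (\<lambda>y :: real ^ 4. f (norm y)) \<longleftrightarrow> integrable lborel (\<lambda>s. indicator {0<..} s * (2 * pi\<^sup>2 * (s ^ 3 * f s)))"
    and "(LINT y|lborel. f (norm (y :: real ^ 4))) = (LINT s|lborel. indicator {0<..} s * (2 * pi\<^sup>2 * (s ^ 3 * f s)))"
proof -
  let ?w = "\<lambda>s::real. indicator {0<..} s * (2 * pi\<^sup>2 * s ^ 3) :: real"
  have law: "distr (lborel :: (real ^ 4) measure) borel norm = density lborel (\<lambda>s. ennreal (?w s))"
    unfolding distr_norm_lborel by (simp add: unit_ball_vol_4 mult_ac)
  have w: "?w s \<ge> 0" for s by (simp add: indicator_def)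
  have "integrable lborel (\<lambda>y :: real ^ 4. f (norm y)) \<longleftrightarrow> integrable (distr (lborel :: (real ^ 4) measure) borel norm) f"
    by (subst integrable_distr_eq) auto
  also have "\<dots> \<longleftrightarrow> integrable lborel (\<lambda>s. ?w s *\<^sub>R f s)"
    unfolding law by (subst integrable_density) (auto simp: w)
  finally show "integrable lborel (\<lambda>y :: real ^ 4. f (norm y)) \<longleftrightarrow> integrable lborel (\<lambda>s. indicator {0<..} s * (2 * pi\<^sup>2 * (s ^ 3 * f s)))"
    by (simp add: mult.assoc)
  have "(LINT y|lborel. f (norm (y :: real ^ 4))) = (LINT s|distr (lborel :: (real ^ 4) measure) borel norm. f s)"
    by (subst integral_distr) auto
  also have "\<dots> = (LINT s|lborel. ?w s *\<^sub>R f s)"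
    unfolding law by (subst integral_density) (auto simp: w)
  finally show "(LINT y|lborel. f (norm (y :: real ^ 4))) = (LINT s|lborel. indicator {0<..} s * (2 * pi\<^sup>2 * (s ^ 3 * f s)))"
    by (simp add: mult.assoc)
qed

lemma integrable_local_ln_norm:
  "integrable lborel (\<lambda>y :: real ^ 4. indicator {..R} (norm y) * \<bar>ln (norm y)\<bar>)"
proof -
  have "continuous_on {0..R} (\<lambda>s::real. 2 * pi\<^sup>2 * \<bar>s ^ 3 * ln s\<bar>)"
    by (intro continuous_intros continuous_on_subset[OF continuous_on_cube_ln]) auto
  then have "integrable lborel (\<lambda>s. indicator {0..R} s *\<^sub>R (2 * pi\<^sup>2 * \<bar>s ^ 3 * ln s\<bar>))"
    using borel_integrable_atLeastAtMost' unfolding set_integrable_def by blast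
  also have "(\<lambda>s. indicator {0..R} s *\<^sub>R (2 * pi\<^sup>2 * \<bar>s ^ 3 * ln s\<bar>)) =
      (\<lambda>s. indicator {0<..} s * (2 * pi\<^sup>2 * (s ^ 3 * (indicator {..R} s * \<bar>ln s\<bar>))))"
    by (auto simp: fun_eq_iff indicator_def abs_mult)
  finally show ?thesis
    using radial_integral(1)[of "\<lambda>s. indicator {..R} s * \<bar>ln s\<bar>"] by simp
qed

text \<open>For \<open>norm y \<le> 2 * norm x\<close> the density is bounded and the two
  logarithmic singularities are integrable in dimension 4. Farther out the quotient lies between
  \<open>1 / 2\<close> and 2, so the logarithm is bounded by \<open>ln 2\<close>.\<close>

lemma integrable_log_quotient:
  fixes x :: "real ^ 4" and g :: "real \<Rightarrow> real"
  assumes g: "continuous_on {0..} g" "\<And>s. s \<ge> 0 \<Longrightarrow> g s \<ge> 0" and gm [measurable]: "g \<in> borel_measurable borel"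
    and int: "integrable lborel (\<lambda>y :: real ^ 4. g (norm y))"
  shows "integrable lborel (\<lambda>y. ln (norm y / norm (x - y)) * g (norm y))"
proof -
  define R where "R = 2 * norm x"
  have "compact (g ` {0..R})" by (intro compact_continuous_image continuous_on_subset[OF g(1)]) auto
  then obtain M where M: "\<And>s. s \<in> {0..R} \<Longrightarrow> \<bar>g s\<bar> \<le> M"
    by (meson bounded_real compact_imp_bounded imageI)
  then have M0: "M \<ge> 0" using M[of 0] by (force simp: R_def)
  have tr: "integrable lborel (\<lambda>y :: real ^ 4. indicator {..R + norm x} (norm (x - y)) * \<bar>ln (norm (x - y))\<bar>)"
  proof -
    let ?F = "\<lambda>y :: real ^ 4. indicator {..R + norm x} (norm y) * \<bar>ln (norm y)\<bar>"
    have 1: "integrable (distr lborel borel (\<lambda>y. - x + y)) ?F"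
      unfolding lborel_distr_plus by (rule integrable_local_ln_norm)
    then have "integrable lborel (\<lambda>y. ?F (- x + y))"
      by (subst (asm) integrable_distr_eq) auto
    moreover have "norm (- x + y) = norm (x - y)" for y :: "real ^ 4" by (simp add: norm_minus_commute)
    ultimately show ?thesis by simp
  qed
  let ?B = "\<lambda>y. M * (indicator {..R} (norm y) * \<bar>ln (norm y)\<bar>)
      + M * (indicator {..R + norm x} (norm (x - y)) * \<bar>ln (norm (x - y))\<bar>) + ln 2 * g (norm y)"
  have "integrable lborel ?B"
    by (intro Bochner_Integration.integrable_add integrable_mult_right integrable_local_ln_norm tr int)
  then show ?thesis
  proof (rule Bochner_Integration.integrable_bound)
    show "(\<lambda>y. ln (norm y / norm (x - y)) * g (norm y)) \<in> borel_measurable lborel" by measurable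
    show "AE y in lborel. norm (ln (norm y / norm (x - y)) * g (norm y)) \<le> norm (?B y)"
    proof (intro always_eventually allI)
      fix y :: "real ^ 4"
      have gy: "g (norm y) \<ge> 0" by (rule g) simp
      have nn: "0 \<le> M * (indicator {..R} (norm y) * \<bar>ln (norm y)\<bar>)"
        "0 \<le> M * (indicator {..R + norm x} (norm (x - y)) * \<bar>ln (norm (x - y))\<bar>)" "0 \<le> ln 2 * g (norm y)"
        using M0 gy by auto
      have "\<bar>ln (norm y / norm (x - y))\<bar> * g (norm y) \<le> ?B y"
      \<comment> \<open>At these two points the quotient is 0 and \<open>ln 0 = 0\<close>.\<close>
      proof (cases "y = 0 \<or> x = y")
        case True
        then show ?thesis using nn by auto
      next
        case False
        then have p: "norm y > 0" "norm (x - y) > 0" by auto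
        show ?thesis
        proof (cases "norm y \<le> R")
          case True
          have "norm (x - y) \<le> norm x + R" using norm_triangle_ineq4[of x y] True by simp
          then have i: "indicator {..R} (norm y) = (1::real)" "indicator {..R + norm x} (norm (x - y)) = (1::real)"
            using True by auto
          have "g (norm y) \<le> M" using M[of "norm y"] True by auto
          moreover have "\<bar>ln (norm y / norm (x - y))\<bar> \<le> \<bar>ln (norm y)\<bar> + \<bar>ln (norm (x - y))\<bar>"
            using p by (simp add: ln_div)
          ultimately have "\<bar>ln (norm y / norm (x - y))\<bar> * g (norm y) \<le> (\<bar>ln (norm y)\<bar> + \<bar>ln (norm (x - y))\<bar>) * M"
            using gy by (intro mult_mono) auto
          also have "\<dots> = M * \<bar>ln (norm y)\<bar> + M * \<bar>ln (norm (x - y))\<bar>" by (simp add: algebra_simps)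
          finally show ?thesis using nn(3) unfolding i by simp
        next
          case far: False
          have a: "norm (x - y) \<le> norm x + norm y" by (rule norm_triangle_ineq4)
          have b: "norm y \<le> norm x + norm (x - y)" using norm_triangle_ineq4[of x "x - y"] by simp
          have "norm y / norm (x - y) \<le> 2" "1 / 2 \<le> norm y / norm (x - y)"
            using far p a b by (auto simp: R_def field_simps)
          then have "ln (norm y / norm (x - y)) \<le> ln 2" "ln (1 / 2) \<le> ln (norm y / norm (x - y))"
            using p by (auto intro!: ln_mono divide_pos_pos simp del: ln_divide_pos)
          then have "\<bar>ln (norm y / norm (x - y))\<bar> \<le> ln 2" by (simp add: ln_div abs_le_iff)
          then have "\<bar>ln (norm y / norm (x - y))\<bar> * g (norm y) \<le> ln 2 * g (norm y)"
            using gy by (intro mult_right_mono) auto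
          then show ?thesis using nn by linarith
        qed
      qed
      then show "norm (ln (norm y / norm (x - y)) * g (norm y)) \<le> norm (?B y)"
        using gy nn by (simp add: abs_mult)
    qed
  qed
qed

section \<open>From the radial equation to four dimensions\<close>

text \<open>Truncating at \<open>R \<ge> r\<close> gives the potential with \<open>mom 1 h R\<close>
  in place of \<open>c\<close>, the outer branch of the kernel producing
  \<open>mom 1 h R - mom 1 h r\<close>. Then \<open>R\<close> tends to infinity.\<close>

lemma log_kernel_integral:
  assumes h: "continuous_on {0..} h"
    and c: "(mom 1 h \<longlongrightarrow> c) at_top" and r: "r > 0"
    and int: "integrable lborel (\<lambda>s. indicator {0<..} s * (s ^ 3 * log_kernel r s * h s))"
  shows "(LINT s|lborel. indicator {0<..} s * (s ^ 3 * log_kernel r s * h s)) = 4 * pot c h r"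
proof -
  let ?f = "\<lambda>s. s ^ 3 * log_kernel r s * h s"
  let ?F = "\<lambda>s. indicator {0<..} s * ?f s"
  have trunc: "(LINT s|lborel. indicator {..R} s *\<^sub>R ?F s) = 4 * pot (mom 1 h R) h r" if R: "R \<ge> r" for R
  proof -
    note mi = mom_integrand_integrable[OF h, of 0, simplified]
    have li: "(\<lambda>s. s ^ 3 * ln s * h s) integrable_on {0..r}"
      by (rule integrable_on_cont_half_line[OF continuous_on_lmom_integrand[OF h]])
    have "((\<lambda>s. s ^ 3 * ln s * h s - ln r * (s ^ 3 * h s) - 1 / (4 * r\<^sup>2) * (s ^ 5 * h s)) has_integral
        lmom h r - ln r * mom 3 h r - 1 / (4 * r\<^sup>2) * mom 5 h r) {0..r}"
      unfolding lmom_def mom_def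
      by (intro has_integral_diff has_integral_mult_right integrable_integral mi li)
    then have 1: "(?f has_integral lmom h r - ln r * mom 3 h r - 1 / (4 * r\<^sup>2) * mom 5 h r) {0..r}"
    proof (rule has_integral_eq[rotated])
      fix s assume s: "s \<in> {0..r}"
      \<comment> \<open>The two branches agree at \<open>s = r\<close>, with value
        \<open>- 1 / 4\<close>.\<close>
      have "log_kernel r s = ln s - ln r - s\<^sup>2 / (4 * r\<^sup>2)"
        using s r by (cases "s = r") (auto simp: log_kernel_def)
      then show "s ^ 3 * ln s * h s - ln r * (s ^ 3 * h s) - 1 / (4 * r\<^sup>2) * (s ^ 5 * h s) = ?f s"
        using r by (simp only:) (simp add: field_simps eval_nat_numeral)
    qed
    have "((\<lambda>s. - (r\<^sup>2 / 4) * (s ^ 1 * h s)) has_integral - (r\<^sup>2 / 4) * (mom 1 h R - mom 1 h r)) {r..R}"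
      unfolding mom_diff[OF h less_imp_le[OF r] R]
      by (intro has_integral_mult_right integrable_integral mom_integrand_integrable[OF h]) (use r in simp)
    then have 2: "(?f has_integral - (r\<^sup>2 / 4) * (mom 1 h R - mom 1 h r)) {r..R}"
    proof (rule has_integral_eq[rotated])
      fix s assume s: "s \<in> {r..R}"
      then show "- (r\<^sup>2 / 4) * (s ^ 1 * h s) = ?f s"
        using r by (simp add: log_kernel_def field_simps power2_eq_square power3_eq_cube)
    qed
    have "(?f has_integral (lmom h r - ln r * mom 3 h r - 1 / (4 * r\<^sup>2) * mom 5 h r) + (- (r\<^sup>2 / 4) * (mom 1 h R - mom 1 h r))) {0..R}"
      by (rule has_integral_combine[OF _ R 1 2]) (use r in simp)
    also have "(lmom h r - ln r * mom 3 h r - 1 / (4 * r\<^sup>2) * mom 5 h r) + (- (r\<^sup>2 / 4) * (mom 1 h R - mom 1 h r)) = 4 * pot (mom 1 h R) h r"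
      by (simp add: pot_def)
    finally have "((\<lambda>s. if s \<in> {0..R} then ?f s else 0) has_integral 4 * pot (mom 1 h R) h r) UNIV"
      unfolding has_integral_restrict_UNIV .
    also have "(\<lambda>s. if s \<in> {0..R} then ?f s else 0) = (\<lambda>s. indicator {..R} s *\<^sub>R ?F s)"
      by (auto simp: fun_eq_iff indicator_def)
    finally have "((\<lambda>s. indicator {..R} s *\<^sub>R ?F s) has_integral 4 * pot (mom 1 h R) h r) UNIV" .
    moreover have "((\<lambda>s. indicator {..R} s *\<^sub>R ?F s) has_integral (LINT s|lborel. indicator {..R} s *\<^sub>R ?F s)) UNIV"
      by (intro has_integral_integral_lborel integrable_mult_indicator int) auto
    ultimately show ?thesis by (rule has_integral_unique[symmetric])
  qed
  have "((\<lambda>R. LINT s|lborel. indicator {..R} s *\<^sub>R ?F s) \<longlongrightarrow> (LINT s|lborel. ?F s)) at_top"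
    by (rule tendsto_integral_at_top[OF _ int]) simp
  moreover have "((\<lambda>R. LINT s|lborel. indicator {..R} s *\<^sub>R ?F s) \<longlongrightarrow> 4 * pot c h r) at_top"
  proof (rule Lim_transform_eventually)
    show "((\<lambda>R. 4 * pot (mom 1 h R) h r) \<longlongrightarrow> 4 * pot c h r) at_top"
      unfolding pot_def by (intro tendsto_intros c)
    show "\<forall>\<^sub>F R in at_top. 4 * pot (mom 1 h R) h r = (LINT s|lborel. indicator {..R} s *\<^sub>R ?F s)"
      using eventually_ge_at_top[of r] by eventually_elim (rule trunc[symmetric])
  qed
  ultimately show ?thesis by (rule tendsto_unique[rotated]) simp
qed

lemma half_line_integral_mom:
  assumes h: "continuous_on {0..} h" and R: "R \<ge> 0" and k: "k > 0"
  shows "integrable lborel (\<lambda>s. indicator {0<..} s * (s ^ k * h s) * indicator {..R} s)"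
    and "(LINT s|lborel. indicator {0<..} s * (s ^ k * h s) * indicator {..R} s) = mom k h R"
proof -
  \<comment> \<open>Including the endpoint 0 changes nothing pointwise, since \<open>s ^ k\<close>
    vanishes there for \<open>k > 0\<close>.\<close>
  have eq: "(\<lambda>s. indicator {0<..} s * (s ^ k * h s) * indicator {..R} s) = (\<lambda>s. indicator {0..R} s *\<^sub>R (s ^ k * h s))"
    using k by (auto simp: fun_eq_iff indicator_def)
  have "set_integrable lborel {0..R} (\<lambda>s. s ^ k * h s)"
    by (rule borel_integrable_atLeastAtMost'[OF continuous_on_subset[OF continuous_on_mom_integrand[OF h]]]) auto
  then show "integrable lborel (\<lambda>s. indicator {0<..} s * (s ^ k * h s) * indicator {..R} s)"
    "(LINT s|lborel. indicator {0<..} s * (s ^ k * h s) * indicator {..R} s) = mom k h R"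
    unfolding eq mom_def using set_borel_integral_eq_integral(2)[of "{0..R}" "\<lambda>s. s ^ k * h s"]
    by (simp_all add: set_integrable_def set_lebesgue_integral_def)
qed

lemma mom_lim_of_integrable:
  assumes h: "continuous_on {0..} h" and k: "k > 0"
    and int: "integrable lborel (\<lambda>s. indicator {0<..} s * (s ^ k * h s))"
  shows "(mom k h \<longlongrightarrow> (LINT s|lborel. indicator {0<..} s * (s ^ k * h s))) at_top"
proof (rule Lim_transform_eventually)
  show "((\<lambda>R. LINT s|lborel. indicator {..R} s *\<^sub>R (indicator {0<..} s * (s ^ k * h s))) \<longlongrightarrow>
      (LINT s|lborel. indicator {0<..} s * (s ^ k * h s))) at_top"
    by (rule tendsto_integral_at_top[OF _ int]) simp
  show "\<forall>\<^sub>F R in at_top. (LINT s|lborel. indicator {..R} s *\<^sub>R (indicator {0<..} s * (s ^ k * h s))) = mom k h R"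
    using eventually_ge_at_top[of 0]
  proof eventually_elim
    case (elim R)
    then show ?case using half_line_integral_mom(2)[OF h elim k] by (simp add: mult_ac)
  qed
qed

lemma integrable_of_mom_lim:
  assumes h: "continuous_on {0..} h" "\<And>s. s \<ge> 0 \<Longrightarrow> h s \<ge> 0" and k: "k > 0"
    and hm [measurable]: "h \<in> borel_measurable borel"
    and lim: "(mom k h \<longlongrightarrow> L) at_top"
  shows "integrable lborel (\<lambda>s. indicator {0<..} s * (s ^ k * h s))"
proof (rule integrable_monotone_convergence_at_top)
  show "integrable lborel (\<lambda>s. indicator {0<..} s * (s ^ k * h s) * indicator {..R} s)" for R
  proof (cases "R \<ge> 0")
    case False
    then have "(\<lambda>s. indicator {0<..} s * (s ^ k * h s) * indicator {..R} s) = (\<lambda>s. 0)"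
      by (auto simp: fun_eq_iff indicator_def)
    then show ?thesis by simp
  qed (rule half_line_integral_mom(1)[OF h(1) _ k])
  show "((\<lambda>R. LINT s|lborel. indicator {0<..} s * (s ^ k * h s) * indicator {..R} s) \<longlongrightarrow> L) at_top"
    by (rule Lim_transform_eventually[OF lim]) 
       (use half_line_integral_mom(2)[OF h(1) _ k] in \<open>auto intro!: eventually_mono[OF eventually_ge_at_top[of 0]]\<close>)
qed (use h(2) in \<open>auto simp: indicator_def\<close>)

context radial_solution
begin

lemma mom3_lim: "(mom 3 h \<longlongrightarrow> Jinf) at_top"
proof (rule Lim_transform_eventually[OF filterlim_compose[OF J_at_top ln_at_top]])
  show "\<forall>\<^sub>F r in at_top. J (ln r) = mom 3 h r"
    using eventually_gt_at_top[of 0] by eventually_elim (simp add: J_def)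
qed

end

section \<open>Dilations\<close>

lemma has_integral_scale:
  fixes f :: "real \<Rightarrow> real"
  assumes "continuous_on {0..} f" "l > 0" "r \<ge> 0"
  shows "((\<lambda>s. l * f (l * s)) has_integral integral {0..l * r} f) {0..r}"
proof -
  have "((\<lambda>s. l *\<^sub>R f (l * s)) has_integral integral {l * 0..l * r} f) {0..r}"
    by (rule has_integral_substitution[where c = 0 and d = "l * r"])
       (use assms in \<open>auto intro!: derivative_eq_intros intro: continuous_on_subset\<close>)
  then show ?thesis by simp
qed

text \<open>The relation between \<open>l\<close> and \<open>d\<close> normalises the weight, and
  the density becomes \<open>l ^ 4 * h (l * s)\<close>. Third moments, hence the mass, are dilation
  invariant. The clamp \<open>max 0 s\<close> makes \<open>V\<close> continuous on the whole
  line.\<close>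

lemma radial_solution_rescale:
  assumes sol: "radial_solution p d C c u" and l: "l > 0" "d = l powr (- (4 * p))"
  defines "V \<equiv> \<lambda>s. u (l * max 0 s) + ln l"
  shows "radial_solution p 1 (C + ln l) (l\<^sup>2 * c) V" "radial_solution.\<beta> p 1 V = radial_solution.\<beta> p d u"
proof -
  interpret S: radial_solution p d C c u by (rule sol)
  let ?H = "radial_density p 1 V"
  have H: "?H s = l ^ 4 * S.h (l * s)" if "s \<ge> 0" for s
  proof -
    have "d * (l * s) powr (4 * p) = s powr (4 * p)"
      using l that by (simp add: powr_mult powr_minus)
    moreover have "exp (4 * V s) = l ^ 4 * exp (4 * u (l * s))"
      using l that exp_of_nat_mult[of 4 "ln l"] by (simp add: V_def distrib_left exp_add mult.commute)
    ultimately show ?thesis by (simp add: radial_density_def weight_def)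
  qed
  have cV: "continuous_on {0..} V"
    unfolding V_def using l
    by (intro continuous_intros continuous_on_compose2[OF S.cont_u]) (auto simp: max_def)
  have mom: "l ^ k * mom k ?H r = l ^ 3 * mom k S.h (l * r)" if "r \<ge> 0" for k r
  proof -
    have "((\<lambda>s. l ^ 3 * (l * ((l * s) ^ k * S.h (l * s)))) has_integral l ^ 3 * mom k S.h (l * r)) {0..r}"
      unfolding mom_def
      by (intro has_integral_mult_right has_integral_scale continuous_on_mom_integrand S.cont_h l that)
    then have "((\<lambda>s. l ^ k * (s ^ k * ?H s)) has_integral l ^ 3 * mom k S.h (l * r)) {0..r}"
      by (rule has_integral_eq[rotated]) (simp add: H power_mult_distrib eval_nat_numeral mult_ac)
    then have "integral {0..r} (\<lambda>s. l ^ k * (s ^ k * ?H s)) = l ^ 3 * mom k S.h (l * r)"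
      by (rule integral_unique)
    then show ?thesis by (simp add: mom_def)
  qed
  have lmom: "lmom ?H r = lmom S.h (l * r) - ln l * mom 3 S.h (l * r)" if "r \<ge> 0" for r
  proof -
    let ?f = "\<lambda>t. t ^ 3 * ln t * S.h t - ln l * (t ^ 3 * S.h t)"
    have c: "continuous_on {0..} ?f"
      by (intro continuous_intros continuous_on_lmom_integrand continuous_on_mom_integrand S.cont_h)
    have "integral {0..l * r} ?f = lmom S.h (l * r) - ln l * mom 3 S.h (l * r)"
      unfolding lmom_def mom_def
      by (intro integral_unique has_integral_diff has_integral_mult_right integrable_integral
          integrable_on_cont_half_line continuous_on_lmom_integrand continuous_on_mom_integrand S.cont_h)
    moreover have "((\<lambda>s. l * ?f (l * s)) has_integral integral {0..l * r} ?f) {0..r}"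
      by (rule has_integral_scale[OF c l(1) that])
    then have "((\<lambda>s. s ^ 3 * ln s * ?H s) has_integral integral {0..l * r} ?f) {0..r}"
    proof (rule has_integral_eq[rotated])
      fix s assume s: "s \<in> {0..r}"
      show "l * ?f (l * s) = s ^ 3 * ln s * ?H s"
      proof (cases "s = 0")
        case False
        then have "ln (l * s) = ln l + ln s" using l s by (simp add: ln_mult)
        then show ?thesis using s by (simp add: H power_mult_distrib algebra_simps eval_nat_numeral)
      qed simp
    qed
    ultimately show ?thesis unfolding lmom_def by (simp add: integral_unique)
  qed
  have mom1: "mom 1 ?H r = l\<^sup>2 * mom 1 S.h (l * r)" if "r \<ge> 0" for r
    using mom[OF that, of 1] l by (simp add: power2_eq_square power3_eq_cube)
  have mom3: "mom 3 ?H r = mom 3 S.h (l * r)" if "r \<ge> 0" for r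
    using mom[OF that, of 3] l by simp
  have mom5: "l\<^sup>2 * mom 5 ?H r = mom 5 S.h (l * r)" if "r \<ge> 0" for r
    using mom[OF that, of 5] l by (simp add: eval_nat_numeral)
  show sV: "radial_solution p 1 (C + ln l) (l\<^sup>2 * c) V"
  proof
    show "p > 0" by (rule S.p_pos)
    show "(0::real) \<le> 1" by simp
    show "continuous_on {0..} V" by (rule cV)
    have "((\<lambda>r. l\<^sup>2 * mom 1 S.h (l * r)) \<longlongrightarrow> l\<^sup>2 * c) at_top"
      by (intro tendsto_intros filterlim_compose[OF S.mom1_lim] filterlim_tendsto_pos_mult_at_top[OF tendsto_const l(1)] filterlim_ident)
    then show "(mom 1 ?H \<longlongrightarrow> l\<^sup>2 * c) at_top"
      by (rule Lim_transform_eventually) (use mom1 in \<open>auto intro!: eventually_mono[OF eventually_ge_at_top[of 0]]\<close>)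
    fix r :: real assume r: "r > 0"
    \<comment> \<open>The term \<open>ln l * mom 3\<close> from \<open>lmom\<close> cancels against
      the one in \<open>ln (l * r) = ln l + ln r\<close>; the remaining powers of \<open>l\<close>
      match.\<close>
    have "pot (l\<^sup>2 * c) ?H r = pot c S.h (l * r)"
    proof -
      have "mom 5 ?H r / (16 * r\<^sup>2) = mom 5 S.h (l * r) / (16 * (l * r)\<^sup>2)"
        using mom5[of r] r l by (simp add: field_simps power_mult_distrib)
      then show ?thesis
        unfolding pot_def using r l(1)
        by (simp add: lmom mom1 mom3 ln_mult algebra_simps add_divide_distrib
            diff_divide_distrib power_mult_distrib del: One_nat_def)
    qed
    then show "V r = C + ln l + pot (l\<^sup>2 * c) ?H r"
      using S.u_eq[of "l * r"] r l by (simp add: V_def)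
  qed
  interpret R: radial_solution p 1 "C + ln l" "l\<^sup>2 * c" V by (rule sV)
  have "(mom 3 ?H \<longlongrightarrow> S.Jinf) at_top"
  proof (rule Lim_transform_eventually)
    show "((\<lambda>r. mom 3 S.h (l * r)) \<longlongrightarrow> S.Jinf) at_top"
      by (intro filterlim_compose[OF S.mom3_lim] filterlim_tendsto_pos_mult_at_top[OF tendsto_const l(1)] filterlim_ident)
  qed (use mom3 in \<open>auto intro!: eventually_mono[OF eventually_ge_at_top[of 0]]\<close>)
  then have "R.Jinf = S.Jinf" using R.mom3_lim by (rule tendsto_unique[rotated, symmetric]) simp
  then show "radial_solution.\<beta> p 1 V = radial_solution.\<beta> p d u" by (simp add: R.\<beta>_def S.\<beta>_def)
qed

lemma conf_density_radial: "conf_density p (\<lambda>x. u (norm x)) y = radial_density p 1 u (norm y)"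
  by (simp add: conf_density_def radial_density_def weight_def)

text \<open>As the unit sphere of \<open>real ^ 4\<close> has area \<open>2 * pi\<^sup>2\<close>,
  the normalised volume is a quarter of the full third moment, which is why \<open>\<beta>\<close>
  is \<open>Jinf / 4\<close>.\<close>

lemma normalisation: "2 / (fact 3 * vol_S4) = 1 / (8 * pi\<^sup>2)"
  by (simp add: vol_S4_def fact_numeral)

section \<open>Radial functions on four-space\<close>

context
  fixes p :: real and u :: "real \<Rightarrow> real"
  assumes p: "p > 0" and u: "continuous_on UNIV u"
begin

private abbreviation "h \<equiv> radial_density p 1 u"

lemma radial_density_props: 
  "continuous_on {0..} h" "h s \<ge> 0" "h \<in> borel_measurable borel"
proof -
  show "continuous_on {0..} h"
    unfolding radial_density_def[abs_def]
    by (intro continuous_intros continuous_on_weight p continuous_on_subset[OF u]) auto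
  show "h s \<ge> 0" using weight_ge_1[of 1 p s] by (simp add: radial_density_def)
  have [measurable]: "u \<in> borel_measurable borel" by (rule borel_measurable_continuous_onI[OF u])
  show "h \<in> borel_measurable borel"
    unfolding radial_density_def[abs_def] weight_def by measurable
qed

lemma integrable_conf_density_iff:
  "integrable lborel (conf_density p (\<lambda>x. u (norm x))) \<longleftrightarrow> integrable lborel (\<lambda>s. indicator {0<..} s * (s ^ 3 * h s))"
proof -
  have "integrable lborel (conf_density p (\<lambda>x. u (norm x))) \<longleftrightarrow> integrable lborel (\<lambda>y :: real ^ 4. h (norm y))"
    by (simp add: conf_density_radial[abs_def])
  also have "\<dots> \<longleftrightarrow> integrable lborel (\<lambda>s. (2 * pi\<^sup>2) * (indicator {0<..} s * (s ^ 3 * h s)))"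
    by (subst radial_integral(1)[OF radial_density_props(3)]) (simp add: mult_ac)
  also have "\<dots> \<longleftrightarrow> integrable lborel (\<lambda>s. indicator {0<..} s * (s ^ 3 * h s))"
    by (simp add: integrable_mult_left_iff)
  finally show ?thesis .
qed

context
  assumes int: "integrable lborel (conf_density p (\<lambda>x. u (norm x)))"
begin

lemma conf_volume_lim:
  "(mom 3 h \<longlongrightarrow> 4 * (2 / (fact 3 * vol_S4) * (LINT x|lborel. conf_density p (\<lambda>x. u (norm x)) x))) at_top"
proof -
  have "(LINT x|lborel. conf_density p (\<lambda>x. u (norm x)) x) = (LINT y|lborel. h (norm (y :: real ^ 4)))"
    by (simp add: conf_density_radial)
  also have "\<dots> = (LINT s|lborel. (2 * pi\<^sup>2) * (indicator {0<..} s * (s ^ 3 * h s)))"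
    by (subst radial_integral(2)[OF radial_density_props(3)]) (simp add: mult_ac)
  also have "\<dots> = (2 * pi\<^sup>2) * (LINT s|lborel. indicator {0<..} s * (s ^ 3 * h s))"
    by (rule Bochner_Integration.integral_mult_right_zero)
  finally have "4 * (2 / (fact 3 * vol_S4) * (LINT x|lborel. conf_density p (\<lambda>x. u (norm x)) x)) = (LINT s|lborel. indicator {0<..} s * (s ^ 3 * h s))"
    unfolding normalisation by simp
  then show ?thesis
    using mom_lim_of_integrable[OF radial_density_props(1) _ int[unfolded integrable_conf_density_iff]] by simp
qed

text \<open>Integrability controls the third moment; beyond radius 1 the first moment grows no
  faster.\<close>

lemma mom1_convergent: "\<exists>c. (mom 1 h \<longlongrightarrow> c) at_top"
proof -
  note hp = radial_density_props
  have mono: "mom k h s \<le> mom k h t" if "s \<le> t" for k s t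
  proof (cases "s < 0")
    case True
    then show ?thesis using mom_nonneg[of h k t] hp(2) by (simp add: mom_def)
  qed (intro mom_mono hp that, simp)
  define L where "L = 4 * (2 / (fact 3 * vol_S4) * (LINT x|lborel. conf_density p (\<lambda>x. u (norm x)) x))"
  have L: "mom 3 h r \<le> L" for r
    by (rule tendsto_lowerbound[OF conf_volume_lim[folded L_def] eventually_mono[OF eventually_ge_at_top[of r]]])
       (auto intro: mono)
  have "mom 1 h r \<le> mom 1 h 1 + L" for r
  proof (cases "r \<ge> 1")
    case True
    have "mom 1 h r - mom 1 h 1 \<le> mom 3 h r - mom 3 h 1"
      using mom_shift_bounds(1)[OF hp(1,2) _ True, of 1] by (simp add: numeral_3_eq_3)
    moreover have "mom 3 h 1 \<ge> 0" by (rule mom_nonneg[OF hp(2)])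
    ultimately show ?thesis using L[of r] by linarith
  next
    case False
    then have "mom 1 h r \<le> mom 1 h 1" by (intro mono) simp
    moreover have "0 \<le> L" using L[of 0] by simp
    ultimately show ?thesis by linarith
  qed
  then have "bdd_above (range (mom 1 h))" by (auto simp: bdd_above_def)
  then show ?thesis using tendsto_SUP_mono_at_top[of "mom 1 h", OF mono] by blast
qed

lemma log_potential_integrable:
  "integrable lborel (\<lambda>y. ln (norm y / norm (x - y)) * conf_density p (\<lambda>x. u (norm x)) y)"
  using integrable_log_quotient[OF radial_density_props(1,2,3)] int
  by (simp add: conf_density_radial[abs_def])

lemma log_potential_eq:
  assumes c: "(mom 1 h \<longlongrightarrow> c) at_top" and x: "x \<noteq> 0"
  shows "2 / (fact 3 * vol_S4) * (LINT y|lborel. ln (norm y / norm (x - y)) * conf_density p (\<lambda>x. u (norm x)) y) = pot c h (norm x)"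
proof -
  have i: "integrable lborel (\<lambda>y. ln (norm y / norm (x - y)) * h (norm y))"
    using log_potential_integrable[of x] by (simp add: conf_density_radial)
  note avg = log_average[OF x radial_density_props(3) i]
  have eq: "(\<lambda>s. indicator {0<..} s * (2 * pi\<^sup>2 * (s ^ 3 * log_kernel (norm x) s * h s))) =
      (\<lambda>s. (2 * pi\<^sup>2) * (indicator {0<..} s * (s ^ 3 * log_kernel (norm x) s * h s)))"
    by (simp add: mult_ac)
  have "integrable lborel (\<lambda>s. indicator {0<..} s * (s ^ 3 * log_kernel (norm x) s * h s))"
    using avg(1) unfolding eq by (simp add: integrable_mult_left_iff)
  from log_kernel_integral[OF radial_density_props(1) c _ this] x
  have "(LINT s|lborel. indicator {0<..} s * (s ^ 3 * log_kernel (norm x) s * h s)) = 4 * pot c h (norm x)" by simp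
  then have "(LINT y|lborel. ln (norm y / norm (x - y)) * h (norm y)) = (2 * pi\<^sup>2) * (4 * pot c h (norm x))"
    unfolding avg(2) eq by (simp only: Bochner_Integration.integral_mult_right_zero)
  then show ?thesis unfolding normalisation by (simp add: conf_density_radial)
qed

end
end

theorem corollary8p2:
  fixes p \<beta> :: real
  assumes "p > 0"
  shows "(\<exists>u :: real ^ 4 \<Rightarrow> real.
            radially_symmetric u \<and> continuous_on UNIV u \<and>
            integrable lborel (conf_density p u) \<and>
            (\<exists>C. solves_integral_eq p u C) \<and>
            2 / (fact 3 * vol_S4) * (LINT x|lborel. conf_density p u x) = \<beta>)
         \<longleftrightarrow> max 2 (2 * p) < \<beta> \<and> \<beta> < 2 + 2 * p"
proof
  assume "\<exists>u :: real ^ 4 \<Rightarrow> real.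
            radially_symmetric u \<and> continuous_on UNIV u \<and>
            integrable lborel (conf_density p u) \<and>
            (\<exists>C. solves_integral_eq p u C) \<and>
            2 / (fact 3 * vol_S4) * (LINT x|lborel. conf_density p u x) = \<beta>"
  then obtain u :: "real ^ 4 \<Rightarrow> real" and C where u: "radially_symmetric u" "continuous_on UNIV u"
    "integrable lborel (conf_density p u)" "solves_integral_eq p u C"
    "2 / (fact 3 * vol_S4) * (LINT x|lborel. conf_density p u x) = \<beta>"
    by blast
  \<comment> \<open>Any unit vector would do: restricting \<open>u\<close> to its line gives the
    radial profile.\<close>
  define e :: "real ^ 4" where "e = axis 1 1"
  have e: "norm e = 1" by (simp add: e_def)
  define U where "U s = u (s *\<^sub>R e)" for s
  have uU: "u = (\<lambda>x. U (norm x))"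
  proof
    fix x :: "real ^ 4"
    have "norm x = norm (norm x *\<^sub>R e)" using e by simp
    then show "u x = U (norm x)"
      using u(1) unfolding radially_symmetric_def U_def by blast
  qed
  have cU: "continuous_on UNIV U"
    unfolding U_def[abs_def] by (intro continuous_on_compose2[OF u(2)] continuous_intros) auto
  note int = u(3)[unfolded uU]
  obtain c where c: "(mom 1 (radial_density p 1 U) \<longlongrightarrow> c) at_top"
    using mom1_convergent[OF assms cU int] by blast
  interpret S: radial_solution p 1 C c U
  proof
    show "p > 0" by fact
    show "(0::real) \<le> 1" by simp
    show "continuous_on {0..} U" by (rule continuous_on_subset[OF cU]) simp
    show "(mom 1 (radial_density p 1 U) \<longlongrightarrow> c) at_top" by (rule c)
    fix r :: real assume r: "r > 0"
    have x: "r *\<^sub>R e \<noteq> 0" "norm (r *\<^sub>R e) = r" using r e by auto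
    have "u (r *\<^sub>R e) = pot c (radial_density p 1 U) r + C"
      using u(4)[unfolded solves_integral_eq_def, rule_format, of "r *\<^sub>R e", THEN conjunct2]
        log_potential_eq[OF assms cU int c x(1)] x(2)
      by (simp flip: uU)
    then show "U r = C + pot c (radial_density p 1 U) r" by (simp add: U_def)
  qed
  have "S.Jinf = 4 * \<beta>"
    using tendsto_unique[OF _ S.mom3_lim conf_volume_lim[OF assms cU int]] u(5) unfolding uU by simp
  then have "S.\<beta> = \<beta>" by (simp add: S.\<beta>_def)
  with S.\<beta>_bounds show "max 2 (2 * p) < \<beta> \<and> \<beta> < 2 + 2 * p" by simp
next
  assume b: "max 2 (2 * p) < \<beta> \<and> \<beta> < 2 + 2 * p"
  interpret pos_exponent p by unfold_locales (rule assms)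
  obtain d where d: "d > 0" "mass d = \<beta>" using mass_attained[of \<beta>] b by auto
  \<comment> \<open>The dilation factor that solves \<open>d = l powr (- (4 * p))\<close>.\<close>
  define l where "l = d powr (- 1 / (4 * p))"
  have l: "l > 0" "d = l powr (- (4 * p))" using d assms by (auto simp: l_def powr_powr)
  define V where "V s = sol d (l * max 0 s) + ln l" for s
  note sol = radial_solution_sol[OF less_imp_le[OF d(1)]]
  note resc = radial_solution_rescale[OF sol l, folded V_def[abs_def], simplified]
  interpret S: radial_solution p 1 "ln l" "l\<^sup>2 * crit d" V by (rule resc(1))
  have cV: "continuous_on UNIV V"
    unfolding V_def[abs_def] using l(1)
    by (intro continuous_intros continuous_on_compose2[OF radial_solution.cont_u[OF sol]]) auto
  note props = radial_density_props[OF assms cV]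
  define u where "u = (\<lambda>x :: real ^ 4. V (norm x))"
  have int: "integrable lborel (conf_density p (\<lambda>x. V (norm x)))"
    unfolding integrable_conf_density_iff[OF assms cV]
    by (rule integrable_of_mom_lim[OF props(1,2) _ props(3) S.mom3_lim]) simp
  have "radially_symmetric u" by (simp add: radially_symmetric_def u_def)
  moreover have "continuous_on UNIV u"
    unfolding u_def by (intro continuous_on_compose2[OF cV] continuous_intros) auto
  moreover have "integrable lborel (conf_density p u)" using int by (simp add: u_def)
  moreover have "solves_integral_eq p u (ln l)"
    unfolding solves_integral_eq_def
  proof (intro allI conjI)
    fix x :: "real ^ 4"
    show "integrable lborel (\<lambda>y. ln (norm y / norm (x - y)) * conf_density p u y)"
      unfolding u_def by (rule log_potential_integrable[OF assms cV int])
    show "u x = 2 / (fact 3 * vol_S4) * (LINT y|lborel. ln (norm y / norm (x - y)) * conf_density p u y) + ln l"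
    proof (cases "x = 0")
      case True
      \<comment> \<open>At the origin the logarithmic integrand vanishes identically, so the
        equation reduces to \<open>u 0 = ln l\<close>.\<close>
      have "sol d 0 = 0"
        using U_eq[of d 0 "crit d"] d by (simp add: sol_def)
      moreover have "ln (norm y / norm (0 - y)) = 0" for y :: "real ^ 4" by simp
      ultimately show ?thesis using True by (simp add: u_def V_def)
    next
      case False
      then show ?thesis
        using log_potential_eq[OF assms cV int S.mom1_lim False] S.u_eq[of "norm x"]
        by (simp add: u_def)
    qed
  qed
  moreover have "2 / (fact 3 * vol_S4) * (LINT x|lborel. conf_density p u x) = \<beta>"
  proof -
    have "S.Jinf = 4 * \<beta>" using resc(2) d(2) by (simp add: S.\<beta>_def mass_def)
    then show ?thesis
      using tendsto_unique[OF _ S.mom3_lim conf_volume_lim[OF assms cV int]] by (simp add: u_def)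
  qed
  ultimately show "\<exists>u :: real ^ 4 \<Rightarrow> real.
            radially_symmetric u \<and> continuous_on UNIV u \<and>
            integrable lborel (conf_density p u) \<and>
            (\<exists>C. solves_integral_eq p u C) \<and>
            2 / (fact 3 * vol_S4) * (LINT x|lborel. conf_density p u x) = \<beta>"
    by blast
qed

end
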